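(* Let $\Omega\subset\mathbb{R}^n$, $n\ge 2$, be a bounded region, let $a\in L^2(\Omega)$ be a non-negative function, let $f\in H^{1/2}(\partial\Omega)$, and let $\lambda>0$. Assume that the minimization problem $$\min\Big\{\int_\Omega a(x)|\nabla v|\,dx:\ v\in H^1(\Omega),\ v|_{\partial\Omega}=f\Big\}\qquad (\ast)$$ has an optimal solution in $H^1(\Omega)$. Then for any $u_f\in H^1(\Omega)$ with $u_f|_{\partial\Omega}=f$ and any $b^0,d^0\in (L^2(\Omega))^n$, the sequences $\{b^k\}$, $\{d^k\}$ and $\{u^k\}$ produced by Algorithm 1 (described in the context) converge weakly to some $\hat b$, $\hat d$ and $\hat u$, respectively ($b^k,d^k$ in $(L^2(\Omega))^n$ and $u^k$ in $H^1_0(\Omega)$). Moreover $\{\nabla u^{k+1}-d^k\}_k$ converges strongly to zero in $(L^2(\Omega))^n$ and $$\sum_{k=0}^\infty\|\nabla u^{k+1}-d^k\|^2<\infty .$$ Furthermore $\bar u:=\hat u+u_f$ is a solution of the minimization problem $(\ast)$, $\hat d=\nabla\hat u$, $\nabla\cdot\hat b\equiv 0$, and $$\hat b=\frac1\lambda\, a\,\frac{\nabla\bar u}{|\nabla\bar u|}\quad\text{a.e. in } \Omega\setminus\{x:\ |\nabla\bar u(x)|=0,\ a(x)\ne 0\},$$ where the right-hand side is read as $0$ at points where $a(x)=0$.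
   Context: Boundary values are understood in the sense of traces: with a fixed $u_f\in H^1(\Omega)$ satisfying $u_f|_{\partial\Omega}=f$, the condition $v|_{\partial\Omega}=f$ means $v-u_f\in H^1_0(\Omega)$. $\|\cdot\|$ is the norm of $(L^2(\Omega))^n$, and $\nabla\cdot$ denotes the distributional divergence. Algorithm 1 (alternating split Bregman algorithm, with parameter $\lambda>0$): given $u_f$, $b^0,d^0$ as in the claim, for $k=0,1,2,\dots$: (1) let $u^{k+1}\in H^1_0(\Omega)$ be the weak solution of $\Delta u^{k+1}=\nabla\cdot(d^k-b^k)$ in $\Omega$, $u^{k+1}|_{\partial\Omega}=0$; (2) with $w^{k+1}:=\nabla u^{k+1}+\nabla u_f+b^k$, set $$d^{k+1}(x):=\begin{cases}\max\{|w^{k+1}(x)|-\frac{a(x)}{\lambda},0\}\,\frac{w^{k+1}(x)}{|w^{k+1}(x)|}-\nabla u_f(x) & \text{if } |w^{k+1}(x)|\neq0,\\ -\nabla u_f(x) & \text{if } |w^{k+1}(x)|=0;\end{cases}$$ (3) set $b^{k+1}:=b^k+\nabla u^{k+1}-d^{k+1}$. *)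

theory Defs
  imports "HOL-Analysis.Analysis"
begin

(* Elements of Lebesgue and Sobolev spaces are represented by functions on the whole of R^n.
   Only their values almost everywhere in \<Omega> matter: every integral below is taken with
   respect to lebesgue_on \<Omega>. *)

section \<open>Square-integrable functions\<close>

definition L2 :: "(real^'n) set \<Rightarrow> (real^'n \<Rightarrow> 'b::euclidean_space) set" where
  "L2 \<Omega> = {F. F \<in> borel_measurable (lebesgue_on \<Omega>) \<and>
              integrable (lebesgue_on \<Omega>) (\<lambda>x. (norm (F x))\<^sup>2)}"

definition L2_inner ::
    "(real^'n) set \<Rightarrow> (real^'n \<Rightarrow> 'b::euclidean_space) \<Rightarrow> (real^'n \<Rightarrow> 'b) \<Rightarrow> real" where
  "L2_inner \<Omega> F G = (LINT x|lebesgue_on \<Omega>. F x \<bullet> G x)"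

definition L2_norm :: "(real^'n) set \<Rightarrow> (real^'n \<Rightarrow> 'b::euclidean_space) \<Rightarrow> real" where
  "L2_norm \<Omega> F = sqrt (L2_inner \<Omega> F F)"

(* Weak convergence in a Hilbert space H with inner product ip. *)
definition weakly_converges ::
    "'v set \<Rightarrow> ('v \<Rightarrow> 'v \<Rightarrow> real) \<Rightarrow> (nat \<Rightarrow> 'v) \<Rightarrow> 'v \<Rightarrow> bool" where
  "weakly_converges H ip X L \<longleftrightarrow>
     (\<forall>k. X k \<in> H) \<and> L \<in> H \<and> (\<forall>y\<in>H. (\<lambda>k. ip (X k) y) \<longlonglongrightarrow> ip L y)"


section \<open>Test functions and distributional derivatives\<close>

definition partial_deriv :: "'n \<Rightarrow> (real^'n \<Rightarrow> real) \<Rightarrow> real^'n \<Rightarrow> real" where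
  "partial_deriv i \<phi> x = frechet_derivative \<phi> (at x) (axis i 1)"

definition grad :: "(real^'n \<Rightarrow> real) \<Rightarrow> real^'n \<Rightarrow> real^'n" where
  "grad \<phi> x = (\<chi> i. partial_deriv i \<phi> x)"

fun C_k :: "nat \<Rightarrow> (real^'n \<Rightarrow> real) \<Rightarrow> bool" where
  "C_k 0 \<phi> \<longleftrightarrow> continuous_on UNIV \<phi>"
| "C_k (Suc k) \<phi> \<longleftrightarrow> (\<forall>x. \<phi> differentiable (at x)) \<and> (\<forall>i. C_k k (partial_deriv i \<phi>))"

(* C_c^\<infinity>(\<Omega>), each function being extended by zero to R^n. *)
definition test_functions :: "(real^'n) set \<Rightarrow> (real^'n \<Rightarrow> real) set" where
  "test_functions \<Omega> = {\<phi>. (\<forall>k. C_k k \<phi>) \<and>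
     compact (closure {x. \<phi> x \<noteq> 0}) \<and> closure {x. \<phi> x \<noteq> 0} \<subseteq> \<Omega>}"

definition has_weak_grad ::
    "(real^'n) set \<Rightarrow> (real^'n \<Rightarrow> real) \<Rightarrow> (real^'n \<Rightarrow> real^'n) \<Rightarrow> bool" where
  "has_weak_grad \<Omega> u g \<longleftrightarrow>
     (\<forall>\<phi>\<in>test_functions \<Omega>. \<forall>i.
        (LINT x|lebesgue_on \<Omega>. u x * partial_deriv i \<phi> x) = - (LINT x|lebesgue_on \<Omega>. g x $ i * \<phi> x))"

(* The distributional divergence of a field F in L2 \<Omega>, as a functional on test functions. *)
definition distr_div ::
    "(real^'n) set \<Rightarrow> (real^'n \<Rightarrow> real^'n) \<Rightarrow> (real^'n \<Rightarrow> real) \<Rightarrow> real" where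
  "distr_div \<Omega> F \<phi> = - (LINT x|lebesgue_on \<Omega>. F x \<bullet> grad \<phi> x)"


section \<open>Sobolev spaces and traces\<close>

definition H1 :: "(real^'n) set \<Rightarrow> (real^'n \<Rightarrow> real) set" where
  "H1 \<Omega> = {u \<in> L2 \<Omega>. \<exists>g\<in>L2 \<Omega>. has_weak_grad \<Omega> u g}"

(* For u in H1 \<Omega>: a representative of the weak gradient, which is unique almost everywhere
   in \<Omega>. *)
definition wgrad :: "(real^'n) set \<Rightarrow> (real^'n \<Rightarrow> real) \<Rightarrow> real^'n \<Rightarrow> real^'n" where
  "wgrad \<Omega> u = (SOME g. g \<in> L2 \<Omega> \<and> has_weak_grad \<Omega> u g)"

definition H1_inner ::
    "(real^'n) set \<Rightarrow> (real^'n \<Rightarrow> real) \<Rightarrow> (real^'n \<Rightarrow> real) \<Rightarrow> real" where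
  "H1_inner \<Omega> u v = L2_inner \<Omega> u v + L2_inner \<Omega> (wgrad \<Omega> u) (wgrad \<Omega> v)"

definition H1_norm :: "(real^'n) set \<Rightarrow> (real^'n \<Rightarrow> real) \<Rightarrow> real" where
  "H1_norm \<Omega> u = sqrt (H1_inner \<Omega> u u)"

(* The closure of the test functions in H1 \<Omega>. *)
definition H10 :: "(real^'n) set \<Rightarrow> (real^'n \<Rightarrow> real) set" where
  "H10 \<Omega> = {u \<in> H1 \<Omega>. \<exists>\<phi>. (\<forall>k::nat. \<phi> k \<in> test_functions \<Omega>) \<and>
                          (\<lambda>k. H1_norm \<Omega> (\<lambda>x. \<phi> k x - u x)) \<longlonglongrightarrow> 0}"

(* No regularity of the boundary is assumed.  Two functions in H1 \<Omega> have the same boundary values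
   iff their difference lies in H10 \<Omega>; the trace of v is its class modulo H10 \<Omega>, and the space
   H^{1/2} of boundary data is the range H1 \<Omega> / H10 \<Omega> of the trace operator. *)
definition bdry_trace :: "(real^'n) set \<Rightarrow> (real^'n \<Rightarrow> real) \<Rightarrow> (real^'n \<Rightarrow> real) set" where
  "bdry_trace \<Omega> v = {w \<in> H1 \<Omega>. (\<lambda>x. w x - v x) \<in> H10 \<Omega>}"

definition H_half :: "(real^'n) set \<Rightarrow> (real^'n \<Rightarrow> real) set set" where
  "H_half \<Omega> = bdry_trace \<Omega> ` H1 \<Omega>"


section \<open>The weighted least gradient problem\<close>

definition energy ::
    "(real^'n) set \<Rightarrow> (real^'n \<Rightarrow> real) \<Rightarrow> (real^'n \<Rightarrow> real) \<Rightarrow> real" where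
  "energy \<Omega> a v = (LINT x|lebesgue_on \<Omega>. a x * norm (wgrad \<Omega> v x))"

definition least_gradient_solution ::
    "(real^'n) set \<Rightarrow> (real^'n \<Rightarrow> real) \<Rightarrow> (real^'n \<Rightarrow> real) set \<Rightarrow> (real^'n \<Rightarrow> real) \<Rightarrow> bool" where
  "least_gradient_solution \<Omega> a f v \<longleftrightarrow>
     v \<in> H1 \<Omega> \<and> bdry_trace \<Omega> v = f \<and>
     (\<forall>w\<in>H1 \<Omega>. bdry_trace \<Omega> w = f \<longrightarrow> energy \<Omega> a v \<le> energy \<Omega> a w)"


section \<open>The alternating split Bregman algorithm\<close>

(* Weak solution of \<Delta> u = \<nabla>\<cdot>F in \<Omega>, u = 0 on the boundary. *)
definition weak_poisson_solution ::
    "(real^'n) set \<Rightarrow> (real^'n \<Rightarrow> real^'n) \<Rightarrow> (real^'n \<Rightarrow> real) \<Rightarrow> bool" where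
  "weak_poisson_solution \<Omega> F u \<longleftrightarrow>
     u \<in> H10 \<Omega> \<and>
     (\<forall>\<psi>\<in>H10 \<Omega>. L2_inner \<Omega> (wgrad \<Omega> u) (wgrad \<Omega> \<psi>) = L2_inner \<Omega> F (wgrad \<Omega> \<psi>))"

(* The iterates are elements of L2, so they are prescribed up to null sets; u 0 is not used by the
   algorithm and is unconstrained. *)
definition split_bregman ::
    "(real^'n) set \<Rightarrow> (real^'n \<Rightarrow> real) \<Rightarrow> real \<Rightarrow> (real^'n \<Rightarrow> real) \<Rightarrow>
     (nat \<Rightarrow> real^'n \<Rightarrow> real) \<Rightarrow> (nat \<Rightarrow> real^'n \<Rightarrow> real^'n) \<Rightarrow> (nat \<Rightarrow> real^'n \<Rightarrow> real^'n) \<Rightarrow> bool" where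
  "split_bregman \<Omega> a lam uf u d b \<longleftrightarrow> (\<forall>k.
     weak_poisson_solution \<Omega> (\<lambda>x. d k x - b k x) (u (Suc k)) \<and>
     (AE x in lebesgue_on \<Omega>.
        let w = wgrad \<Omega> (u (Suc k)) x + wgrad \<Omega> uf x + b k x in
        d (Suc k) x =
          (if norm w \<noteq> 0 then max (norm w - a x / lam) 0 *\<^sub>R (w /\<^sub>R norm w) - wgrad \<Omega> uf x
           else - wgrad \<Omega> uf x)) \<and>
     (AE x in lebesgue_on \<Omega>. b (Suc k) x = b k x + wgrad \<Omega> (u (Suc k)) x - d (Suc k) x))"

end

theory Submission
  imports Defs
begin

text \<open>
The algorithm is a splitting iteration for a monotone inclusion in the Hilbert space of
square-integrable fields. Let V be the space of gradients of functions in H10, and let A consist of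
the pairs (d, b) for which b is a subgradient at d of the convex functional that maps y to
the integral of (a/\<lambda>) |y + \<nabla>u_f|. Pointwise this means |b| \<le> a/\<lambda> and
b \<bullet> (d + \<nabla>u_f) = (a/\<lambda>) |d + \<nabla>u_f|. The Poisson problem makes \<nabla>u^{k+1} the orthogonal
projection of d^k - b^k onto V. Soft thresholding is the resolvent of A, so the other two steps
split \<nabla>u^{k+1} + b^k as d^{k+1} + b^{k+1} with (d^{k+1}, b^{k+1}) in A.

The limits are sought among the saddle points: pairs with (d, b) in A, d in V and b orthogonal to V.
The subgradient inequality shows that the d of a saddle point gives a minimizer. Conversely, every
minimizer d carries such a b. The subgradients at d form a bounded closed convex set, one of
them is nonnegative on any given direction of V because d is a minimizer, and a separation argument
with weak compactness then yields one that is orthogonal to V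
(lemma minimizer_has_orthogonal_subgradient). This is where the assumed minimizer is used.

For every saddle point the squared distance of (b^k, d^k) to it drops by at least
|\<nabla>u^{k+1} - d^k|^2 in each step (lemma energy_decrease). So these squares are summable and the iterates
are bounded. Every weak cluster point is a saddle point (lemma weak_cluster_saddle): the inner products
of b^k and d^k tend to 0, so monotonicity survives the weak limit, and a monotone
relation whose resolvent is defined everywhere is maximal. Since the distances to all saddle points
converge, there is only one weak cluster point (lemma opial_weak_convergence), and the iterates
converge weakly to it. The formula for the limit of b^k is the equality case of the Cauchy-Schwarz
inequality.

The analytic input is that V is closed. It follows from the completeness of the space of
square-integrable fields, the Poincare inequality, and the uniqueness of weak gradients, which is
the fundamental lemma of the calculus of variations. One Hilbert space, of classes of fields
on all of the Euclidean space, serves for all domains: fields on a domain are extended by zero.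
\<close>

section \<open>Weak topology of a Hilbert space\<close>

text \<open>
A minimizing sequence is Cauchy by the parallelogram identity: the midpoint of two nearly nearest
points lies in the set, so it cannot be nearer than the infimum.
\<close>

lemma closed_convex_nearest_point:
  fixes S :: "'h::{real_inner,complete_space} set"
  assumes "closed S" "convex S" "S \<noteq> {}"
  obtains p where "p \<in> S" "\<And>y. y \<in> S \<Longrightarrow> (x - p) \<bullet> (y - p) \<le> 0"
proof -
  define m where "m = (INF y\<in>S. norm (x - y))"
  have bdd: "bdd_below ((\<lambda>y. norm (x - y)) ` S)"
    by (rule bdd_belowI[of _ 0]) auto
  have m_le: "m \<le> norm (x - y)" if "y \<in> S" for y
    unfolding m_def using bdd that by (rule cINF_lower)
  have m0: "0 \<le> m"
    unfolding m_def using assms(3) by (intro cINF_greatest) auto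
  have "\<exists>y\<in>S. norm (x - y) < m + 1 / Suc n" for n
    using cINF_less_iff[OF assms(3) bdd, of "m + 1 / Suc n"] by (simp add: m_def)
  then obtain Y where Y: "Y n \<in> S" "norm (x - Y n) < m + 1 / Suc n" for n
    by metis
  have near: "(norm (Y i - Y j))\<^sup>2 \<le> 4 * (2 * m + 1) * (1 / Suc n)" if "n \<le> i" "n \<le> j" for i j n
  proof -
    have small: "(norm (x - Y k))\<^sup>2 \<le> m\<^sup>2 + (2 * m + 1) * (1 / Suc n)" if "n \<le> k" for k
    proof -
      have "1 / real (Suc k) \<le> 1 / real (Suc n)"
        using that by (intro divide_left_mono) auto
      then have "norm (x - Y k) \<le> m + 1 / Suc n"
        using Y(2)[of k] by linarith
      then have "(norm (x - Y k))\<^sup>2 \<le> (m + 1 / Suc n)\<^sup>2"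
        by (rule power_mono) simp
      also have "\<dots> = m\<^sup>2 + 2 * m * (1 / Suc n) + (1 / Suc n) * (1 / Suc n)"
        by (simp add: power2_eq_square algebra_simps add_divide_distrib)
      also have "\<dots> \<le> m\<^sup>2 + 2 * m * (1 / Suc n) + 1 * (1 / Suc n)"
        by (intro add_left_mono mult_right_mono) auto
      finally show ?thesis
        by (simp add: algebra_simps)
    qed
    have "(1/2) *\<^sub>R Y i + (1/2) *\<^sub>R Y j \<in> S"
      using assms(2) Y(1) by (intro convexD) auto
    then have "m\<^sup>2 \<le> (norm (x - ((1/2) *\<^sub>R Y i + (1/2) *\<^sub>R Y j)))\<^sup>2"
      using m_le m0 by (intro power_mono) auto
    moreover have "(norm (Y i - Y j))\<^sup>2 = 2 * (norm (x - Y i))\<^sup>2 + 2 * (norm (x - Y j))\<^sup>2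
        - 4 * (norm (x - ((1/2) *\<^sub>R Y i + (1/2) *\<^sub>R Y j)))\<^sup>2"
      unfolding power2_norm_eq_inner by (simp add: algebra_simps inner_commute)
    moreover note small[OF that(1)] small[OF that(2)]
    ultimately have "(norm (Y i - Y j))\<^sup>2 \<le> 4 * ((2 * m + 1) * (1 / Suc n))"
      by linarith
    then show ?thesis
      by (simp only: mult.assoc)
  qed
  have "Cauchy Y"
  proof (rule metric_CauchyI)
    fix e :: real
    assume "e > 0"
    then have "e\<^sup>2 / (4 * (2 * m + 1)) > 0"
      using m0 by simp
    then obtain n where n: "1 / real (Suc n) < e\<^sup>2 / (4 * (2 * m + 1))"
      using nat_approx_posE by blast
    have "dist (Y i) (Y j) < e" if "n \<le> i" "n \<le> j" for i j
    proof -
      have "4 * (2 * m + 1) * (1 / Suc n) < e\<^sup>2"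
        using n m0 by (simp add: field_simps)
      then have "(norm (Y i - Y j))\<^sup>2 < e\<^sup>2"
        using near[OF that] by linarith
      then show ?thesis
        using \<open>e > 0\<close> by (simp add: dist_norm power2_less_imp_less)
    qed
    then show "\<exists>M. \<forall>i\<ge>M. \<forall>j\<ge>M. dist (Y i) (Y j) < e"
      by blast
  qed
  then obtain p where p: "Y \<longlonglongrightarrow> p"
    using Cauchy_convergent convergent_def by blast
  have pS: "p \<in> S"
    using closed_sequentially[OF assms(1)] Y(1) p by blast
  have "norm (x - p) \<le> m"
  proof (rule LIMSEQ_le)
    show "(\<lambda>n. norm (x - Y n)) \<longlonglongrightarrow> norm (x - p)"
      by (intro tendsto_intros p)
    show "(\<lambda>n. m + 1 / Suc n) \<longlonglongrightarrow> m"
      using tendsto_add[OF tendsto_const LIMSEQ_inverse_real_of_nat, of m] by (simp add: inverse_eq_divide)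
    show "\<exists>N. \<forall>n\<ge>N. norm (x - Y n) \<le> m + 1 / real (Suc n)"
      using Y(2) less_imp_le by blast
  qed
  then have "\<forall>z\<in>S. dist x p \<le> dist x z"
    using m_le by (force simp: dist_norm)
  then show ?thesis
    using that pS any_closest_point_dot[OF assms(2,1) pS] by blast
qed

lemma closed_subspace_decompose:
  fixes V :: "'h::{real_inner,complete_space} set"
  assumes "subspace V" "closed V"
  obtains p where "p \<in> V" "\<And>v. v \<in> V \<Longrightarrow> (x - p) \<bullet> v = 0"
proof -
  obtain p where p: "p \<in> V" "\<And>y. y \<in> V \<Longrightarrow> (x - p) \<bullet> (y - p) \<le> 0"
    using closed_convex_nearest_point[OF assms(2) subspace_imp_convex[OF assms(1)]]
      subspace_0[OF assms(1)] by blast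
  have "(x - p) \<bullet> v = 0" if "v \<in> V" for v
    using p(2)[of "p + v"] p(2)[of "p - v"] that p(1) subspace_add[OF assms(1)] subspace_diff[OF assms(1)]
    by simp
  then show ?thesis
    using that p(1) by blast
qed

text \<open>
Testing x against its own component x - p orthogonal to V shows that this component is zero.
\<close>

lemma orthogonal_complement_twice:
  fixes V :: "'h::{real_inner,complete_space} set"
  assumes "subspace V" "closed V"
    and "\<And>n. (\<And>v. v \<in> V \<Longrightarrow> n \<bullet> v = 0) \<Longrightarrow> x \<bullet> n = 0"
  shows "x \<in> V"
proof -
  obtain p where p: "p \<in> V" "\<And>v. v \<in> V \<Longrightarrow> (x - p) \<bullet> v = 0"
    using closed_subspace_decompose[OF assms(1,2)] by blast
  have "x \<bullet> (x - p) = 0" "p \<bullet> (x - p) = 0"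
    using assms(3)[of "x - p"] p by (simp_all add: inner_commute)
  then have "(x - p) \<bullet> (x - p) = 0"
    by (simp add: inner_diff_left)
  then show ?thesis
    using p(1) by simp
qed

text \<open>
The point of S nearest to p bounds a closed half-space that contains S, and a half-space is closed under
weak limits. Limits are taken along arbitrary filters, so that cluster points of a sequence
are limits along finer filters and subsequences can be avoided throughout.
\<close>

lemma closed_convex_weakly_closed:
  fixes S :: "'h::{real_inner,complete_space} set"
  assumes "closed S" "convex S" "F \<noteq> bot" "\<And>y. ((\<lambda>k. X k \<bullet> y) \<longlongrightarrow> p \<bullet> y) F"
    and "eventually (\<lambda>k. X k \<in> S) F"
  shows "p \<in> S"
proof -
  have "S \<noteq> {}"
    using eventually_happens[OF assms(5)] assms(3) by blast
  then obtain q where q: "q \<in> S" "\<And>y. y \<in> S \<Longrightarrow> (p - q) \<bullet> (y - q) \<le> 0"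
    using closed_convex_nearest_point[OF assms(1,2)] by blast
  have "((\<lambda>k. X k \<bullet> (p - q) - q \<bullet> (p - q)) \<longlongrightarrow> p \<bullet> (p - q) - q \<bullet> (p - q)) F"
    by (intro tendsto_intros assms(4))
  moreover have "y \<bullet> (p - q) - q \<bullet> (p - q) \<le> 0" if "y \<in> S" for y
    using q(2)[OF that] inner_diff_left[of y q "p - q"] inner_commute[of "p - q" "y - q"] by linarith
  then have "eventually (\<lambda>k. X k \<bullet> (p - q) - q \<bullet> (p - q) \<le> 0) F"
    using assms(5) by (rule eventually_mono[rotated])
  ultimately have "p \<bullet> (p - q) - q \<bullet> (p - q) \<le> 0"
    using assms(3) by (intro tendsto_upperbound)
  then have "(p - q) \<bullet> (p - q) \<le> 0"
    by (simp add: inner_diff_left)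
  then show ?thesis
    using q(1) by (metis eq_iff_diff_eq_0 inner_eq_zero_iff inner_ge_zero order_antisym)
qed

text \<open>
For a nonzero functional the orthogonal complement of the kernel inside V is a line, and the scaling of a vector on it is
fixed by one value of the functional. The version relative to a subspace serves for functionals that
are defined on gradients only.
\<close>

lemma riesz_representation_subspace:
  fixes V :: "'h::{real_inner,complete_space} set"
  assumes V: "subspace V" "closed V"
    and add: "\<And>x y. x \<in> V \<Longrightarrow> y \<in> V \<Longrightarrow> f (x + y) = f x + f y"
    and scale: "\<And>c x. x \<in> V \<Longrightarrow> f (c *\<^sub>R x) = c * f x"
    and bound: "\<And>x. x \<in> V \<Longrightarrow> \<bar>f x\<bar> \<le> M * norm x"
  obtains z where "z \<in> V" "\<And>x. x \<in> V \<Longrightarrow> f x = z \<bullet> x"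
proof (cases "\<forall>x\<in>V. f x = 0")
  case True
  then show ?thesis
    using that[of 0] subspace_0[OF V(1)] by simp
next
  case False
  then obtain x0 where x0: "x0 \<in> V" "f x0 \<noteq> 0"
    by blast
  have diff: "f (x - y) = f x - f y" if "x \<in> V" "y \<in> V" for x y
    using add[of x "- y"] scale[of y "- 1"] that subspace_neg[OF V(1)] by simp
  define N where "N = {x \<in> V. f x = 0}"
  have N: "subspace N"
    unfolding subspace_def N_def
    using subspace_0[OF V(1)] subspace_add[OF V(1)] subspace_scale[OF V(1)] scale[of 0 0]
    by (auto simp: add scale)
  have "closed N"
    unfolding closed_sequential_limits
  proof (intro allI impI, elim conjE)
    fix X l
    assume X: "\<forall>n. X n \<in> N" "X \<longlonglongrightarrow> l"
    then have l: "l \<in> V"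
      using closed_sequentially[OF V(2)] unfolding N_def by blast
    have "\<bar>f l\<bar> \<le> M * norm (l - X n)" for n
      using bound[of "l - X n"] diff[of l "X n"] X(1) l subspace_diff[OF V(1), of l "X n"]
      by (simp add: N_def)
    moreover have "(\<lambda>n. M * norm (l - X n)) \<longlonglongrightarrow> M * norm (l - l)"
      by (intro tendsto_intros X(2))
    ultimately have "\<bar>f l\<bar> \<le> M * norm (l - l)"
      by (intro LIMSEQ_le_const) auto
    then show "l \<in> N"
      using l by (simp add: N_def)
  qed
  then obtain p where p: "p \<in> N" "\<And>v. v \<in> N \<Longrightarrow> (x0 - p) \<bullet> v = 0"
    using closed_subspace_decompose[OF N] by blast
  define e where "e = x0 - p"
  have e: "e \<in> V" "f e = f x0"
    using p(1) x0(1) subspace_diff[OF V(1)] diff[of x0 p] by (auto simp: e_def N_def)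
  then have "e \<noteq> 0"
    using x0(2) scale[of 0 0] subspace_0[OF V(1)] by auto
  have "f x = (f e / (e \<bullet> e)) *\<^sub>R e \<bullet> x" if x: "x \<in> V" for x
  proof -
    have "x - (f x / f e) *\<^sub>R e \<in> N"
      using x e x0(2) subspace_diff[OF V(1)] subspace_scale[OF V(1)]
      by (auto simp: N_def diff scale)
    then have "e \<bullet> (x - (f x / f e) *\<^sub>R e) = 0"
      using p(2) by (simp add: e_def)
    then have "e \<bullet> x = f x / f e * (e \<bullet> e)"
      by (simp add: inner_diff_right)
    then show ?thesis
      using \<open>e \<noteq> 0\<close> e(2) x0(2) by (simp add: field_simps)
  qed
  then show ?thesis
    using that[of "(f e / (e \<bullet> e)) *\<^sub>R e"] subspace_scale[OF V(1) e(1)] by blast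
qed

text \<open>
The functions sending y to X k \<bullet> y lie in the product over all y of the intervals from -M |y| to
M |y|, which is compact by the theorem of Tychonoff. A cluster point in this product is again a
bounded linear functional, hence is represented by a vector.
\<close>

lemma bounded_weakly_compact:
  fixes X :: "'i \<Rightarrow> 'h::{real_inner,complete_space}"
  assumes "F \<noteq> bot" and bound: "\<And>k. norm (X k) \<le> M"
  shows "\<exists>F' p. F' \<le> F \<and> F' \<noteq> bot \<and> (\<forall>y. ((\<lambda>k. X k \<bullet> y) \<longlongrightarrow> p \<bullet> y) F')"
proof -
  define \<Phi> where "\<Phi> k y = X k \<bullet> y" for k y
  define K where "K = PiE UNIV (\<lambda>y::'h. {- (M * norm y) .. M * norm y})"
  have "compactin (product_topology (\<lambda>_. euclidean) UNIV) K"
    unfolding K_def compactin_PiE by auto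
  then have "compact K"
    by (simp add: euclidean_product_topology)
  moreover have "\<Phi> k \<in> K" for k
  proof -
    have "\<bar>X k \<bullet> y\<bar> \<le> M * norm y" for y
      by (rule order_trans[OF Cauchy_Schwarz_ineq2]) (intro mult_right_mono bound norm_ge_zero)
    then show ?thesis
      by (auto simp: K_def \<Phi>_def abs_le_iff minus_le_iff)
  qed
  then have "eventually (\<lambda>x. x \<in> K) (filtermap \<Phi> F)"
    by (simp add: eventually_filtermap)
  moreover have "filtermap \<Phi> F \<noteq> bot"
    using assms(1) by (simp add: filtermap_bot_iff)
  ultimately obtain L where L: "L \<in> K" "inf (nhds L) (filtermap \<Phi> F) \<noteq> bot"
    unfolding compact_filter by blast
  define F' where "F' = inf F (filtercomap \<Phi> (nhds L))"
  have "F' \<noteq> bot"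
  proof
    assume "F' = bot"
    then obtain P Q where PQ: "eventually P F" "eventually Q (nhds L)" "\<And>k. P k \<Longrightarrow> Q (\<Phi> k) \<Longrightarrow> False"
      unfolding F'_def trivial_limit_def eventually_inf eventually_filtercomap by metis
    have "eventually (\<lambda>f. \<not> Q f) (filtermap \<Phi> F)"
      unfolding eventually_filtermap using PQ(1) by eventually_elim (use PQ(3) in blast)
    then have "eventually (\<lambda>_. False) (inf (nhds L) (filtermap \<Phi> F))"
      unfolding eventually_inf using PQ(2) by blast
    then show False
      using L(2) by (simp add: trivial_limit_def)
  qed
  have "(\<Phi> \<longlongrightarrow> L) F'"
    unfolding F'_def filterlim_iff_le_filtercomap by simp
  then have lim: "((\<lambda>k. X k \<bullet> y) \<longlongrightarrow> L y) F'" for y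
  proof -
    assume "(\<Phi> \<longlongrightarrow> L) F'"
    moreover have "((\<lambda>f::'h \<Rightarrow> real. f y) \<longlongrightarrow> L y) (at L)"
      using continuous_on_product_coordinates[of y] unfolding continuous_on_def by blast
    ultimately show ?thesis
      using tendsto_compose[where f = \<Phi> and g = "\<lambda>f. f y"] unfolding \<Phi>_def by fast
  qed
  have "L (x + y) = L x + L y" for x y
    using tendsto_unique[OF \<open>F' \<noteq> bot\<close> lim[of "x + y"]] tendsto_add[OF lim[of x] lim[of y]]
    by (simp add: inner_add_right)
  moreover have "L (c *\<^sub>R x) = c * L x" for c x
    using tendsto_unique[OF \<open>F' \<noteq> bot\<close> lim[of "c *\<^sub>R x"]] tendsto_mult[OF tendsto_const lim[of x]]
    by simp
  moreover have "\<bar>L x\<bar> \<le> M * norm x" for x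
    using L(1) by (auto simp: K_def PiE_iff abs_le_iff minus_le_iff)
  ultimately obtain z where z: "\<And>x. L x = z \<bullet> x"
    using riesz_representation_subspace[of UNIV L M] by (metis UNIV_I closed_UNIV subspace_UNIV)
  have "F' \<le> F"
    by (simp add: F'_def)
  then show ?thesis
    using \<open>F' \<noteq> bot\<close> lim z by auto
qed

lemma convergent_real_imp_bounded:
  fixes X :: "nat \<Rightarrow> real"
  assumes "convergent X"
  obtains B where "\<And>k. \<bar>X k\<bar> \<le> B"
  using BseqE[OF convergent_imp_Bseq[OF assms]] by auto

text \<open>
If p and q are weak cluster points, then the difference of the squared distances of X k to p and to q
is affine in X k \<bullet> (p - q) and converges, so the limits p \<bullet> (p - q) and q \<bullet> (p - q) along the
two filters agree. Compactness turns a unique cluster point into a limit.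
\<close>

lemma opial_weak_convergence:
  fixes X :: "nat \<Rightarrow> 'h::{real_inner,complete_space}"
  assumes "C \<noteq> {}" and fejer: "\<And>c. c \<in> C \<Longrightarrow> convergent (\<lambda>k. norm (X k - c))"
    and cluster: "\<And>F p. F \<le> sequentially \<Longrightarrow> F \<noteq> bot \<Longrightarrow>
        (\<And>y. ((\<lambda>k. X k \<bullet> y) \<longlongrightarrow> p \<bullet> y) F) \<Longrightarrow> p \<in> C"
  shows "\<exists>p\<in>C. \<forall>y. (\<lambda>k. X k \<bullet> y) \<longlonglongrightarrow> p \<bullet> y"
proof -
  obtain c where "c \<in> C"
    using assms(1) by blast
  obtain B where B: "\<And>k. norm (X k - c) \<le> B"
    using convergent_real_imp_bounded[OF fejer[OF \<open>c \<in> C\<close>]] by auto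
  have bound: "norm (X k) \<le> B + norm c" for k
    using B[of k] norm_triangle_sub[of "X k" c] by linarith
  obtain F p where F: "F \<le> sequentially" "F \<noteq> bot" and p: "\<And>y. ((\<lambda>k. X k \<bullet> y) \<longlongrightarrow> p \<bullet> y) F"
    using bounded_weakly_compact[of sequentially X, OF sequentially_bot bound] by blast
  have pC: "p \<in> C"
    using cluster[OF F p] .
  have unique: "q = p" if G: "G \<le> sequentially" "G \<noteq> bot"
    and q: "\<And>y. ((\<lambda>k. X k \<bullet> y) \<longlongrightarrow> q \<bullet> y) G" for G q
  proof -
    have qC: "q \<in> C"
      using cluster[OF G q] .
    obtain \<alpha> \<beta> where ab: "(\<lambda>k. norm (X k - p)) \<longlonglongrightarrow> \<alpha>" "(\<lambda>k. norm (X k - q)) \<longlonglongrightarrow> \<beta>"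
      using fejer[OF pC] fejer[OF qC] unfolding convergent_def by blast
    have X_eq: "X k \<bullet> (p - q) = ((norm (X k - q))\<^sup>2 - (norm (X k - p))\<^sup>2 + p \<bullet> p - q \<bullet> q) / 2" for k
      unfolding power2_norm_eq_inner by (simp add: algebra_simps inner_commute)
    have "(\<lambda>k. X k \<bullet> (p - q)) \<longlonglongrightarrow> (\<beta>\<^sup>2 - \<alpha>\<^sup>2 + p \<bullet> p - q \<bullet> q) / 2"
      unfolding X_eq by (intro tendsto_intros ab) simp
    then have "p \<bullet> (p - q) = (\<beta>\<^sup>2 - \<alpha>\<^sup>2 + p \<bullet> p - q \<bullet> q) / 2" "q \<bullet> (p - q) = (\<beta>\<^sup>2 - \<alpha>\<^sup>2 + p \<bullet> p - q \<bullet> q) / 2"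
      using tendsto_unique[OF F(2) p] tendsto_unique[OF G(2) q] tendsto_mono[OF F(1)] tendsto_mono[OF G(1)]
      by metis+
    then have "(p - q) \<bullet> (p - q) = 0"
      by (simp add: inner_diff_left)
    then show ?thesis
      by simp
  qed
  have "(\<lambda>k. X k \<bullet> y) \<longlonglongrightarrow> p \<bullet> y" for y
  proof (rule ccontr)
    assume "\<not> ?thesis"
    then obtain e where "e > 0" and e: "\<not> eventually (\<lambda>k. dist (X k \<bullet> y) (p \<bullet> y) < e) sequentially"
      unfolding tendsto_iff by blast
    \<comment> \<open>Along this filter the values stay away from the limit, yet compactness yields a finer filter along which they converge to it.\<close>
    define G where "G = inf sequentially (principal {k. \<not> dist (X k \<bullet> y) (p \<bullet> y) < e})"
    have "G \<noteq> bot"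
      using e unfolding G_def trivial_limit_def eventually_inf_principal by simp
    then obtain G' q where G': "G' \<le> G" "G' \<noteq> bot" and q: "\<And>y. ((\<lambda>k. X k \<bullet> y) \<longlongrightarrow> q \<bullet> y) G'"
      using bounded_weakly_compact[of G X, OF \<open>G \<noteq> bot\<close> bound] by blast
    have "q = p"
      using unique[OF _ G'(2) q] G'(1) by (simp add: G_def)
    then have "eventually (\<lambda>k. dist (X k \<bullet> y) (p \<bullet> y) < e) G'"
      using q \<open>e > 0\<close> unfolding tendsto_iff by blast
    moreover have "eventually (\<lambda>k. \<not> dist (X k \<bullet> y) (p \<bullet> y) < e) G'"
      using G'(1) unfolding G_def le_inf_iff le_principal by simp
    ultimately have "eventually (\<lambda>_. False) G'"
      by eventually_elim simp
    then show False
      using G'(2) by (simp add: trivial_limit_def)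
  qed
  then show ?thesis
    using pC by blast
qed

section \<open>Alternating split Bregman iteration for a monotone relation\<close>

text \<open>
The argument of Minty: the resolvent splits b + d as y + c with (y, c) in A, and then the monotonicity
hypothesis for this pair reads -|d - y|^2 \<ge> 0.
\<close>

lemma monotone_resolvent_maximal:
  fixes A :: "('h::real_inner \<times> 'h) set"
  assumes "\<And>w. \<exists>y. (y, w - y) \<in> A"
    and "\<And>y c. (y, c) \<in> A \<Longrightarrow> (b - c) \<bullet> (d - y) \<ge> 0"
  shows "(d, b) \<in> A"
proof -
  obtain y where y: "(y, b + d - y) \<in> A"
    using assms(1) by blast
  have "(b - (b + d - y)) \<bullet> (d - y) \<ge> 0"
    using assms(2)[OF y] .
  moreover have "(b - (b + d - y)) \<bullet> (d - y) = - ((d - y) \<bullet> (d - y))"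
    by (simp add: algebra_simps)
  ultimately have "d = y"
    by (metis inner_ge_zero inner_eq_zero_iff eq_iff_diff_eq_0 neg_0_le_iff_le order_antisym)
  then show ?thesis
    using y by simp
qed

text \<open>
Here v, d, b stand for \<nabla>u^k, d^k, b^k, and the shift by \<nabla>u_f is absorbed into A.
\<close>

locale split_bregman_iteration =
  fixes V :: "'h::{real_inner,complete_space} set"
    and A :: "('h \<times> 'h) set"
    and v d b :: "nat \<Rightarrow> 'h"
  assumes V: "subspace V" "closed V"
    and mono: "\<And>y c y' c'. (y, c) \<in> A \<Longrightarrow> (y', c') \<in> A \<Longrightarrow> (c - c') \<bullet> (y - y') \<ge> 0"
    and surj: "\<And>w. \<exists>y. (y, w - y) \<in> A"
    and v_in: "\<And>k. v (Suc k) \<in> V"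
    and v_eq: "\<And>k h. h \<in> V \<Longrightarrow> v (Suc k) \<bullet> h = (d k - b k) \<bullet> h"
    and step: "\<And>k. b (Suc k) + d (Suc k) = b k + v (Suc k)"
    and db_in: "\<And>k. (d (Suc k), b (Suc k)) \<in> A"
begin

definition saddle :: "('h \<times> 'h) set" where
  "saddle = {(c, y). y \<in> V \<and> (\<forall>h\<in>V. c \<bullet> h = 0) \<and> (y, c) \<in> A}"

text \<open>
With \<eta> = v (k+1) - y, which lies in V, the Poisson equation gives |\<eta>|^2 = (\<delta> - \<beta>) \<bullet> \<eta>, so
|\<beta> + \<eta>|^2 = |\<beta>|^2 + |\<delta>|^2 - |\<delta> - \<eta>|^2. The same vector is \<beta>' + \<delta>' after the step, and
\<beta>' \<bullet> \<delta>' \<ge> 0 by monotonicity.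
\<close>

lemma energy_decrease:
  assumes "(c, y) \<in> saddle"
  shows "(norm (b (Suc k) - c))\<^sup>2 + (norm (d (Suc k) - y))\<^sup>2 + (norm (v (Suc k) - d k))\<^sup>2
     \<le> (norm (b k - c))\<^sup>2 + (norm (d k - y))\<^sup>2"
proof -
  have y: "y \<in> V" "(y, c) \<in> A" and c: "\<And>h. h \<in> V \<Longrightarrow> c \<bullet> h = 0"
    using assms by (auto simp: saddle_def)
  define \<beta> \<delta> \<eta> \<beta>' \<delta>' where defs: "\<beta> = b k - c" "\<delta> = d k - y" "\<eta> = v (Suc k) - y"
    "\<beta>' = b (Suc k) - c" "\<delta>' = d (Suc k) - y"
  have \<eta>: "\<eta> \<in> V"
    unfolding defs by (intro subspace_diff V v_in y)
  have "\<eta> \<bullet> \<eta> = (\<delta> - \<beta>) \<bullet> \<eta>"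
    using v_eq[OF \<eta>, of k] c[OF \<eta>] unfolding defs(1,2) by (simp add: defs(3) inner_diff_left)
  moreover have "\<beta>' + \<delta>' = \<beta> + \<eta>"
    using step[of k] by (simp add: defs algebra_simps)
  then have "\<beta> = \<beta>' + \<delta>' - \<eta>"
    by (simp add: algebra_simps)
  moreover have "\<beta>' \<bullet> \<delta>' \<ge> 0"
    using mono[OF db_in y(2), of k] by (simp add: defs)
  moreover have "\<beta> \<bullet> \<beta> = \<beta>' \<bullet> \<beta>' + \<delta>' \<bullet> \<delta>' + \<eta> \<bullet> \<eta> + 2 * (\<beta>' \<bullet> \<delta>') - 2 * (\<beta>' \<bullet> \<eta> + \<delta>' \<bullet> \<eta>)"
    unfolding \<open>\<beta> = \<beta>' + \<delta>' - \<eta>\<close>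
    by (simp add: inner_add_left inner_add_right inner_diff_left inner_diff_right inner_commute)
  ultimately have "\<beta>' \<bullet> \<beta>' + \<delta>' \<bullet> \<delta>' + (\<eta> - \<delta>) \<bullet> (\<eta> - \<delta>) \<le> \<beta> \<bullet> \<beta> + \<delta> \<bullet> \<delta>"
    by (simp add: algebra_simps inner_commute)
  moreover have "v (Suc k) - d k = \<eta> - \<delta>"
    by (simp add: defs)
  ultimately show ?thesis
    unfolding power2_norm_eq_inner by (simp only: defs(1,2,4,5))
qed

lemma residual_summable:
  assumes "saddle \<noteq> {}"
  shows "summable (\<lambda>k. (norm (v (Suc k) - d k))\<^sup>2)"
proof -
  obtain c y where cy: "(c, y) \<in> saddle"
    using assms by auto
  define E where "E k = (norm (b k - c))\<^sup>2 + (norm (d k - y))\<^sup>2" for k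
  have "(\<Sum>k<n. (norm (v (Suc k) - d k))\<^sup>2) \<le> E 0 - E n" for n
  proof (induction n)
    case (Suc n)
    then show ?case
      using energy_decrease[OF cy, of n] by (simp add: E_def)
  qed simp
  moreover have "E n \<ge> 0" for n
    by (simp add: E_def)
  ultimately have "(\<Sum>k<n. (norm (v (Suc k) - d k))\<^sup>2) \<le> E 0" for n
    by (smt (verit))
  then show ?thesis
    by (intro summableI_nonneg_bounded) auto
qed

lemma residual_tendsto_0:
  assumes "saddle \<noteq> {}"
  shows "(\<lambda>k. norm (v (Suc k) - d k)) \<longlonglongrightarrow> 0"
proof -
  have "(\<lambda>k. sqrt ((norm (v (Suc k) - d k))\<^sup>2)) \<longlonglongrightarrow> sqrt 0"
    by (intro tendsto_real_sqrt summable_LIMSEQ_zero residual_summable assms)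
  then show ?thesis
    by simp
qed

lemma saddle_distance_convergent:
  assumes "p \<in> saddle"
  shows "convergent (\<lambda>k. norm ((b k, d k) - p))"
proof -
  obtain c y where p: "p = (c, y)"
    by (cases p)
  have eq: "norm ((b k, d k) - p) = sqrt ((norm (b k - c))\<^sup>2 + (norm (d k - y))\<^sup>2)" for k
    by (simp add: p norm_Pair)
  have "norm ((b (Suc k), d (Suc k)) - p) \<le> norm ((b k, d k) - p)" for k
    unfolding eq using energy_decrease[of c y k] assms p
    by (intro real_sqrt_le_mono) (smt (verit) zero_le_power2)
  then have "decseq (\<lambda>k. norm ((b k, d k) - p))"
    by (intro decseq_SucI)
  then obtain l where "(\<lambda>k. norm ((b k, d k) - p)) \<longlonglongrightarrow> l"
    using decseq_convergent[of _ 0] norm_ge_zero by blast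
  then show ?thesis
    by (rule convergentI)
qed

lemma iterates_bounded:
  assumes "saddle \<noteq> {}"
  shows "\<exists>B. \<forall>k. norm (b k) \<le> B \<and> norm (d k) \<le> B"
proof -
  obtain p where p: "p \<in> saddle"
    using assms by blast
  obtain B where B: "\<And>k. norm ((b k, d k) - p) \<le> B"
    using convergent_real_imp_bounded[OF saddle_distance_convergent[OF p]] by auto
  have "norm (b k, d k) \<le> B + norm p" for k
    using B[of k] norm_triangle_sub[of "(b k, d k)" p] by linarith
  then show ?thesis
    by (blast intro: order_trans[OF norm_fst_le] order_trans[OF norm_snd_le])
qed

text \<open>
A product of two weakly convergent sequences need not converge to the product of the limits. Here it
does, because b^k is asymptotically orthogonal to V while d^k is asymptotically in V: b^k \<bullet> d^k tends
to 0, and p \<bullet> q = 0.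
\<close>

lemma weak_cluster_saddle:
  assumes "saddle \<noteq> {}" "F \<le> sequentially" "F \<noteq> bot"
    and wb: "\<And>y. ((\<lambda>k. b k \<bullet> y) \<longlongrightarrow> p \<bullet> y) F" and wd: "\<And>y. ((\<lambda>k. d k \<bullet> y) \<longlongrightarrow> q \<bullet> y) F"
  shows "(p, q) \<in> saddle"
proof -
  obtain B where B: "\<And>k. norm (b k) \<le> B" "\<And>k. norm (d k) \<le> B"
    using iterates_bounded[OF assms(1)] by blast
  have res: "((\<lambda>k. v (Suc k) - d k) \<longlongrightarrow> 0) F"
    using residual_tendsto_0[OF assms(1)] tendsto_mono[OF assms(2)] tendsto_norm_zero_iff by blast
  have wv: "((\<lambda>k. v (Suc k) \<bullet> y) \<longlongrightarrow> q \<bullet> y) F" for y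
    using tendsto_add[OF wd[of y] tendsto_inner[OF res tendsto_const[of y]]]
    by (simp add: inner_diff_left)
  have q: "q \<in> V"
    by (rule closed_convex_weakly_closed[OF V(2) subspace_imp_convex[OF V(1)] assms(3) wv])
      (simp add: v_in)
  have p: "p \<bullet> h = 0" if h: "h \<in> V" for h
  proof -
    have "((\<lambda>k. - ((v (Suc k) - d k) \<bullet> h)) \<longlongrightarrow> - (0 \<bullet> h)) F"
      by (intro tendsto_intros res)
    moreover have "b k \<bullet> h = - ((v (Suc k) - d k) \<bullet> h)" for k
      using v_eq[OF h, of k] by (simp add: inner_diff_left)
    ultimately have "((\<lambda>k. b k \<bullet> h) \<longlongrightarrow> 0) F"
      by simp
    then show ?thesis
      using tendsto_unique[OF assms(3) wb] by blast
  qed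
  have bd: "((\<lambda>k. b k \<bullet> d k) \<longlongrightarrow> 0) F"
  proof (rule Lim_null_comparison)
    have "norm (v (Suc k)) \<le> norm (d k - b k)" for k
    proof (cases "v (Suc k) = 0")
      case False
      have "norm (v (Suc k)) * norm (v (Suc k)) \<le> norm (d k - b k) * norm (v (Suc k))"
        using v_eq[OF v_in[of k], of k] norm_cauchy_schwarz[of "d k - b k" "v (Suc k)"]
        by (simp add: power2_norm_eq_inner[symmetric] power2_eq_square)
      then show ?thesis
        using False by simp
    qed simp
    then have v_bound: "norm (v (Suc k)) \<le> 2 * B" for k
      using B norm_triangle_ineq4[of "d k" "b k"] order_trans[of "norm (v (Suc k))"] by (smt (verit))
    have "\<bar>b k \<bullet> d k\<bar> \<le> 3 * B * norm (v (Suc k) - d k)" for k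
    proof -
      \<comment> \<open>The Poisson equation is tested with the new gradient itself.\<close>
      have "b k \<bullet> d k = - ((v (Suc k) - d k) \<bullet> v (Suc k)) - b k \<bullet> (v (Suc k) - d k)"
        using v_eq[OF v_in[of k], of k] by (simp add: inner_diff_left inner_diff_right inner_commute)
      then have "\<bar>b k \<bullet> d k\<bar> \<le> \<bar>(v (Suc k) - d k) \<bullet> v (Suc k)\<bar> + \<bar>b k \<bullet> (v (Suc k) - d k)\<bar>"
        by linarith
      also have "\<dots> \<le> norm (v (Suc k) - d k) * norm (v (Suc k)) + norm (b k) * norm (v (Suc k) - d k)"
        by (intro add_mono Cauchy_Schwarz_ineq2)
      also have "\<dots> \<le> norm (v (Suc k) - d k) * (2 * B) + B * norm (v (Suc k) - d k)"
        by (intro add_mono mult_left_mono mult_right_mono v_bound B norm_ge_zero)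
      finally show ?thesis
        by (simp add: algebra_simps)
    qed
    then show "eventually (\<lambda>k. norm (b k \<bullet> d k) \<le> 3 * B * norm (v (Suc k) - d k)) F"
      by simp
    show "((\<lambda>k. 3 * B * norm (v (Suc k) - d k)) \<longlongrightarrow> 0) F"
      using tendsto_mult[OF tendsto_const tendsto_norm[OF res], of "3 * B"] by simp
  qed
  have "(q, p) \<in> A"
  proof (rule monotone_resolvent_maximal[OF surj])
    fix y c
    assume yc: "(y, c) \<in> A"
    have "((\<lambda>k. b k \<bullet> d k - b k \<bullet> y - d k \<bullet> c + c \<bullet> y) \<longlongrightarrow> 0 - p \<bullet> y - q \<bullet> c + c \<bullet> y) F"
      by (intro tendsto_intros bd wb wd)
    moreover have "eventually (\<lambda>k. 0 \<le> b k \<bullet> d k - b k \<bullet> y - d k \<bullet> c + c \<bullet> y) F"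
    proof (rule filter_leD[OF assms(2)])
      \<comment> \<open>The starting pair is arbitrary and need not belong to A, so the index 0 is excluded.\<close>
      have "0 \<le> b k \<bullet> d k - b k \<bullet> y - d k \<bullet> c + c \<bullet> y" if "k \<ge> 1" for k
        using mono[OF db_in[of "k - 1"] yc] that
        by (simp add: inner_diff_left inner_diff_right inner_commute algebra_simps)
      then show "eventually (\<lambda>k. 0 \<le> b k \<bullet> d k - b k \<bullet> y - d k \<bullet> c + c \<bullet> y) sequentially"
        using eventually_sequentially by blast
    qed
    ultimately have "0 \<le> 0 - p \<bullet> y - q \<bullet> c + c \<bullet> y"
      using assms(3) by (intro tendsto_lowerbound)
    then show "(p - c) \<bullet> (q - y) \<ge> 0"
      using p[OF q] by (simp add: inner_diff_left inner_diff_right inner_commute algebra_simps)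
  qed
  then show ?thesis
    using p q by (simp add: saddle_def)
qed

text \<open>
Opial's argument is applied to the pairs (b^k, d^k) in the product space, whose distances to the saddle
points decrease.
\<close>

theorem weak_convergence:
  assumes "saddle \<noteq> {}"
  obtains p q where "(p, q) \<in> saddle" "\<And>y. (\<lambda>k. b k \<bullet> y) \<longlonglongrightarrow> p \<bullet> y"
    "\<And>y. (\<lambda>k. d k \<bullet> y) \<longlonglongrightarrow> q \<bullet> y" "\<And>y. (\<lambda>k. v (Suc k) \<bullet> y) \<longlonglongrightarrow> q \<bullet> y"
proof -
  have "z \<in> saddle" if F: "F \<le> sequentially" "F \<noteq> bot"
    and z: "\<And>y. ((\<lambda>k. (b k, d k) \<bullet> y) \<longlongrightarrow> z \<bullet> y) F" for F and z :: "'h \<times> 'h"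
  proof -
    have "((\<lambda>k. b k \<bullet> y) \<longlongrightarrow> fst z \<bullet> y) F" "((\<lambda>k. d k \<bullet> y) \<longlongrightarrow> snd z \<bullet> y) F" for y
      using z[of "(y, 0)"] z[of "(0, y)"] by (auto simp: inner_prod_def)
    then show ?thesis
      using weak_cluster_saddle[OF assms F, of "fst z" "snd z"] by simp
  qed
  then obtain z where z: "z \<in> saddle" "\<And>y. (\<lambda>k. (b k, d k) \<bullet> y) \<longlonglongrightarrow> z \<bullet> y"
    using opial_weak_convergence[of saddle "\<lambda>k. (b k, d k)", OF assms saddle_distance_convergent] by blast
  have wb: "(\<lambda>k. b k \<bullet> y) \<longlonglongrightarrow> fst z \<bullet> y" and wd: "(\<lambda>k. d k \<bullet> y) \<longlonglongrightarrow> snd z \<bullet> y" for y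
    using z(2)[of "(y, 0)"] z(2)[of "(0, y)"] by (auto simp: inner_prod_def)
  have res: "(\<lambda>k. v (Suc k) - d k) \<longlonglongrightarrow> 0"
    using residual_tendsto_0[OF assms] tendsto_norm_zero_iff by blast
  have "(\<lambda>k. v (Suc k) \<bullet> y) \<longlonglongrightarrow> snd z \<bullet> y" for y
    using tendsto_add[OF wd[of y] tendsto_inner[OF res tendsto_const[of y]]]
    by (simp add: inner_diff_left)
  then show ?thesis
    using that[of "fst z" "snd z"] z(1) wb wd by simp
qed

end

text \<open>
Let p be the point nearest to 0 in the closure of the differences c - n with c in K and n orthogonal
to V. It is orthogonal to all such n, hence lies in V; testing the hypothesis with -p gives p = 0. So some
c in K are arbitrarily close to the complement of V, and K is weakly compact.
\<close>

lemma convex_set_meets_orthogonal_complement: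
  fixes K V :: "'h::{real_inner,complete_space} set"
  assumes V: "subspace V" "closed V"
    and K: "convex K" "closed K" "\<And>c. c \<in> K \<Longrightarrow> norm c \<le> M"
    and supp: "\<And>h. h \<in> V \<Longrightarrow> \<exists>c\<in>K. c \<bullet> h \<ge> 0"
  obtains c where "c \<in> K" "\<And>h. h \<in> V \<Longrightarrow> c \<bullet> h = 0"
proof -
  define N where "N = {n. \<forall>h\<in>V. n \<bullet> h = 0}"
  have N: "subspace N"
    unfolding N_def subspace_def by (auto simp: inner_add_left)
  define D where "D = {c - n |c n. c \<in> K \<and> n \<in> N}"
  have "K \<noteq> {}"
    using supp[of 0] subspace_0[OF V(1)] by blast
  then have "D \<noteq> {}"
    using subspace_0[OF N] by (auto simp: D_def)
  moreover have "D = (\<Union>x\<in>K. \<Union>y\<in>N. {x - y})"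
    by (auto simp: D_def)
  then have "convex D"
    using convex_differences[OF K(1) subspace_imp_convex[OF N]] by simp
  ultimately obtain p where p: "p \<in> closure D" "\<And>y. y \<in> closure D \<Longrightarrow> (0 - p) \<bullet> (y - p) \<le> 0"
    using closed_convex_nearest_point[OF closed_closure convex_closure, of D 0] by auto
  have p_D: "p \<bullet> p \<le> p \<bullet> c - p \<bullet> n" if "c \<in> K" "n \<in> N" for c n
  proof -
    have "c - n \<in> closure D"
      using that closure_subset[of D] by (auto simp: D_def)
    then show ?thesis
      using p(2) by (force simp: inner_diff_right)
  qed
  have "p \<bullet> n = 0" if n: "n \<in> N" for n
  proof (rule ccontr)
    assume neq: "p \<bullet> n \<noteq> 0"
    obtain c where c: "c \<in> K"
      using \<open>K \<noteq> {}\<close> by blast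
    define s where "s = (p \<bullet> c + 1) / (p \<bullet> n)"
    have "p \<bullet> p \<le> p \<bullet> c - p \<bullet> (s *\<^sub>R n)"
      using p_D[OF c] subspace_scale[OF N n] by blast
    also have "\<dots> = - 1"
      using neq by (simp add: s_def)
    finally show False
      using inner_ge_zero[of p] by linarith
  qed
  then have "p \<in> V"
    by (intro orthogonal_complement_twice[OF V]) (auto simp: N_def)
  then obtain c where c: "c \<in> K" "c \<bullet> (- p) \<ge> 0"
    using supp[of "- p"] subspace_neg[OF V(1)] by blast
  have "p \<bullet> p \<le> 0"
    using p_D[OF c(1) subspace_0[OF N]] c(2) by (simp add: inner_commute)
  then have "p = 0"
    by (metis inner_ge_zero inner_eq_zero_iff order_antisym)
  then obtain Y where Y: "\<And>k. Y k \<in> D" "Y \<longlonglongrightarrow> 0"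
    using p(1) closure_sequential by blast
  have "\<exists>c n. c \<in> K \<and> n \<in> N \<and> Y k = c - n" for k
    using Y(1)[of k] by (auto simp: D_def)
  then obtain c n where cn: "\<And>k. c k \<in> K" "\<And>k. n k \<in> N" "\<And>k. Y k = c k - n k"
    by metis
  obtain F q where F: "F \<le> sequentially" "F \<noteq> bot" "\<And>y. ((\<lambda>k. c k \<bullet> y) \<longlongrightarrow> q \<bullet> y) F"
    using bounded_weakly_compact[of sequentially c, OF sequentially_bot K(3)[OF cn(1)]] by blast
  have "q \<in> K"
    by (rule closed_convex_weakly_closed[OF K(2,1) F(2,3)]) (simp add: cn(1))
  moreover have "q \<bullet> h = 0" if h: "h \<in> V" for h
  proof -
    have "(\<lambda>k. Y k \<bullet> h) \<longlonglongrightarrow> 0 \<bullet> h"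
      by (intro tendsto_intros Y(2))
    moreover have "Y k \<bullet> h = c k \<bullet> h" for k
      using cn(2)[of k] h by (simp add: cn(3) N_def inner_diff_left)
    ultimately have "(\<lambda>k. c k \<bullet> h) \<longlonglongrightarrow> 0"
      by simp
    then show ?thesis
      using tendsto_unique[OF F(2,3)] tendsto_mono[OF F(1)] by blast
  qed
  ultimately show ?thesis
    using that by blast
qed

section \<open>The Hilbert space of square-integrable fields\<close>

definition square_integrable :: "('a::euclidean_space \<Rightarrow> 'b::euclidean_space) \<Rightarrow> bool" where
  "square_integrable f \<longleftrightarrow>
     f \<in> borel_measurable lebesgue \<and> integrable lebesgue (\<lambda>x. (norm (f x))\<^sup>2)"

lemma square_integrable_measurable: "square_integrable f \<Longrightarrow> f \<in> borel_measurable lebesgue"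
  by (simp add: square_integrable_def)

lemma square_integrable_inner:
  assumes "square_integrable f" "square_integrable g"
  shows "integrable lebesgue (\<lambda>x. f x \<bullet> g x)"
proof (rule Bochner_Integration.integrable_bound)
  show "integrable lebesgue (\<lambda>x. (norm (f x))\<^sup>2 + (norm (g x))\<^sup>2)"
    using assms by (simp add: square_integrable_def)
  show "(\<lambda>x. f x \<bullet> g x) \<in> borel_measurable lebesgue"
    using assms by (auto simp: square_integrable_def intro: borel_measurable_inner)
  have "\<bar>f x \<bullet> g x\<bar> \<le> (norm (f x))\<^sup>2 + (norm (g x))\<^sup>2" for x
  proof -
    have "\<bar>f x \<bullet> g x\<bar> \<le> norm (f x) * norm (g x)"
      by (rule Cauchy_Schwarz_ineq2)
    also have "\<dots> \<le> (norm (f x))\<^sup>2 + (norm (g x))\<^sup>2"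
      using sum_squares_bound[of "norm (f x)" "norm (g x)"]
        mult_nonneg_nonneg[OF norm_ge_zero[of "f x"] norm_ge_zero[of "g x"]] by linarith
    finally show ?thesis .
  qed
  then show "AE x in lebesgue. norm (f x \<bullet> g x) \<le> norm ((norm (f x))\<^sup>2 + (norm (g x))\<^sup>2)"
    by (intro AE_I2) (simp add: abs_of_nonneg)
qed

lemma square_integrable_bound:
  assumes "square_integrable g" "f \<in> borel_measurable lebesgue"
    and "AE x in lebesgue. norm (f x) \<le> norm (g x)"
  shows "square_integrable f"
  unfolding square_integrable_def
proof (intro conjI assms(2))
  show "integrable lebesgue (\<lambda>x. (norm (f x))\<^sup>2)"
  proof (rule Bochner_Integration.integrable_bound)
    show "integrable lebesgue (\<lambda>x. (norm (g x))\<^sup>2)"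
      using assms(1) by (simp add: square_integrable_def)
    show "(\<lambda>x. (norm (f x))\<^sup>2) \<in> borel_measurable lebesgue"
      using assms(2) by measurable
    show "AE x in lebesgue. norm ((norm (f x))\<^sup>2) \<le> norm ((norm (g x))\<^sup>2)"
      using assms(3) by eventually_elim (simp add: power_mono)
  qed
qed

lemma square_integrable_zero: "square_integrable (\<lambda>_. 0)"
  by (simp add: square_integrable_def)

lemma square_integrable_scaleR:
  "square_integrable f \<Longrightarrow> square_integrable (\<lambda>x. c *\<^sub>R f x)"
  by (auto simp: square_integrable_def power_mult_distrib)

lemma square_integrable_add:
  assumes "square_integrable f" "square_integrable g"
  shows "square_integrable (\<lambda>x. f x + g x)"
  unfolding square_integrable_def
proof
  have "(norm (f x + g x))\<^sup>2 = (norm (f x))\<^sup>2 + 2 * (f x \<bullet> g x) + (norm (g x))\<^sup>2" for x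
    unfolding power2_norm_eq_inner by (simp add: inner_add_left inner_add_right inner_commute)
  then show "integrable lebesgue (\<lambda>x. (norm (f x + g x))\<^sup>2)"
    using assms square_integrable_inner[OF assms] by (simp add: square_integrable_def)
  show "(\<lambda>x. f x + g x) \<in> borel_measurable lebesgue"
    using assms by (auto simp: square_integrable_def intro: borel_measurable_add)
qed

lemma square_integrable_uminus:
  "square_integrable f \<Longrightarrow> square_integrable (\<lambda>x. - f x)"
  using square_integrable_scaleR[of f "- 1"] by simp

lemma square_integrable_diff:
  "square_integrable f \<Longrightarrow> square_integrable g \<Longrightarrow> square_integrable (\<lambda>x. f x - g x)"
  using square_integrable_add[of f "\<lambda>x. - g x"] square_integrable_uminus[of g] by simp

definition ae_equal :: "('a::euclidean_space \<Rightarrow> 'b::euclidean_space) \<Rightarrow> ('a \<Rightarrow> 'b) \<Rightarrow> bool" where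
  "ae_equal f g \<longleftrightarrow> square_integrable f \<and> square_integrable g \<and> (AE x in lebesgue. f x = g x)"

lemma ae_equal_refl: "ae_equal f f \<longleftrightarrow> square_integrable f"
  by (simp add: ae_equal_def)

lemma AE_eq_combine:
  assumes "AE x in M. f x = f' x" "AE x in M. g x = g' x"
  shows "AE x in M. h (f x) (g x) = h (f' x) (g' x)"
  using assms by eventually_elim simp

lemma ae_equal_add:
  "ae_equal f f' \<Longrightarrow> ae_equal g g' \<Longrightarrow> ae_equal (\<lambda>x. f x + g x) (\<lambda>x. f' x + g' x)"
  by (simp add: ae_equal_def square_integrable_add AE_eq_combine[where h = plus])

lemma ae_equal_diff:
  "ae_equal f f' \<Longrightarrow> ae_equal g g' \<Longrightarrow> ae_equal (\<lambda>x. f x - g x) (\<lambda>x. f' x - g' x)"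
  by (simp add: ae_equal_def square_integrable_diff AE_eq_combine[where h = minus])

lemma ae_equal_scaleR: "ae_equal f f' \<Longrightarrow> ae_equal (\<lambda>x. c *\<^sub>R f x) (\<lambda>x. c *\<^sub>R f' x)"
  by (simp add: ae_equal_def square_integrable_scaleR AE_eq_combine[where h = "\<lambda>u v. c *\<^sub>R u"])

lemma ae_equal_uminus: "ae_equal f f' \<Longrightarrow> ae_equal (\<lambda>x. - f x) (\<lambda>x. - f' x)"
  by (simp add: ae_equal_def square_integrable_uminus AE_eq_combine[where h = "\<lambda>u v. - u"])

lemma part_equivp_ae_equal:
  "part_equivp (ae_equal :: ('a::euclidean_space \<Rightarrow> 'b::euclidean_space) \<Rightarrow> _)"
proof (rule part_equivpI)
  show "\<exists>f::'a \<Rightarrow> 'b. ae_equal f f"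
    by (rule exI[of _ "\<lambda>_. 0"]) (simp add: ae_equal_refl square_integrable_zero)
  show "symp (ae_equal :: ('a \<Rightarrow> 'b) \<Rightarrow> _)"
  proof (rule sympI)
    fix f g :: "'a \<Rightarrow> 'b"
    assume *: "ae_equal f g"
    then have "AE x in lebesgue. f x = g x"
      by (simp only: ae_equal_def)
    then have "AE x in lebesgue. g x = f x"
      by (rule eventually_mono) simp
    then show "ae_equal g f"
      using * by (simp only: ae_equal_def)
  qed
  show "transp (ae_equal :: ('a \<Rightarrow> 'b) \<Rightarrow> _)"
  proof (rule transpI)
    fix f g h :: "'a \<Rightarrow> 'b"
    assume *: "ae_equal f g" "ae_equal g h"
    then have "AE x in lebesgue. f x = g x" "AE x in lebesgue. g x = h x"
      by (simp_all only: ae_equal_def)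
    then have "AE x in lebesgue. f x = h x"
      by eventually_elim simp
    then show "ae_equal f h"
      using * by (simp only: ae_equal_def)
  qed
qed

quotient_type (overloaded) ('a, 'b) l2 = "'a::euclidean_space \<Rightarrow> 'b::euclidean_space" / partial: ae_equal
  by (rule part_equivp_ae_equal)

lemma abs_l2_eq_iff:
  "square_integrable f \<Longrightarrow> square_integrable g \<Longrightarrow> abs_l2 f = abs_l2 g \<longleftrightarrow> (AE x in lebesgue. f x = g x)"
  using Quotient_rel[OF Quotient_l2, of f g] by (auto simp: ae_equal_def)

lemma square_integrable_rep_l2: "square_integrable (rep_l2 X)"
  using Quotient_rep_reflp[OF Quotient_l2, of X] by (simp add: ae_equal_refl)

lemma abs_rep_l2: "abs_l2 (rep_l2 X) = X"
  using Quotient_abs_rep[OF Quotient_l2] .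

instantiation l2 :: (euclidean_space, euclidean_space) real_vector
begin

lift_definition zero_l2 :: "('a, 'b) l2" is "\<lambda>_. 0"
  by (simp add: ae_equal_refl square_integrable_zero)

lift_definition plus_l2 :: "('a, 'b) l2 \<Rightarrow> ('a, 'b) l2 \<Rightarrow> ('a, 'b) l2" is "\<lambda>f g x. f x + g x"
  by (rule ae_equal_add)

lift_definition minus_l2 :: "('a, 'b) l2 \<Rightarrow> ('a, 'b) l2 \<Rightarrow> ('a, 'b) l2" is "\<lambda>f g x. f x - g x"
  by (rule ae_equal_diff)

lift_definition uminus_l2 :: "('a, 'b) l2 \<Rightarrow> ('a, 'b) l2" is "\<lambda>f x. - f x"
  by (rule ae_equal_uminus)

lift_definition scaleR_l2 :: "real \<Rightarrow> ('a, 'b) l2 \<Rightarrow> ('a, 'b) l2" is "\<lambda>c f x. c *\<^sub>R f x"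
  by (rule ae_equal_scaleR)

instance
proof
  fix X Y Z :: "('a, 'b) l2" and c c' :: real
  show "X + Y + Z = X + (Y + Z)"
    by transfer (simp add: ae_equal_def square_integrable_add add.assoc)
  show "X + Y = Y + X"
    by transfer (simp add: ae_equal_def square_integrable_add add.commute)
  show "0 + X = X"
    by transfer (simp add: ae_equal_def)
  show "- X + X = 0"
    by transfer (simp add: ae_equal_def square_integrable_zero)
  show "X - Y = X + - Y"
    by transfer (simp add: ae_equal_def square_integrable_diff)
  show "c *\<^sub>R (X + Y) = c *\<^sub>R X + c *\<^sub>R Y"
    by transfer (simp add: ae_equal_def square_integrable_add square_integrable_scaleR scaleR_add_right)
  show "(c + c') *\<^sub>R X = c *\<^sub>R X + c' *\<^sub>R X"
    by transfer (simp add: ae_equal_def square_integrable_add square_integrable_scaleR scaleR_add_left)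
  show "c *\<^sub>R c' *\<^sub>R X = (c * c') *\<^sub>R X"
    by transfer (simp add: ae_equal_def square_integrable_scaleR)
  show "1 *\<^sub>R X = X"
    by transfer (simp add: ae_equal_def)
qed

end

instantiation l2 :: (euclidean_space, euclidean_space) real_inner
begin

lift_definition inner_l2 :: "('a, 'b) l2 \<Rightarrow> ('a, 'b) l2 \<Rightarrow> real" is "\<lambda>f g. LINT x|lebesgue. f x \<bullet> g x"
proof -
  fix f f' g g' :: "'a \<Rightarrow> 'b"
  assume *: "ae_equal f f'" "ae_equal g g'"
  then have "AE x in lebesgue. f x = f' x" "AE x in lebesgue. g x = g' x"
    by (simp_all add: ae_equal_def)
  then have "AE x in lebesgue. f x \<bullet> g x = f' x \<bullet> g' x"
    by eventually_elim simp
  moreover have "f \<in> borel_measurable lebesgue" "g \<in> borel_measurable lebesgue"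
    "f' \<in> borel_measurable lebesgue" "g' \<in> borel_measurable lebesgue"
    using * by (simp_all add: ae_equal_def square_integrable_def)
  ultimately show "(LINT x|lebesgue. f x \<bullet> g x) = (LINT x|lebesgue. f' x \<bullet> g' x)"
    by (intro integral_cong_AE borel_measurable_inner)
qed

definition norm_l2 :: "('a, 'b) l2 \<Rightarrow> real" where
  "norm_l2 X = sqrt (X \<bullet> X)"

definition dist_l2 :: "('a, 'b) l2 \<Rightarrow> ('a, 'b) l2 \<Rightarrow> real" where
  "dist_l2 X Y = norm (X - Y)"

definition sgn_l2 :: "('a, 'b) l2 \<Rightarrow> ('a, 'b) l2" where
  "sgn_l2 X = X /\<^sub>R norm X"

definition uniformity_l2 :: "(('a, 'b) l2 \<times> ('a, 'b) l2) filter" where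
  "uniformity_l2 = (INF e\<in>{0<..}. principal {(X, Y). dist X Y < e})"

definition open_l2 :: "('a, 'b) l2 set \<Rightarrow> bool" where
  "open_l2 U = (\<forall>X\<in>U. eventually (\<lambda>(X', Y). X' = X \<longrightarrow> Y \<in> U) uniformity)"

instance
proof
  fix X Y Z :: "('a, 'b) l2" and c :: real and U :: "('a, 'b) l2 set"
  show "dist X Y = norm (X - Y)"
    by (simp add: dist_l2_def)
  show "sgn X = X /\<^sub>R norm X"
    by (simp add: sgn_l2_def)
  show "uniformity = (INF e\<in>{0<..}. principal {(X :: ('a, 'b) l2, Y). dist X Y < e})"
    by (simp add: uniformity_l2_def)
  show "open U = (\<forall>X\<in>U. eventually (\<lambda>(X', Y). X' = X \<longrightarrow> Y \<in> U) uniformity)"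
    by (simp add: open_l2_def)
  show "X \<bullet> Y = Y \<bullet> X"
    by transfer (simp add: inner_commute)
  show "(X + Y) \<bullet> Z = X \<bullet> Z + Y \<bullet> Z"
    by transfer (simp add: ae_equal_refl inner_add_left square_integrable_inner)
  show "(c *\<^sub>R X) \<bullet> Y = c * (X \<bullet> Y)"
    by transfer simp
  show "0 \<le> X \<bullet> X"
    by transfer simp
  show "X \<bullet> X = 0 \<longleftrightarrow> X = 0"
  proof transfer
    fix f :: "'a \<Rightarrow> 'b"
    assume "ae_equal f f"
    then have f: "square_integrable f"
      by (simp add: ae_equal_refl)
    then show "(LINT x|lebesgue. f x \<bullet> f x) = 0 \<longleftrightarrow> ae_equal f (\<lambda>_. 0)"
      using integral_nonneg_eq_0_iff_AE[OF square_integrable_inner[OF f f]]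
      by (simp add: ae_equal_def square_integrable_zero)
  qed
  show "norm X = sqrt (X \<bullet> X)"
    by (simp add: norm_l2_def)
qed

end

lemma abs_l2_add:
  "square_integrable f \<Longrightarrow> square_integrable g \<Longrightarrow> abs_l2 f + abs_l2 g = abs_l2 (\<lambda>x. f x + g x)"
  by (rule plus_l2.abs_eq) (simp_all add: ae_equal_refl)

lemma abs_l2_diff:
  "square_integrable f \<Longrightarrow> square_integrable g \<Longrightarrow> abs_l2 f - abs_l2 g = abs_l2 (\<lambda>x. f x - g x)"
  by (rule minus_l2.abs_eq) (simp_all add: ae_equal_refl)

lemma abs_l2_scaleR:
  "square_integrable f \<Longrightarrow> c *\<^sub>R abs_l2 f = abs_l2 (\<lambda>x. c *\<^sub>R f x)"
  by (rule scaleR_l2.abs_eq) (simp_all add: ae_equal_refl)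

lemma abs_l2_inner:
  "square_integrable f \<Longrightarrow> square_integrable g \<Longrightarrow> abs_l2 f \<bullet> abs_l2 g = (LINT x|lebesgue. f x \<bullet> g x)"
  by (rule inner_l2.abs_eq) (simp_all add: ae_equal_refl)

lemma abs_l2_norm:
  "square_integrable f \<Longrightarrow> (norm (abs_l2 f))\<^sup>2 = (LINT x|lebesgue. (norm (f x))\<^sup>2)"
  by (simp add: power2_norm_eq_inner abs_l2_inner)

lemma nn_integral_square_diff:
  "(\<integral>\<^sup>+ x. ennreal ((norm (rep_l2 X x - rep_l2 Y x))\<^sup>2) \<partial>lebesgue) = ennreal ((dist X Y)\<^sup>2)"
proof -
  let ?f = "\<lambda>x. rep_l2 X x - rep_l2 Y x"
  have f: "square_integrable ?f"
    by (intro square_integrable_diff square_integrable_rep_l2)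
  have "X - Y = abs_l2 ?f"
    using abs_l2_diff[OF square_integrable_rep_l2 square_integrable_rep_l2, of X Y] by (simp add: abs_rep_l2)
  then have "(dist X Y)\<^sup>2 = (LINT x|lebesgue. (norm (?f x))\<^sup>2)"
    using abs_l2_norm[OF f] by (simp add: dist_norm)
  then show ?thesis
    using f by (simp add: nn_integral_eq_integral square_integrable_def)
qed

text \<open>
The integrals of 2^k |F (k+1) - F k|^2 are still summable, so almost everywhere these functions have a
finite sum; hence |F (k+1) - F k| decays like 2^(-k/2) at almost every point.
\<close>

lemma AE_convergent_of_fast_Cauchy:
  fixes F :: "nat \<Rightarrow> 'a::euclidean_space \<Rightarrow> 'b::euclidean_space"
  assumes meas: "\<And>k. F k \<in> borel_measurable lebesgue"
    and fast: "\<And>k. (\<integral>\<^sup>+ x. ennreal ((norm (F (Suc k) x - F k x))\<^sup>2) \<partial>lebesgue) \<le> ennreal ((1/4)^k)"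
  shows "AE x in lebesgue. convergent (\<lambda>k. F k x)"
proof -
  define D where "D k x = ennreal (2^k * (norm (F (Suc k) x - F k x))\<^sup>2)" for k x
  have D_meas: "D k \<in> borel_measurable lebesgue" for k
    unfolding D_def using meas by measurable
  have "(\<integral>\<^sup>+ x. D k x \<partial>lebesgue) \<le> ennreal ((1/2)^k)" for k
  proof -
    have "(\<integral>\<^sup>+ x. D k x \<partial>lebesgue) = ennreal (2^k) * (\<integral>\<^sup>+ x. ennreal ((norm (F (Suc k) x - F k x))\<^sup>2) \<partial>lebesgue)"
      unfolding D_def using meas by (subst nn_integral_cmult[symmetric]) (auto simp: ennreal_mult)
    also have "\<dots> \<le> ennreal (2^k) * ennreal ((1/4)^k)"
      by (intro mult_left_mono fast) simp
    also have "\<dots> = ennreal ((1/2)^k)"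
      by (simp add: ennreal_mult[symmetric] power_mult_distrib[symmetric])
    finally show ?thesis .
  qed
  then have "(\<Sum>k. \<integral>\<^sup>+ x. D k x \<partial>lebesgue) \<le> (\<Sum>k. ennreal ((1/2)^k))"
    by (intro suminf_le) auto
  also have "\<dots> < \<infinity>"
    by (subst suminf_ennreal2) (auto intro: summable_geometric)
  finally have "(\<integral>\<^sup>+ x. (\<Sum>k. D k x) \<partial>lebesgue) \<noteq> \<infinity>"
    using D_meas by (subst nn_integral_suminf) auto
  then have "AE x in lebesgue. (\<Sum>k. D k x) \<noteq> \<infinity>"
    using D_meas by (intro nn_integral_PInf_AE) auto
  then show ?thesis
  proof eventually_elim
    case (elim x)
    then obtain C where C: "(\<Sum>k. D k x) = ennreal C" "C \<ge> 0"
      by (metis ennreal_cases infinity_ennreal_def)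
    have "norm (F (Suc k) x - F k x) \<le> sqrt C * (sqrt (1/2))^k" for k
    proof -
      have "D k x \<le> ennreal C"
        using sum_le_suminf[of "\<lambda>k. D k x" "{k}"] C(1) by auto
      then have "2^k * (norm (F (Suc k) x - F k x))\<^sup>2 \<le> C"
        unfolding D_def using C(2) by (simp add: ennreal_le_iff)
      then have "(norm (F (Suc k) x - F k x))\<^sup>2 \<le> C * (1/2)^k"
        by (simp add: field_simps)
      then have "sqrt ((norm (F (Suc k) x - F k x))\<^sup>2) \<le> sqrt (C * (1/2)^k)"
        by (rule real_sqrt_le_mono)
      then show ?thesis
        by (simp add: real_sqrt_mult real_sqrt_power)
    qed
    moreover have "summable (\<lambda>k. sqrt C * (sqrt (1/2))^k)"
      by (intro summable_mult summable_geometric) (simp add: real_sqrt_lt_1_iff)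
    ultimately have "summable (\<lambda>k. F (Suc k) x - F k x)"
      using summable_comparison_test'[of "\<lambda>k. sqrt C * (sqrt (1/2))^k" 0 "\<lambda>k. F (Suc k) x - F k x"]
      by blast
    from summable_LIMSEQ[OF this] have "(\<lambda>n. F n x - F 0 x) \<longlonglongrightarrow> (\<Sum>k. F (Suc k) x - F k x)"
      unfolding sum_lessThan_telescope[of "\<lambda>n. F n x"] .
    from tendsto_add[OF this tendsto_const[of "F 0 x"]]
    have "(\<lambda>n. F n x) \<longlonglongrightarrow> (\<Sum>k. F (Suc k) x - F k x) + F 0 x"
      by (simp only: diff_add_cancel)
    then show ?case
      by (rule convergentI)
  qed
qed

text \<open>
The theorem of Riesz and Fischer. A fast subsequence converges almost everywhere, and Fatou's lemma
turns the Cauchy condition into convergence in norm to the pointwise limit.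
\<close>

instance l2 :: (euclidean_space, euclidean_space) complete_space
proof
  fix X :: "nat \<Rightarrow> ('a, 'b) l2"
  assume "Cauchy X"
  have "\<exists>N. \<forall>m\<ge>N. \<forall>n\<ge>N. dist (X m) (X n) < (1/2)^k" for k
    by (rule metric_CauchyD[OF \<open>Cauchy X\<close>]) simp
  then obtain N where N: "\<And>k m n. N k \<le> m \<Longrightarrow> N k \<le> n \<Longrightarrow> dist (X m) (X n) < (1/2)^k"
    by metis
  \<comment> \<open>The partial sums give a monotone choice of indices with r k at least N k.\<close>
  define r where "r k = (\<Sum>i\<le>k. N i)" for k
  have r: "N k \<le> r j" if "k \<le> j" for k j
    unfolding r_def using that by (intro member_le_sum) auto
  define F where "F k = rep_l2 (X (r k))" for k
  have F: "square_integrable (F k)" for k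
    by (simp add: F_def square_integrable_rep_l2)
  have F_close: "(\<integral>\<^sup>+ x. ennreal ((norm (rep_l2 (X m) x - F k x))\<^sup>2) \<partial>lebesgue) \<le> ennreal ((1/4)^j)"
    if "N j \<le> m" "j \<le> k" for m j k
  proof -
    have "(dist (X m) (X (r k)))\<^sup>2 \<le> ((1/2)^j)\<^sup>2"
      using N[OF that(1) r[OF that(2)]] by (intro power_mono) auto
    also have "((1/2)^j)\<^sup>2 = ((1/4)^j :: real)"
      by (simp add: power2_eq_square power_mult_distrib[symmetric])
    finally show ?thesis
      unfolding F_def nn_integral_square_diff by (rule ennreal_leI)
  qed
  have "AE x in lebesgue. convergent (\<lambda>k. F k x)"
    using F F_close[OF r] by (intro AE_convergent_of_fast_Cauchy) (auto simp: F_def square_integrable_measurable)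
  define g where "g x = lim (\<lambda>k. F k x)" for x
  have g_lim: "AE x in lebesgue. (\<lambda>k. F k x) \<longlonglongrightarrow> g x"
    using \<open>AE x in lebesgue. convergent (\<lambda>k. F k x)\<close>
    by eventually_elim (simp add: g_def convergent_LIMSEQ_iff)
  have g_meas: "g \<in> borel_measurable lebesgue"
    unfolding g_def using F by (intro borel_measurable_lim_metric) (simp add: square_integrable_measurable)
  have g_close: "(\<integral>\<^sup>+ x. ennreal ((norm (rep_l2 (X m) x - g x))\<^sup>2) \<partial>lebesgue) \<le> ennreal ((1/4)^j)"
    if m: "N j \<le> m" for m j
  proof -
    let ?h = "rep_l2 (X m)"
    have h_meas: "?h \<in> borel_measurable lebesgue"
      by (intro square_integrable_measurable square_integrable_rep_l2)
    have F_meas: "F k \<in> borel_measurable lebesgue" for k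
      using F by (rule square_integrable_measurable)
    have "(\<integral>\<^sup>+ x. ennreal ((norm (?h x - g x))\<^sup>2) \<partial>lebesgue)
        = (\<integral>\<^sup>+ x. liminf (\<lambda>k. ennreal ((norm (?h x - F k x))\<^sup>2)) \<partial>lebesgue)"
    proof (rule nn_integral_cong_AE)
      show "AE x in lebesgue. ennreal ((norm (?h x - g x))\<^sup>2) = liminf (\<lambda>k. ennreal ((norm (?h x - F k x))\<^sup>2))"
        using g_lim
      proof eventually_elim
        case (elim x)
        then have "(\<lambda>k. ennreal ((norm (?h x - F k x))\<^sup>2)) \<longlonglongrightarrow> ennreal ((norm (?h x - g x))\<^sup>2)"
          by (intro tendsto_intros)
        then show ?case
          using lim_imp_Liminf[OF sequentially_bot] by metis
      qed
    qed
    also have "\<dots> \<le> liminf (\<lambda>k. \<integral>\<^sup>+ x. ennreal ((norm (?h x - F k x))\<^sup>2) \<partial>lebesgue)"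
      using h_meas F_meas by (intro nn_integral_liminf) measurable
    also have "\<dots> \<le> ennreal ((1/4)^j)"
    proof (rule Liminf_le)
      show "\<forall>\<^sub>F k in sequentially. (\<integral>\<^sup>+ x. ennreal ((norm (?h x - F k x))\<^sup>2) \<partial>lebesgue) \<le> ennreal ((1/4)^j)"
        by (rule eventually_sequentiallyI[of j]) (rule F_close[OF m])
    qed simp
    finally show ?thesis .
  qed
  have diff: "square_integrable (\<lambda>x. rep_l2 (X m) x - g x)" if "N 0 \<le> m" for m
    unfolding square_integrable_def
  proof
    show 1: "(\<lambda>x. rep_l2 (X m) x - g x) \<in> borel_measurable lebesgue"
      using g_meas square_integrable_measurable[OF square_integrable_rep_l2] by measurable
    have "(\<integral>\<^sup>+ x. ennreal ((norm (rep_l2 (X m) x - g x))\<^sup>2) \<partial>lebesgue) < \<infinity>"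
      using g_close[OF that] by (simp add: le_less_trans)
    then show "integrable lebesgue (\<lambda>x. (norm (rep_l2 (X m) x - g x))\<^sup>2)"
      using 1 by (intro integrableI_nonneg) auto
  qed
  have "square_integrable (\<lambda>x. rep_l2 (X (N 0)) x - (rep_l2 (X (N 0)) x - g x))"
    by (rule square_integrable_diff[OF square_integrable_rep_l2 diff[OF order_refl]])
  then have g: "square_integrable g"
    by (simp only: diff_diff_eq2 add_diff_cancel_left' add_diff_cancel_right' diff_add_cancel)
  have "dist (X m) (abs_l2 g) \<le> (1/2)^j" if "N j \<le> m" "N 0 \<le> m" for m j
  proof -
    let ?f = "\<lambda>x. rep_l2 (X m) x - g x"
    have "X m - abs_l2 g = abs_l2 ?f"
      using abs_l2_diff[OF square_integrable_rep_l2 g, of "X m"] by (simp add: abs_rep_l2)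
    then have "ennreal ((dist (X m) (abs_l2 g))\<^sup>2) = (\<integral>\<^sup>+ x. ennreal ((norm (?f x))\<^sup>2) \<partial>lebesgue)"
      using abs_l2_norm[OF diff[OF that(2)]] diff[OF that(2)]
      by (simp add: dist_norm nn_integral_eq_integral square_integrable_def)
    also have "\<dots> \<le> ennreal ((1/4)^j)"
      by (rule g_close[OF that(1)])
    finally have "(dist (X m) (abs_l2 g))\<^sup>2 \<le> (1/4)^j"
      by (simp add: ennreal_le_iff)
    also have "(1/4)^j = (((1/2)^j)\<^sup>2 :: real)"
      by (simp add: power2_eq_square power_mult_distrib[symmetric])
    finally show ?thesis
      by (rule power2_le_imp_le) simp
  qed
  then have bound: "dist (X m) (abs_l2 g) \<le> (1/2)^j" if "N j + N 0 \<le> m" for m j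
    using that by simp
  have "X \<longlonglongrightarrow> abs_l2 g"
  proof (rule metric_LIMSEQ_I)
    fix e :: real
    assume "e > 0"
    then obtain j where "(1/2)^j < e"
      using real_arch_pow_inv[of e "1/2"] by auto
    then show "\<exists>n0. \<forall>n\<ge>n0. dist (X n) (abs_l2 g) < e"
      using bound[of j] by (intro exI[of _ "N j + N 0"] allI impI) (rule le_less_trans)
  qed
  then show "convergent X"
    by (auto simp: convergent_def)
qed

section \<open>Smooth functions and test functions\<close>

lemma partial_deriv_eqI:
  assumes "(f has_derivative D) (at x)"
  shows "partial_deriv i f x = D (axis i 1)"
  unfolding partial_deriv_def using frechet_derivative_at[OF assms] by simp

lemma partial_deriv_const: "partial_deriv i (\<lambda>_. c) = (\<lambda>_. 0)"
  by (rule ext) (rule partial_deriv_eqI[OF has_derivative_const])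

lemma partial_deriv_coordinate: "partial_deriv i (\<lambda>x::real^'n. x $ j) = (\<lambda>_. if i = j then 1 else 0)"
proof
  fix x :: "real^'n"
  have "((\<lambda>x::real^'n. x $ j) has_derivative (\<lambda>x. x $ j)) (at x)"
    by (rule bounded_linear_imp_has_derivative[OF bounded_linear_vec_nth])
  from partial_deriv_eqI[OF this] show "partial_deriv i (\<lambda>x. x $ j) x = (if i = j then 1 else 0)"
    by (auto simp: axis_def)
qed

lemma partial_deriv_add:
  assumes "\<And>x. f differentiable (at x)" "\<And>x. g differentiable (at x)"
  shows "partial_deriv i (\<lambda>x. f x + g x) = (\<lambda>x. partial_deriv i f x + partial_deriv i g x)"
proof
  fix x
  show "partial_deriv i (\<lambda>x. f x + g x) x = partial_deriv i f x + partial_deriv i g x"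
    using partial_deriv_eqI[OF has_derivative_add, OF frechet_derivative_works[THEN iffD1] frechet_derivative_works[THEN iffD1], OF assms]
    unfolding partial_deriv_def .
qed

lemma partial_deriv_mult:
  assumes "\<And>x. f differentiable (at x)" "\<And>x. g differentiable (at x)"
  shows "partial_deriv i (\<lambda>x. f x * g x) = (\<lambda>x. f x * partial_deriv i g x + partial_deriv i f x * g x)"
proof
  fix x
  show "partial_deriv i (\<lambda>x. f x * g x) x = f x * partial_deriv i g x + partial_deriv i f x * g x"
    using partial_deriv_eqI[OF has_derivative_mult, OF frechet_derivative_works[THEN iffD1] frechet_derivative_works[THEN iffD1], OF assms]
    unfolding partial_deriv_def .
qed

lemma partial_deriv_compose:
  assumes "\<And>t. (h has_field_derivative h' t) (at t)" "\<And>x. q differentiable (at x)"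
  shows "partial_deriv i (\<lambda>x. h (q x)) = (\<lambda>x. h' (q x) * partial_deriv i q x)"
proof
  fix x
  have "((\<lambda>x. h (q x)) has_derivative (\<lambda>y. h' (q x) * frechet_derivative q (at x) y)) (at x)"
    using has_derivative_compose[OF frechet_derivative_works[THEN iffD1, OF assms(2)]
        has_field_derivative_imp_has_derivative[OF assms(1)], of x] .
  from partial_deriv_eqI[OF this] show "partial_deriv i (\<lambda>x. h (q x)) x = h' (q x) * partial_deriv i q x"
    by (simp add: partial_deriv_def)
qed

lemma C_k_Suc_imp_C_k: "C_k (Suc k) f \<Longrightarrow> C_k k f"
proof (induction k arbitrary: f)
  case 0
  then show ?case
    by (auto intro!: differentiable_imp_continuous_on simp: differentiable_on_def differentiable_at_withinI)
qed auto

lemma C_k_const: "C_k k (\<lambda>_. c)"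
  by (induction k arbitrary: c) (auto simp: partial_deriv_const)

lemma C_k_coordinate: "C_k k (\<lambda>x::real^'n. x $ j)"
proof (cases k)
  case 0
  then show ?thesis
    by (simp add: continuous_on_component)
next
  case (Suc k')
  have "(\<lambda>x::real^'n. x $ j) differentiable (at x)" for x
    by (rule bounded_linear_imp_differentiable[OF bounded_linear_vec_nth])
  then show ?thesis
    using Suc by (simp add: partial_deriv_coordinate C_k_const)
qed

lemma C_k_add: "C_k k f \<Longrightarrow> C_k k g \<Longrightarrow> C_k k (\<lambda>x. f x + g x)"
proof (induction k arbitrary: f g)
  case (Suc k)
  then show ?case
    by (simp add: partial_deriv_add differentiable_add)
qed (simp add: continuous_on_add)

lemma C_k_mult: "C_k k f \<Longrightarrow> C_k k g \<Longrightarrow> C_k k (\<lambda>x. f x * g x)"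
proof (induction k arbitrary: f g)
  case (Suc k)
  then have "C_k k f" "C_k k g"
    using C_k_Suc_imp_C_k by blast+
  then show ?case
    using Suc by (simp add: partial_deriv_mult C_k_add)
qed (simp add: continuous_on_mult)

lemma C_k_diff: "C_k k f \<Longrightarrow> C_k k g \<Longrightarrow> C_k k (\<lambda>x. f x - g x)"
  using C_k_add[of k f "\<lambda>x. (- 1) * g x"] C_k_mult[OF C_k_const[of k "- 1"], of g] by simp

lemma C_k_prod: "finite I \<Longrightarrow> (\<And>i. i \<in> I \<Longrightarrow> C_k k (f i)) \<Longrightarrow> C_k k (\<lambda>x. \<Prod>i\<in>I. f i x)"
  by (induction I rule: finite_induct) (simp_all add: C_k_const C_k_mult)

text \<open>
The derivative of exp (-1/t) / t^n is a combination of the same functions with exponents n + 2 and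
n + 1. Treating the whole family at once therefore gives smoothness by induction.
\<close>

definition flat_exp :: "nat \<Rightarrow> real \<Rightarrow> real" where
  "flat_exp n t = (if t > 0 then exp (- 1 / t) / t ^ n else 0)"

lemma flat_exp_tendsto_0: "(flat_exp n \<longlongrightarrow> 0) (at 0)"
proof (rule filterlim_split_at)
  have "eventually (\<lambda>t. flat_exp n t = 0) (at_left 0)"
    by (auto simp: eventually_at_filter flat_exp_def)
  then show "(flat_exp n \<longlongrightarrow> 0) (at_left 0)"
    by (rule tendsto_eventually)
  have "((\<lambda>t. (inverse t) ^ n / exp (inverse t)) \<longlongrightarrow> (0::real)) (at_right 0)"
    by (rule filterlim_compose[OF tendsto_power_div_exp_0 filterlim_inverse_at_top_right])
  moreover have "eventually (\<lambda>t. (inverse t) ^ n / exp (inverse t) = flat_exp n t) (at_right 0)"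
    by (auto simp: eventually_at_filter flat_exp_def exp_minus field_simps)
  ultimately show "(flat_exp n \<longlongrightarrow> 0) (at_right 0)"
    by (rule Lim_transform_eventually)
qed

lemma flat_exp_has_derivative:
  "(flat_exp n has_field_derivative (flat_exp (n + 2) t - real n * flat_exp (n + 1) t)) (at t)"
proof -
  consider "t > 0" | "t < 0" | "t = 0"
    by linarith
  then show ?thesis
  proof cases
    case 1
    have "((\<lambda>t. exp (- 1 / t) / t ^ n) has_field_derivative
        (flat_exp (n + 2) t - real n * flat_exp (n + 1) t)) (at t)"
      using 1 by (auto intro!: derivative_eq_intros simp: flat_exp_def field_simps power2_eq_square)
        (cases n; simp add: field_simps)
    then show ?thesis
    proof (rule has_field_derivative_transform_within_open[OF _ open_greaterThan])
      show "t \<in> {0<..}"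
        using 1 by simp
      show "exp (- 1 / s) / s ^ n = flat_exp n s" if "s \<in> {0<..}" for s
        using that by (simp add: flat_exp_def)
    qed
  next
    case 2
    have "((\<lambda>_. 0) has_field_derivative 0) (at t)"
      by simp
    then have "(flat_exp n has_field_derivative 0) (at t)"
      by (rule has_field_derivative_transform_within_open[OF _ open_lessThan[of 0]])
        (use 2 in \<open>auto simp: flat_exp_def\<close>)
    then show ?thesis
      using 2 by (simp add: flat_exp_def)
  next
    case 3
    \<comment> \<open>The difference quotient at 0 is the next member of the family, which tends to 0.\<close>
    have "(flat_exp n (0 + h) - flat_exp n 0) / h = flat_exp (n + 1) h" for h
      by (simp add: flat_exp_def)
    then have "(flat_exp n has_field_derivative 0) (at 0)"
      using flat_exp_tendsto_0[of "n + 1"] unfolding DERIV_def by presburger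
    then show ?thesis
      using 3 by (simp add: flat_exp_def)
  qed
qed

lemma C_k_flat_exp_compose:
  assumes "\<And>j. C_k j q"
  shows "C_k k (\<lambda>x. flat_exp n (q x))"
proof (induction k arbitrary: n)
  case 0
  have "continuous_on UNIV (flat_exp n)"
    by (rule DERIV_continuous_on) (rule has_field_derivative_at_within[OF flat_exp_has_derivative])
  then show ?case
    using assms[of 0] continuous_on_compose2[of UNIV "flat_exp n" UNIV q] by simp
next
  case (Suc k)
  have q: "q differentiable (at x)" "C_k k (partial_deriv i q)" for x i
    using assms[of "Suc k"] by auto
  have "(\<lambda>x. flat_exp n (q x)) differentiable (at x)" for x
    unfolding differentiable_def
    using has_derivative_compose[OF frechet_derivative_works[THEN iffD1, OF q(1)]
        has_field_derivative_imp_has_derivative[OF flat_exp_has_derivative]] by blast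
  moreover have "C_k k (partial_deriv i (\<lambda>x. flat_exp n (q x)))" for i
    unfolding partial_deriv_compose[OF flat_exp_has_derivative q(1)]
    by (intro C_k_mult C_k_diff C_k_const Suc q)
  ultimately show ?case
    by simp
qed

lemma test_functionsI:
  assumes "\<And>k. C_k k \<phi>" "compact K" "K \<subseteq> \<Omega>" "\<And>x. x \<notin> K \<Longrightarrow> \<phi> x = 0"
  shows "\<phi> \<in> test_functions \<Omega>"
proof -
  have "{x. \<phi> x \<noteq> 0} \<subseteq> K"
    using assms(4) by blast
  then have "closure {x. \<phi> x \<noteq> 0} \<subseteq> K"
    using compact_imp_closed[OF assms(2)] by (rule closure_minimal)
  moreover from this have "compact (closure {x. \<phi> x \<noteq> 0})"
    using compact_Int_closed[OF assms(2) closed_closure, of "{x. \<phi> x \<noteq> 0}"] by (simp add: Int_absorb1)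
  ultimately show ?thesis
    using assms(1,3) by (auto simp: test_functions_def)
qed

lemma test_functionsE:
  assumes "\<phi> \<in> test_functions \<Omega>"
  shows "(\<forall>k. C_k k \<phi>) \<and> (\<exists>K. compact K \<and> K \<subseteq> \<Omega> \<and> (\<forall>x. x \<notin> K \<longrightarrow> \<phi> x = 0))"
proof -
  have "\<phi> x = 0" if "x \<notin> closure {x. \<phi> x \<noteq> 0}" for x
    using that closure_subset[of "{x. \<phi> x \<noteq> 0}"] by blast
  then show ?thesis
    using assms unfolding test_functions_def mem_Collect_eq by blast
qed

lemma test_functions_outside: "\<phi> \<in> test_functions \<Omega> \<Longrightarrow> x \<notin> \<Omega> \<Longrightarrow> \<phi> x = 0"
  using test_functionsE by blast

lemma test_functions_zero: "(\<lambda>_. 0) \<in> test_functions \<Omega>"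
  by (rule test_functionsI[of _ "{}"]) (simp_all add: C_k_const)

lemma test_functions_add:
  assumes "\<phi> \<in> test_functions \<Omega>" "\<psi> \<in> test_functions \<Omega>"
  shows "(\<lambda>x. \<phi> x + \<psi> x) \<in> test_functions \<Omega>"
proof -
  obtain K where K: "\<forall>k. C_k k \<phi>" "compact K" "K \<subseteq> \<Omega>" "\<forall>x. x \<notin> K \<longrightarrow> \<phi> x = 0"
    using test_functionsE[OF assms(1)] by blast
  obtain L where L: "\<forall>k. C_k k \<psi>" "compact L" "L \<subseteq> \<Omega>" "\<forall>x. x \<notin> L \<longrightarrow> \<psi> x = 0"
    using test_functionsE[OF assms(2)] by blast
  show ?thesis
    by (rule test_functionsI[of _ "K \<union> L"]) (use K L in \<open>simp_all add: C_k_add compact_Un\<close>)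
qed

lemma test_functions_mult:
  assumes "\<phi> \<in> test_functions \<Omega>" "\<And>k. C_k k \<psi>"
  shows "(\<lambda>x. \<psi> x * \<phi> x) \<in> test_functions \<Omega>"
proof -
  obtain K where K: "\<forall>k. C_k k \<phi>" "compact K" "K \<subseteq> \<Omega>" "\<forall>x. x \<notin> K \<longrightarrow> \<phi> x = 0"
    using test_functionsE[OF assms(1)] by blast
  show ?thesis
    by (rule test_functionsI[of _ K]) (use K assms(2) in \<open>simp_all add: C_k_mult\<close>)
qed

lemma test_functions_diff:
  assumes "\<phi> \<in> test_functions \<Omega>" "\<psi> \<in> test_functions \<Omega>"
  shows "(\<lambda>x. \<phi> x - \<psi> x) \<in> test_functions \<Omega>"
  using test_functions_add[OF assms(1) test_functions_mult[OF assms(2) C_k_const[of _ "- 1"]]] by simp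

lemma test_functions_smooth: "\<phi> \<in> test_functions \<Omega> \<Longrightarrow> C_k k \<phi>"
  by (simp add: test_functions_def)

section \<open>Fundamental lemma of the calculus of variations\<close>

text \<open>
The bounds make dominated convergence applicable, so that integrals against the indicator of an
approximable set are limits of integrals against test functions.
\<close>

definition approximable :: "(real^'n) set \<Rightarrow> (real^'n) set \<Rightarrow> bool" where
  "approximable \<Omega> A \<longleftrightarrow> (\<exists>\<phi>. (\<forall>m::nat. \<phi> m \<in> test_functions \<Omega> \<and> (\<forall>x. 0 \<le> \<phi> m x \<and> \<phi> m x \<le> 1)) \<and>
     (\<forall>x. (\<lambda>m. \<phi> m x) \<longlonglongrightarrow> indicator A x))"

lemma approximable_empty: "approximable \<Omega> {}"
  unfolding approximable_def by (rule exI[of _ "\<lambda>_ _. 0"]) (simp add: test_functions_zero)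

text \<open>
The functions 1 - (1 - \<phi>) (1 - \<psi>) approximate the union.
\<close>

lemma approximable_Un:
  assumes "approximable \<Omega> A" "approximable \<Omega> B"
  shows "approximable \<Omega> (A \<union> B)"
proof -
  obtain \<phi> where \<phi>: "\<And>m::nat. \<phi> m \<in> test_functions \<Omega>" "\<And>m x. 0 \<le> \<phi> m x \<and> \<phi> m x \<le> 1"
    "\<And>x. (\<lambda>m. \<phi> m x) \<longlonglongrightarrow> indicator A x"
    using assms(1) unfolding approximable_def by metis
  obtain \<psi> where \<psi>: "\<And>m::nat. \<psi> m \<in> test_functions \<Omega>" "\<And>m x. 0 \<le> \<psi> m x \<and> \<psi> m x \<le> 1"
    "\<And>x. (\<lambda>m. \<psi> m x) \<longlonglongrightarrow> indicator B x"
    using assms(2) unfolding approximable_def by metis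
  have "(\<lambda>x. \<phi> m x + \<psi> m x - \<phi> m x * \<psi> m x) \<in> test_functions \<Omega>" for m
    by (intro test_functions_diff test_functions_add test_functions_mult \<phi> \<psi>) (rule test_functions_smooth[OF \<phi>(1)])
  moreover have "0 \<le> \<phi> m x + \<psi> m x - \<phi> m x * \<psi> m x \<and> \<phi> m x + \<psi> m x - \<phi> m x * \<psi> m x \<le> 1" for m x
  proof -
    have "0 \<le> (1 - \<phi> m x) * (1 - \<psi> m x)" "(1 - \<phi> m x) * (1 - \<psi> m x) \<le> 1"
      using \<phi>(2)[of m x] \<psi>(2)[of m x] by (auto intro: mult_le_one)
    then show ?thesis
      by (simp add: algebra_simps)
  qed
  moreover have "(\<lambda>m. \<phi> m x + \<psi> m x - \<phi> m x * \<psi> m x) \<longlonglongrightarrow>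
      indicator A x + indicator B x - indicator A x * indicator B x" for x
    by (intro tendsto_intros \<phi> \<psi>)
  moreover have "indicator A x + indicator B x - indicator A x * indicator B x = (indicator (A \<union> B) x :: real)" for x
    by (simp add: indicator_def)
  ultimately show ?thesis
    unfolding approximable_def by (intro exI[of _ "\<lambda>m x. \<phi> m x + \<psi> m x - \<phi> m x * \<psi> m x"]) simp
qed

text \<open>
The argument (m + 1) (x_i - p_i) (q_i - x_i) of flat_exp 0 is positive exactly when x_i lies between
p_i and q_i, and then it tends to infinity, so that the factor tends to 1.
\<close>

lemma approximable_box:
  fixes p q :: "real^'n"
  assumes "cbox p q \<subseteq> \<Omega>"
  shows "approximable \<Omega> (box p q)"
proof (cases "box p q = {}")
  case False
  then have pq: "p $ i < q $ i" for i
    by (auto simp: box_ne_empty Basis_vec_def inner_axis)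
  define \<phi> where "\<phi> m x = (\<Prod>i\<in>UNIV. flat_exp 0 (real (Suc m) * ((x $ i - p $ i) * (q $ i - x $ i))))" for m and x :: "real^'n"
  have pos: "0 < (x $ i - p $ i) * (q $ i - x $ i) \<longleftrightarrow> p $ i < x $ i \<and> x $ i < q $ i" for x i
    using pq[of i] by (auto simp: zero_less_mult_iff)
  have fe: "0 \<le> flat_exp 0 t \<and> flat_exp 0 t \<le> 1" for t
    by (simp add: flat_exp_def)
  have smooth: "C_k k (\<phi> m)" for k m
    unfolding \<phi>_def by (intro C_k_prod C_k_flat_exp_compose C_k_mult C_k_diff C_k_const C_k_coordinate) simp
  have zero: "\<phi> m x = 0" if x: "x \<notin> box p q" for m x
  proof -
    obtain i where "\<not> (p $ i < x $ i \<and> x $ i < q $ i)"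
      using x by (auto simp: mem_box_cart)
    then have "\<not> 0 < real (Suc m) * ((x $ i - p $ i) * (q $ i - x $ i))"
      unfolding zero_less_mult_iff[of "real (Suc m)"] pos by simp
    then have "flat_exp 0 (real (Suc m) * ((x $ i - p $ i) * (q $ i - x $ i))) = 0"
      by (simp add: flat_exp_def)
    then show ?thesis
      unfolding \<phi>_def by (intro prod_zero) auto
  qed
  have "\<phi> m \<in> test_functions \<Omega>" for m
    by (rule test_functionsI[OF smooth compact_cbox assms]) (use zero box_subset_cbox in blast)
  moreover have "0 \<le> \<phi> m x \<and> \<phi> m x \<le> 1" for m x
    unfolding \<phi>_def using fe by (intro conjI prod_nonneg prod_le_1) auto
  moreover have "(\<lambda>m. \<phi> m x) \<longlonglongrightarrow> indicator (box p q) x" for x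
  proof (cases "x \<in> box p q")
    case True
    have "(\<lambda>m. flat_exp 0 (real (Suc m) * ((x $ i - p $ i) * (q $ i - x $ i)))) \<longlonglongrightarrow> 1" for i
    proof -
      define c where "c = (x $ i - p $ i) * (q $ i - x $ i)"
      have c: "c > 0"
        unfolding c_def pos using True by (simp add: mem_box_cart)
      have "(\<lambda>m. exp ((- 1 / c) * inverse (real (Suc m)))) \<longlonglongrightarrow> exp ((- 1 / c) * 0)"
        by (intro tendsto_intros LIMSEQ_inverse_real_of_nat)
      moreover have "flat_exp 0 (real (Suc m) * c) = exp ((- 1 / c) * inverse (real (Suc m)))" for m
        using c mult_pos_pos[OF of_nat_0_less_iff[THEN iffD2, OF zero_less_Suc[of m]] c]
        by (simp add: flat_exp_def inverse_eq_divide del: of_nat_Suc)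
      ultimately show ?thesis
        by (simp add: c_def)
    qed
    then have "(\<lambda>m. \<phi> m x) \<longlonglongrightarrow> (\<Prod>i\<in>(UNIV::'n set). 1)"
      unfolding \<phi>_def by (intro tendsto_prod)
    then show ?thesis
      using True by simp
  qed (simp add: zero)
  ultimately show ?thesis
    unfolding approximable_def by blast
qed (simp add: approximable_empty)

text \<open>
The integral of f over an approximable set vanishes. An open subset of \<Omega> is an increasing union of finite
unions of boxes whose closures lie in it, and a measurable set is, up to a null set, a decreasing
intersection of open sets; so the integral of f over every measurable subset of \<Omega> vanishes.
\<close>

lemma fundamental_lemma_calculus_of_variations:
  fixes f :: "real^'n \<Rightarrow> real"
  assumes \<Omega>: "open \<Omega>" and f: "integrable lebesgue f"
    and test: "\<And>\<phi>. \<phi> \<in> test_functions \<Omega> \<Longrightarrow> (LINT x|lebesgue. f x * \<phi> x) = 0"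
  shows "AE x in lebesgue. x \<in> \<Omega> \<longrightarrow> f x = 0"
proof -
  have f_meas: "f \<in> borel_measurable lebesgue"
    using f by (rule borel_measurable_integrable)
  have dominated: "(\<lambda>m. LINT x|lebesgue. f x * g m x) \<longlonglongrightarrow> (LINT x|lebesgue. f x * h x)"
    if "\<And>m. g m \<in> borel_measurable lebesgue" "h \<in> borel_measurable lebesgue"
      "\<And>m x. 0 \<le> g m x \<and> g m x \<le> (1::real)" "\<And>x. (\<lambda>m. g m x) \<longlonglongrightarrow> h x" for g h
  proof (rule integral_dominated_convergence)
    show "integrable lebesgue (\<lambda>x. \<bar>f x\<bar>)"
      using f by simp
    show "(\<lambda>x. f x * g m x) \<in> borel_measurable lebesgue" for m
      by (rule borel_measurable_times[OF f_meas that(1)])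
    show "(\<lambda>x. f x * h x) \<in> borel_measurable lebesgue"
      by (rule borel_measurable_times[OF f_meas that(2)])
    show "AE x in lebesgue. norm (f x * g m x) \<le> \<bar>f x\<bar>" for m
      using that(3)[of m] by (intro AE_I2) (simp add: abs_mult mult_left_le)
    show "AE x in lebesgue. (\<lambda>m. f x * g m x) \<longlonglongrightarrow> f x * h x"
      by (intro AE_I2 tendsto_intros that)
  qed
  have approx: "A \<in> sets borel \<and> (LINT x|lebesgue. f x * indicator A x) = 0" if "approximable \<Omega> A" for A
  proof -
    from that obtain \<phi> where "(\<forall>m::nat. \<phi> m \<in> test_functions \<Omega> \<and> (\<forall>x. 0 \<le> \<phi> m x \<and> \<phi> m x \<le> 1)) \<and>
        (\<forall>x. (\<lambda>m. \<phi> m x) \<longlonglongrightarrow> indicator A x)"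
      unfolding approximable_def ..
    then have \<phi>: "\<And>m. \<phi> m \<in> test_functions \<Omega>" "\<And>m x. 0 \<le> \<phi> m x \<and> \<phi> m x \<le> 1"
      "\<And>x. (\<lambda>m. \<phi> m x) \<longlonglongrightarrow> indicator A x"
      by simp_all
    have \<phi>_cont: "continuous_on UNIV (\<phi> m)" for m
      using test_functions_smooth[OF \<phi>(1), of 0] by simp
    then have \<phi>_borel: "\<phi> m \<in> borel_measurable borel" for m
      by (rule borel_measurable_continuous_onI)
    have ind: "indicat_real A \<in> borel_measurable borel"
      by (rule borel_measurable_LIMSEQ_real[OF \<phi>(3) \<phi>_borel])
    then have A: "A \<in> sets borel"
      by (simp add: borel_measurable_indicator_iff)
    have "\<phi> m \<in> borel_measurable lebesgue" for m
      using \<phi>_borel by (simp add: measurable_completion)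
    moreover have "indicat_real A \<in> borel_measurable lebesgue"
      using ind by (simp add: measurable_completion)
    ultimately have "(\<lambda>m. LINT x|lebesgue. f x * \<phi> m x) \<longlonglongrightarrow> (LINT x|lebesgue. f x * indicator A x)"
      using \<phi> by (intro dominated)
    then have "(LINT x|lebesgue. f x * indicator A x) = 0"
      using test[OF \<phi>(1)] by (simp add: LIMSEQ_const_iff)
    then show ?thesis
      using A by simp
  qed
  have opn: "(LINT x|lebesgue. f x * indicator U x) = 0" if U: "open U" "U \<subseteq> \<Omega>" for U
  proof -
    define \<F> where "\<F> = {box p q |p q. cbox p q \<subseteq> U}"
    have "\<Union>\<F> = U"
    proof (rule equalityI)
      show "\<Union>\<F> \<subseteq> U"
        unfolding \<F>_def using box_subset_cbox subset_trans by blast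
      show "U \<subseteq> \<Union>\<F>"
      proof
        fix x
        assume "x \<in> U"
        then obtain p q where "cbox p q \<subseteq> U" "x \<in> box p q"
          using open_contains_cbox[OF U(1)] by metis
        then show "x \<in> \<Union>\<F>"
          unfolding \<F>_def by blast
      qed
    qed
    obtain \<G> where \<G>: "\<G> \<subseteq> \<F>" "countable \<G>" "\<Union>\<G> = \<Union>\<F>"
      by (rule Lindelof[of \<F>]) (auto simp: \<F>_def)
    \<comment> \<open>The empty set is added so that the enumeration also makes sense when U is empty.\<close>
    define B where "B = from_nat_into (insert {} \<G>)"
    have B_range: "range B = insert {} \<G>"
      unfolding B_def using \<G>(2) by (intro range_from_nat_into) auto
    have B: "approximable \<Omega> (B n)" for n
    proof -
      have "B n \<in> insert {} \<G>"
        using B_range by blast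
      then consider "B n = {}" | p q where "B n = box p q" "cbox p q \<subseteq> U"
        using \<G>(1) by (auto simp: \<F>_def)
      then show ?thesis
      proof cases
        case 2
        then show ?thesis
          using approximable_box[of p q \<Omega>] U(2) by auto
      qed (simp add: approximable_empty)
    qed
    define W where "W n = (\<Union>k<n. B k)" for n
    have W: "approximable \<Omega> (W n)" for n
    proof (induction n)
      case (Suc n)
      have "W (Suc n) = W n \<union> B n"
        by (auto simp: W_def less_Suc_eq)
      then show ?case
        using approximable_Un[OF Suc B] by simp
    qed (simp add: W_def approximable_empty)
    have W_lim: "(\<lambda>n. indicator (W n) x :: real) \<longlonglongrightarrow> indicator U x" for x
    proof (cases "x \<in> U")
      case True
      then have "x \<in> \<Union>(range B)"
        unfolding B_range using \<G>(3) \<open>\<Union>\<F> = U\<close> by simp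
      then obtain k where "x \<in> B k"
        by blast
      then have "indicator (W n) x = (1::real)" if "n \<ge> Suc k" for n
        using that by (auto simp: W_def indicator_def)
      then have "eventually (\<lambda>n. indicator (W n) x = (1::real)) sequentially"
        by (rule eventually_sequentiallyI)
      then show ?thesis
        using True by (simp add: tendsto_eventually)
    next
      case False
      have "B k \<subseteq> U" for k
        using B_range \<G>(3) \<open>\<Union>\<F> = U\<close> by blast
      then have "x \<notin> W n" for n
        using False by (auto simp: W_def)
      then show ?thesis
        using False by simp
    qed
    have meas_W: "indicat_real (W n) \<in> borel_measurable lebesgue" for n
      using approx[OF W[of n]] by (intro borel_measurable_indicator) auto
    have meas_U: "indicat_real U \<in> borel_measurable lebesgue"
      using U(1) by (intro borel_measurable_indicator) auto
    have "(\<lambda>n. LINT x|lebesgue. f x * indicator (W n) x) \<longlonglongrightarrow> (LINT x|lebesgue. f x * indicator U x)"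
      by (rule dominated[OF meas_W meas_U _ W_lim]) simp
    then show ?thesis
      using approx[OF W] by (simp add: LIMSEQ_const_iff)
  qed
  define h where "h x = f x * indicator \<Omega> x" for x
  have h: "integrable lebesgue h"
    unfolding h_def using integrable_mult_indicator[OF _ f, of \<Omega>] \<Omega> by (simp add: mult.commute)
  have "(LINT x|lebesgue. h x * indicator A x) = 0" if A: "A \<in> sets lebesgue" for A
  proof -
    obtain C T where CT: "gdelta C" "T \<in> null_sets lebesgue" "A \<union> T = C" "disjnt A T"
      using lebesgue_set_almost_gdelta[OF A] by metis
    have "\<exists>F. C = (\<Inter>n::nat. F n) \<and> (\<forall>n. open (F n))"
      by (rule gdelta.cases[OF CT(1)]) blast
    then obtain F where FC: "C = (\<Inter>n. F n)" and FO: "\<And>n::nat. open (F n)"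
      by blast
    define W where "W n = (\<Inter>k\<le>n. F k) \<inter> \<Omega>" for n
    have W: "open (W n)" "W n \<subseteq> \<Omega>" for n
      unfolding W_def using FO \<Omega> by (auto intro!: open_INT)
    have W_lim: "(\<lambda>n. indicator (W n) x :: real) \<longlonglongrightarrow> indicator (C \<inter> \<Omega>) x" for x
    proof (cases "x \<in> C \<inter> \<Omega>")
      case True
      then have "x \<in> W n" for n
        by (auto simp: W_def FC)
      then show ?thesis
        using True by simp
    next
      case False
      then consider "x \<notin> \<Omega>" | k where "x \<notin> F k"
        using FC by blast
      then have "eventually (\<lambda>n. indicator (W n) x = (0::real)) sequentially"
      proof cases
        case 2
        then have "indicator (W n) x = (0::real)" if "n \<ge> k" for n
          using that by (auto simp: W_def indicator_def)
        then show ?thesis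
          by (rule eventually_sequentiallyI)
      qed (simp add: W_def)
      then show ?thesis
        using False by (simp add: tendsto_eventually)
    qed
    have C: "C \<in> sets lebesgue"
      using sets.Un[OF A null_setsD2[OF CT(2)]] CT(3) by simp
    have "(\<lambda>n. LINT x|lebesgue. f x * indicator (W n) x) \<longlonglongrightarrow> (LINT x|lebesgue. f x * indicator (C \<inter> \<Omega>) x)"
    proof (rule dominated[OF _ _ _ W_lim])
      show "indicat_real (W n) \<in> borel_measurable lebesgue" for n
        using W(1)[of n] by (intro borel_measurable_indicator) auto
      show "indicat_real (C \<inter> \<Omega>) \<in> borel_measurable lebesgue"
        using C \<Omega> by (intro borel_measurable_indicator) auto
    qed simp
    then have "(LINT x|lebesgue. f x * indicator (C \<inter> \<Omega>) x) = 0"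
      using opn[OF W] by (simp add: LIMSEQ_const_iff)
    moreover have "AE x in lebesgue. h x * indicator A x = f x * indicator (C \<inter> \<Omega>) x"
      using AE_not_in[OF CT(2)] by eventually_elim (use CT(3) in \<open>auto simp: h_def indicator_def\<close>)
    then have "(LINT x|lebesgue. h x * indicator A x) = (LINT x|lebesgue. f x * indicator (C \<inter> \<Omega>) x)"
      using A C \<Omega> f_meas borel_measurable_integrable[OF h]
      by (intro integral_cong_AE borel_measurable_times borel_measurable_indicator sets.Int) auto
    ultimately show ?thesis
      by simp
  qed
  then have "AE x in lebesgue. h x = 0"
    using h by (intro density_unique_real) (simp_all add: set_lebesgue_integral_def mult.commute)
  then show ?thesis
    by eventually_elim (auto simp: h_def)
qed

section \<open>Integration by parts and the Poincare inequality\<close>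

lemma partial_deriv_outside:
  assumes "compact K" "\<And>x. x \<notin> K \<Longrightarrow> f x = (0::real)" "x \<notin> K"
  shows "partial_deriv i f x = 0"
proof -
  have "open (- K)" "x \<in> - K"
    using compact_imp_closed[OF assms(1)] assms(3) by (auto simp: open_closed)
  then have "(f has_derivative (\<lambda>_. 0)) (at x)"
    by (rule has_derivative_transform_within_open[OF has_derivative_const[of 0]]) (simp add: assms(2))
  then show ?thesis
    by (rule partial_deriv_eqI)
qed

lemma test_functions_partial_deriv:
  assumes "\<phi> \<in> test_functions \<Omega>"
  shows "partial_deriv i \<phi> \<in> test_functions \<Omega>"
proof -
  obtain K where K: "\<forall>k. C_k k \<phi>" "compact K" "K \<subseteq> \<Omega>" "\<forall>x. x \<notin> K \<longrightarrow> \<phi> x = 0"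
    using test_functionsE[OF assms] by blast
  have "C_k k (partial_deriv i \<phi>)" for k
    using K(1)[rule_format, of "Suc k"] by simp
  then show ?thesis
    using partial_deriv_outside[OF K(2), of \<phi>] K(4) by (intro test_functionsI[OF _ K(2,3)]) auto
qed

lemma test_functions_differentiable: "\<phi> \<in> test_functions \<Omega> \<Longrightarrow> \<phi> differentiable (at x)"
  using test_functions_smooth[of \<phi> \<Omega> "Suc 0"] by simp

lemma test_functions_continuous: "\<phi> \<in> test_functions \<Omega> \<Longrightarrow> continuous_on UNIV \<phi>"
  using test_functions_smooth[of \<phi> \<Omega> 0] by simp

lemma test_functions_borel: "\<phi> \<in> test_functions \<Omega> \<Longrightarrow> \<phi> \<in> borel_measurable lborel"
  using borel_measurable_continuous_onI[OF test_functions_continuous] by simp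

lemma test_functions_lebesgue: "\<phi> \<in> test_functions \<Omega> \<Longrightarrow> \<phi> \<in> borel_measurable lebesgue"
  using test_functions_borel by (rule measurable_completion)

lemma test_functions_integrable_lborel:
  assumes "\<phi> \<in> test_functions \<Omega>"
  shows "integrable lborel \<phi>"
proof -
  obtain K where K: "compact K" "\<forall>x. x \<notin> K \<longrightarrow> \<phi> x = 0"
    using test_functionsE[OF assms] by blast
  have "integrable lborel (\<lambda>x. indicator K x *\<^sub>R \<phi> x)"
    using K(1) continuous_on_subset[OF test_functions_continuous[OF assms] subset_UNIV]
    by (rule borel_integrable_compact)
  moreover have "(\<lambda>x. indicator K x *\<^sub>R \<phi> x) = \<phi>"
    using K(2) by (intro ext) (auto simp: indicator_def)
  ultimately show ?thesis
    by simp
qed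

lemma test_functions_integrable: "\<phi> \<in> test_functions \<Omega> \<Longrightarrow> integrable lebesgue \<phi>"
  by (simp add: integrable_completion[OF test_functions_borel] test_functions_integrable_lborel del: measurable_lborel1)

lemma test_functions_bounded:
  assumes "\<phi> \<in> test_functions \<Omega>"
  obtains M where "\<And>x. \<bar>\<phi> x\<bar> \<le> M"
proof -
  obtain K where K: "compact K" "\<forall>x. x \<notin> K \<longrightarrow> \<phi> x = 0"
    using test_functionsE[OF assms] by blast
  have "compact (\<phi> ` K)"
    using K(1) continuous_on_subset[OF test_functions_continuous[OF assms] subset_UNIV]
    by (intro compact_continuous_image)
  then obtain M where M: "\<And>y. y \<in> \<phi> ` K \<Longrightarrow> norm y \<le> M"
    using compact_imp_bounded bounded_iff by metis
  have "\<bar>\<phi> x\<bar> \<le> max M 0" for x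
    using M[of "\<phi> x"] K(2) by (cases "x \<in> K") auto
  then show ?thesis
    by (rule that)
qed

lemma line_has_derivative:
  assumes "f differentiable (at (x + t *\<^sub>R axis i 1))"
  shows "((\<lambda>t. f (x + t *\<^sub>R axis i 1)) has_field_derivative partial_deriv i f (x + t *\<^sub>R axis i 1)) (at t)"
proof -
  let ?e = "axis i (1::real)"
  let ?D = "frechet_derivative f (at (x + t *\<^sub>R ?e))"
  have D: "(f has_derivative ?D) (at (x + t *\<^sub>R ?e))"
    using frechet_derivative_works[THEN iffD1, OF assms] .
  have "((\<lambda>t. x + t *\<^sub>R ?e) has_derivative (\<lambda>s. s *\<^sub>R ?e)) (at t)"
    by (auto intro!: derivative_eq_intros)
  then have "((\<lambda>t. f (x + t *\<^sub>R ?e)) has_derivative (\<lambda>s. ?D (s *\<^sub>R ?e))) (at t)"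
    using D by (rule has_derivative_compose)
  moreover have "?D (s *\<^sub>R ?e) = partial_deriv i f (x + t *\<^sub>R ?e) * s" for s
    using linear_scale[OF has_derivative_linear[OF D]] by (simp add: partial_deriv_def)
  ultimately show ?thesis
    by (simp add: has_field_derivative_def)
qed

text \<open>
The integral is invariant under translation, so all difference quotients of \<phi> integrate to 0. They are
bounded by the maximum of the partial derivative and vanish outside a fixed ball.
\<close>

lemma integral_partial_deriv:
  fixes \<phi> :: "real^'n \<Rightarrow> real"
  assumes \<phi>: "\<phi> \<in> test_functions \<Omega>"
  shows "(LINT x|lebesgue. partial_deriv i \<phi> x) = 0"
proof -
  let ?e = "axis i (1::real) :: real^'n"
  define h where "h n = inverse (real (Suc n))" for n
  have h: "0 < h n" "h n \<le> 1" "h n \<noteq> 0" for n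
    by (simp_all add: h_def inverse_le_1_iff)
  define q where "q n x = (\<phi> (x + h n *\<^sub>R ?e) - \<phi> x) / h n" for n x
  have \<phi>_shift: "integrable lborel (\<lambda>x. \<phi> (x + v)) \<and> (LINT x|lborel. \<phi> (x + v)) = (LINT x|lborel. \<phi> x)" for v
  proof -
    have "integrable (distr lborel borel ((+) v)) \<phi>"
      using test_functions_integrable_lborel[OF \<phi>] by (simp add: lborel_distr_plus)
    then have "integrable lborel (\<lambda>x. \<phi> (x + v))"
      using test_functions_borel[OF \<phi>] by (subst (asm) integrable_distr_eq) (simp_all add: add.commute)
    moreover have "(LINT x|lborel. \<phi> x) = (LINT x|distr lborel borel ((+) v). \<phi> x)"
      by (simp add: lborel_distr_plus)
    moreover have "\<dots> = (LINT x|lborel. \<phi> (v + x))"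
      using test_functions_borel[OF \<phi>] by (intro integral_distr) simp_all
    ultimately show ?thesis
      by (simp add: add.commute)
  qed
  have q_integral: "(LINT x|lborel. q n x) = 0" for n
    unfolding q_def using \<phi>_shift[of "h n *\<^sub>R ?e"] test_functions_integrable_lborel[OF \<phi>]
    by (simp add: Bochner_Integration.integral_diff)
  have \<phi>': "partial_deriv i \<phi> \<in> test_functions \<Omega>"
    using \<phi> by (rule test_functions_partial_deriv)
  obtain M where M: "\<And>x. \<bar>partial_deriv i \<phi> x\<bar> \<le> M"
    using test_functions_bounded[OF \<phi>'] by blast
  obtain K where K: "compact K" "\<forall>x. x \<notin> K \<longrightarrow> \<phi> x = 0"
    using test_functionsE[OF \<phi>] by blast
  obtain R where R: "\<And>x. x \<in> K \<Longrightarrow> norm x \<le> R"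
    using compact_imp_bounded[OF K(1)] bounded_iff by metis
  have deriv: "((\<lambda>t. \<phi> (x + t *\<^sub>R ?e)) has_field_derivative partial_deriv i \<phi> (x + t *\<^sub>R ?e)) (at t)" for x t
    by (rule line_has_derivative[OF test_functions_differentiable[OF \<phi>]])
  have "(\<lambda>n. LINT x|lborel. q n x) \<longlonglongrightarrow> (LINT x|lborel. partial_deriv i \<phi> x)"
  proof (rule integral_dominated_convergence)
    show "partial_deriv i \<phi> \<in> borel_measurable lborel"
      using \<phi>' by (rule test_functions_borel)
    have "continuous_on UNIV (q n)" for n
      unfolding q_def using h(3)[of n]
      by (intro continuous_intros continuous_on_compose2[OF test_functions_continuous[OF \<phi>]]) auto
    then show "q n \<in> borel_measurable lborel" for n
      using borel_measurable_continuous_onI[of "q n"] by simp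
    show "integrable lborel (\<lambda>x. M * indicator (cball (0::real^'n) (R + 1)) x)"
      using emeasure_bounded_finite[OF bounded_cball] by (intro integrable_mult_right) (auto simp: integrable_indicator_iff)
    have "(\<lambda>n. q n x) \<longlonglongrightarrow> partial_deriv i \<phi> x" for x
    proof -
      have "((\<lambda>s. (\<phi> (x + (0 + s) *\<^sub>R ?e) - \<phi> (x + 0 *\<^sub>R ?e)) / s) \<longlongrightarrow> partial_deriv i \<phi> (x + 0 *\<^sub>R ?e)) (at 0)"
        using deriv[of x 0] unfolding DERIV_def .
      moreover have "filterlim h (at 0) sequentially"
        unfolding filterlim_at using h(3) LIMSEQ_inverse_real_of_nat by (simp add: h_def[abs_def])
      ultimately show ?thesis
        using filterlim_compose[of "\<lambda>s. (\<phi> (x + (0 + s) *\<^sub>R ?e) - \<phi> (x + 0 *\<^sub>R ?e)) / s"]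
        unfolding q_def by fastforce
    qed
    then show "AE x in lborel. (\<lambda>n. q n x) \<longlonglongrightarrow> partial_deriv i \<phi> x"
      by simp
    have "\<bar>q n x\<bar> \<le> M * indicator (cball 0 (R + 1)) x" for n x
    proof (cases "norm x \<le> R + 1")
      case True
      obtain z where "\<phi> (x + h n *\<^sub>R ?e) - \<phi> (x + 0 *\<^sub>R ?e) = (h n - 0) * partial_deriv i \<phi> (x + z *\<^sub>R ?e)"
        using MVT2[OF h(1)[of n], of "\<lambda>t. \<phi> (x + t *\<^sub>R ?e)" "\<lambda>t. partial_deriv i \<phi> (x + t *\<^sub>R ?e)"] deriv[of x]
        by auto
      then have "q n x = partial_deriv i \<phi> (x + z *\<^sub>R ?e)"
        using h(3)[of n] by (simp add: q_def)
      then show ?thesis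
        using M True by (simp add: dist_norm)
    next
      case False
      have "norm (h n *\<^sub>R ?e) \<le> 1"
        using h(1,2)[of n] by simp
      then have "norm (x + h n *\<^sub>R ?e) > R"
        using norm_diff_ineq[of x "h n *\<^sub>R ?e"] False by linarith
      then have "x + h n *\<^sub>R ?e \<notin> K" "x \<notin> K"
        using R False by force+
      then show ?thesis
        using K(2) False by (simp add: q_def dist_norm)
    qed
    then show "AE x in lborel. norm (q n x) \<le> M * indicator (cball 0 (R + 1)) x" for n
      by simp
  qed
  then have "(LINT x|lborel. partial_deriv i \<phi> x) = 0"
    by (simp add: q_integral LIMSEQ_const_iff)
  then show ?thesis
    using test_functions_borel[OF \<phi>'] by (simp add: integral_completion)
qed

lemma test_functions_product:
  assumes "\<phi> \<in> test_functions \<Omega>" "\<psi> \<in> test_functions \<Omega>"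
  shows "(\<lambda>x. \<phi> x * \<psi> x) \<in> test_functions \<Omega>"
  using test_functions_mult[OF assms(2) test_functions_smooth[OF assms(1)]] .

lemma integration_by_parts:
  assumes "\<phi> \<in> test_functions \<Omega>" "\<psi> \<in> test_functions \<Omega>"
  shows "(LINT x|lebesgue. \<phi> x * partial_deriv i \<psi> x) = - (LINT x|lebesgue. partial_deriv i \<phi> x * \<psi> x)"
proof -
  note prod = test_functions_product[where \<Omega> = \<Omega>]
  have "0 = (LINT x|lebesgue. partial_deriv i (\<lambda>x. \<phi> x * \<psi> x) x)"
    by (rule integral_partial_deriv[symmetric, OF prod[OF assms]])
  also have "\<dots> = (LINT x|lebesgue. \<phi> x * partial_deriv i \<psi> x + partial_deriv i \<phi> x * \<psi> x)"
    unfolding partial_deriv_mult[OF test_functions_differentiable[OF assms(1)] test_functions_differentiable[OF assms(2)]] ..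
  also have "\<dots> = (LINT x|lebesgue. \<phi> x * partial_deriv i \<psi> x) + (LINT x|lebesgue. partial_deriv i \<phi> x * \<psi> x)"
    by (intro Bochner_Integration.integral_add test_functions_integrable[OF prod]
        test_functions_partial_deriv assms)
  finally show ?thesis
    by simp
qed

text \<open>
Integrating x_i \<phi> against the i-th partial derivative of \<phi> by parts gives
\<integral> \<phi>^2 = -2 \<integral> x_i \<phi> \<partial>_i \<phi>. The integrand on the right is at most
\<phi>^2 / 2 + 2 R^2 (\<partial>_i \<phi>)^2, and the first term is absorbed into the left-hand side. Here i is an arbitrary coordinate.
\<close>

lemma poincare_test_functions:
  fixes \<phi> :: "real^'n \<Rightarrow> real"
  assumes \<phi>: "\<phi> \<in> test_functions \<Omega>" and R: "\<And>x. x \<in> \<Omega> \<Longrightarrow> norm x \<le> R"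
  shows "(LINT x|lebesgue. (\<phi> x)\<^sup>2) \<le> 4 * R\<^sup>2 * (LINT x|lebesgue. (norm (grad \<phi> x))\<^sup>2)"
proof -
  fix i :: 'n
  let ?p = "partial_deriv i \<phi>"
  note prod = test_functions_product[where \<Omega> = \<Omega>]
  have p: "?p \<in> test_functions \<Omega>"
    using \<phi> by (rule test_functions_partial_deriv)
  have x\<phi>: "(\<lambda>x. x $ i * \<phi> x) \<in> test_functions \<Omega>"
    by (rule test_functions_mult[OF \<phi> C_k_coordinate])
  have "partial_deriv i (\<lambda>x. x $ i * \<phi> x) = (\<lambda>x. x $ i * ?p x + \<phi> x)"
    by (subst partial_deriv_mult)
      (simp_all add: bounded_linear_imp_differentiable[OF bounded_linear_vec_nth] test_functions_differentiable[OF \<phi>] partial_deriv_coordinate)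
  then have "(LINT x|lebesgue. x $ i * \<phi> x * ?p x) = - (LINT x|lebesgue. (x $ i * ?p x + \<phi> x) * \<phi> x)"
    using integration_by_parts[OF x\<phi> \<phi>, of i] by simp
  also have "\<dots> = - (LINT x|lebesgue. x $ i * \<phi> x * ?p x + \<phi> x * \<phi> x)"
    by (simp add: algebra_simps)
  also have "\<dots> = - ((LINT x|lebesgue. x $ i * \<phi> x * ?p x) + (LINT x|lebesgue. \<phi> x * \<phi> x))"
    by (subst Bochner_Integration.integral_add) (simp_all add: test_functions_integrable[OF prod[OF x\<phi> p]] test_functions_integrable[OF prod[OF \<phi> \<phi>]])
  finally have "(LINT x|lebesgue. \<phi> x * \<phi> x) = - 2 * (LINT x|lebesgue. x $ i * \<phi> x * ?p x)"
    by simp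
  also have "\<dots> = (LINT x|lebesgue. - 2 * (x $ i * \<phi> x * ?p x))"
    by simp
  also have "\<dots> \<le> (LINT x|lebesgue. (1/2) * (\<phi> x * \<phi> x) + 2 * R\<^sup>2 * (?p x * ?p x))"
  proof (rule integral_mono)
    show "integrable lebesgue (\<lambda>x. - 2 * (x $ i * \<phi> x * ?p x))"
      by (intro integrable_mult_right test_functions_integrable[OF prod[OF x\<phi> p]])
    show "integrable lebesgue (\<lambda>x. (1/2) * (\<phi> x * \<phi> x) + 2 * R\<^sup>2 * (?p x * ?p x))"
      by (intro Bochner_Integration.integrable_add integrable_mult_right test_functions_integrable[OF prod] \<phi> p)
    fix x
    show "- 2 * (x $ i * \<phi> x * ?p x) \<le> (1/2) * (\<phi> x * \<phi> x) + 2 * R\<^sup>2 * (?p x * ?p x)"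
    proof (cases "x \<in> \<Omega>")
      case True
      have "\<bar>x $ i\<bar> \<le> R"
        using component_le_norm_cart[of x i] R[OF True] by linarith
      then have "(x $ i)\<^sup>2 \<le> R\<^sup>2"
        using power_mono[of "\<bar>x $ i\<bar>" R 2] by simp
      then have "2 * (x $ i)\<^sup>2 * (?p x * ?p x) \<le> 2 * R\<^sup>2 * (?p x * ?p x)"
        by (intro mult_right_mono) auto
      moreover have "0 \<le> (\<phi> x + 2 * (x $ i * ?p x))\<^sup>2 / 2"
        by simp
      then have "- 2 * (x $ i * \<phi> x * ?p x) \<le> (1/2) * (\<phi> x * \<phi> x) + 2 * (x $ i)\<^sup>2 * (?p x * ?p x)"
        by (simp add: power2_eq_square algebra_simps add_divide_distrib)
      ultimately show ?thesis
        by linarith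
    qed (simp add: test_functions_outside[OF \<phi>])
  qed
  also have "\<dots> = (1/2) * (LINT x|lebesgue. \<phi> x * \<phi> x) + 2 * R\<^sup>2 * (LINT x|lebesgue. ?p x * ?p x)"
    using test_functions_integrable[OF prod[OF \<phi> \<phi>]] test_functions_integrable[OF prod[OF p p]] by simp
  finally have "(LINT x|lebesgue. \<phi> x * \<phi> x) \<le> 4 * R\<^sup>2 * (LINT x|lebesgue. ?p x * ?p x)"
    by simp
  also have "(LINT x|lebesgue. ?p x * ?p x) \<le> (LINT x|lebesgue. (norm (grad \<phi> x))\<^sup>2)"
  proof (rule integral_mono)
    show "integrable lebesgue (\<lambda>x. ?p x * ?p x)"
      by (rule test_functions_integrable[OF prod[OF p p]])
    have eq: "(norm (grad \<phi> x))\<^sup>2 = (\<Sum>j\<in>UNIV. partial_deriv j \<phi> x * partial_deriv j \<phi> x)" for x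
      by (simp add: power2_norm_eq_inner inner_vec_def grad_def)
    show "integrable lebesgue (\<lambda>x. (norm (grad \<phi> x))\<^sup>2)"
      unfolding eq by (intro Bochner_Integration.integrable_sum test_functions_integrable[OF prod] test_functions_partial_deriv \<phi>)
    show "?p x * ?p x \<le> (norm (grad \<phi> x))\<^sup>2" for x
      unfolding eq by (rule member_le_sum[of i UNIV "\<lambda>j. partial_deriv j \<phi> x * partial_deriv j \<phi> x"]) auto
  qed
  finally show ?thesis
    by (simp add: power2_eq_square mult_left_mono)
qed

section \<open>Sobolev spaces as subspaces of a Hilbert space\<close>

definition zero_ext :: "(real^'n) set \<Rightarrow> (real^'n \<Rightarrow> 'b::euclidean_space) \<Rightarrow> real^'n \<Rightarrow> 'b" where
  "zero_ext \<Omega> F x = indicator \<Omega> x *\<^sub>R F x"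

definition l2_class :: "(real^'n) set \<Rightarrow> (real^'n \<Rightarrow> 'b::euclidean_space) \<Rightarrow> (real^'n, 'b) l2" where
  "l2_class \<Omega> F = abs_l2 (zero_ext \<Omega> F)"

lemma zero_ext_add: "zero_ext \<Omega> (\<lambda>x. F x + G x) = (\<lambda>x. zero_ext \<Omega> F x + zero_ext \<Omega> G x)"
  by (rule ext) (simp add: zero_ext_def scaleR_add_right)

lemma zero_ext_scaleR: "zero_ext \<Omega> (\<lambda>x. c *\<^sub>R F x) = (\<lambda>x. c *\<^sub>R zero_ext \<Omega> F x)"
  by (rule ext) (simp add: zero_ext_def)

lemma L2_iff_square_integrable:
  assumes "\<Omega> \<in> sets lebesgue"
  shows "F \<in> L2 \<Omega> \<longleftrightarrow> square_integrable (zero_ext \<Omega> F)"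
proof -
  have \<Omega>: "\<Omega> \<inter> space lebesgue \<in> sets lebesgue"
    using assms by simp
  have "(\<lambda>x. (norm (zero_ext \<Omega> F x))\<^sup>2) = (\<lambda>x. indicator \<Omega> x *\<^sub>R (norm (F x))\<^sup>2)"
    by (rule ext) (simp add: zero_ext_def indicator_def)
  then show ?thesis
    unfolding L2_def square_integrable_def mem_Collect_eq integrable_restrict_space[OF \<Omega>]
      borel_measurable_restrict_space_iff[OF \<Omega>]
    by (simp add: zero_ext_def[abs_def] mult.commute)
qed

lemma L2_add:
  assumes "\<Omega> \<in> sets lebesgue" "F \<in> L2 \<Omega>" "G \<in> L2 \<Omega>"
  shows "(\<lambda>x. F x + G x) \<in> L2 \<Omega>"
  using assms by (simp add: L2_iff_square_integrable zero_ext_add square_integrable_add)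

lemma L2_scaleR:
  assumes "\<Omega> \<in> sets lebesgue" "F \<in> L2 \<Omega>"
  shows "(\<lambda>x. c *\<^sub>R F x) \<in> L2 \<Omega>"
  using assms by (simp add: L2_iff_square_integrable zero_ext_scaleR square_integrable_scaleR)

lemma L2_diff:
  assumes "\<Omega> \<in> sets lebesgue" "F \<in> L2 \<Omega>" "G \<in> L2 \<Omega>"
  shows "(\<lambda>x. F x - G x) \<in> L2 \<Omega>"
  using L2_add[OF assms(1,2) L2_scaleR[OF assms(1,3), of "- 1"]] by simp

lemma l2_class_add:
  assumes "\<Omega> \<in> sets lebesgue" "F \<in> L2 \<Omega>" "G \<in> L2 \<Omega>"
  shows "l2_class \<Omega> (\<lambda>x. F x + G x) = l2_class \<Omega> F + l2_class \<Omega> G"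
  using assms by (simp add: L2_iff_square_integrable l2_class_def zero_ext_add abs_l2_add)

lemma l2_class_scaleR:
  assumes "\<Omega> \<in> sets lebesgue" "F \<in> L2 \<Omega>"
  shows "l2_class \<Omega> (\<lambda>x. c *\<^sub>R F x) = c *\<^sub>R l2_class \<Omega> F"
  using assms by (simp add: L2_iff_square_integrable l2_class_def zero_ext_scaleR abs_l2_scaleR)

lemma l2_class_diff:
  assumes "\<Omega> \<in> sets lebesgue" "F \<in> L2 \<Omega>" "G \<in> L2 \<Omega>"
  shows "l2_class \<Omega> (\<lambda>x. F x - G x) = l2_class \<Omega> F - l2_class \<Omega> G"
  using l2_class_add[OF assms(1,2) L2_scaleR[OF assms(1,3), of "- 1"]] l2_class_scaleR[OF assms(1,3), of "- 1"]
  by simp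

lemma l2_class_inner:
  assumes "\<Omega> \<in> sets lebesgue" "F \<in> L2 \<Omega>" "G \<in> L2 \<Omega>"
  shows "l2_class \<Omega> F \<bullet> l2_class \<Omega> G = L2_inner \<Omega> F G"
proof -
  have "zero_ext \<Omega> F x \<bullet> zero_ext \<Omega> G x = indicator \<Omega> x *\<^sub>R (F x \<bullet> G x)" for x
    by (simp add: zero_ext_def indicator_def)
  then show ?thesis
    using assms by (simp add: L2_iff_square_integrable l2_class_def abs_l2_inner L2_inner_def integral_restrict_space)
qed

lemma l2_class_norm:
  assumes "\<Omega> \<in> sets lebesgue" "F \<in> L2 \<Omega>"
  shows "norm (l2_class \<Omega> F) = L2_norm \<Omega> F"
  using l2_class_inner[OF assms(1,2,2)] by (simp add: L2_norm_def norm_eq_sqrt_inner)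

lemma AE_lebesgue_on_iff:
  assumes "\<Omega> \<in> sets lebesgue"
  shows "(AE x in lebesgue_on \<Omega>. P x) \<longleftrightarrow> (AE x in lebesgue. x \<in> \<Omega> \<longrightarrow> P x)"
  using assms by (intro AE_restrict_space_iff) simp

lemma l2_class_eq_iff:
  assumes "\<Omega> \<in> sets lebesgue" "F \<in> L2 \<Omega>" "G \<in> L2 \<Omega>"
  shows "l2_class \<Omega> F = l2_class \<Omega> G \<longleftrightarrow> (AE x in lebesgue_on \<Omega>. F x = G x)"
proof -
  have "zero_ext \<Omega> F x = zero_ext \<Omega> G x \<longleftrightarrow> (x \<in> \<Omega> \<longrightarrow> F x = G x)" for x
    by (auto simp: zero_ext_def indicator_def)
  then show ?thesis
    using assms by (simp add: L2_iff_square_integrable l2_class_def abs_l2_eq_iff AE_lebesgue_on_iff)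
qed

text \<open>
Lebesgue measure is complete, so changing a function on a null set preserves measurability.
\<close>

lemma borel_measurable_lebesgue_AE:
  fixes F G :: "'a::euclidean_space \<Rightarrow> 'b::euclidean_space"
  assumes "F \<in> borel_measurable lebesgue" "AE x in lebesgue. G x = F x"
  shows "G \<in> borel_measurable lebesgue"
proof (rule measurableI)
  fix S :: "'b set"
  assume "S \<in> sets borel"
  then have "F -` S \<in> sets lebesgue"
    using measurable_sets[OF assms(1)] by fastforce
  moreover have "AE x in lebesgue. x \<in> F -` S \<longleftrightarrow> x \<in> G -` S"
    using assms(2) by eventually_elim simp
  ultimately show "G -` S \<inter> space lebesgue \<in> sets lebesgue"
    using completion.in_sets_AE[of "F -` S" "G -` S" lborel] by simp
qed simp

lemma zero_ext_id:
  assumes "\<And>x. x \<notin> \<Omega> \<Longrightarrow> F x = 0"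
  shows "zero_ext \<Omega> F = F"
proof
  show "zero_ext \<Omega> F x = F x" for x
    using assms[of x] by (cases "x \<in> \<Omega>") (simp_all add: zero_ext_def)
qed

lemma subspace_closure:
  fixes S :: "'h::real_normed_vector set"
  assumes "subspace S"
  shows "subspace (closure S)"
  unfolding subspace_def
proof (intro conjI ballI allI)
  show "0 \<in> closure S"
    using subspace_0[OF assms] closure_subset by blast
  fix x c
  assume "x \<in> closure S"
  then obtain X where X: "\<forall>n. X n \<in> S" "X \<longlonglongrightarrow> x"
    unfolding closure_sequential by blast
  have "\<forall>n. c *\<^sub>R X n \<in> S" "(\<lambda>n. c *\<^sub>R X n) \<longlonglongrightarrow> c *\<^sub>R x"
    using X subspace_scale[OF assms] by (auto intro: tendsto_intros)
  then show "c *\<^sub>R x \<in> closure S"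
    unfolding closure_sequential by (intro exI conjI)
  fix y
  assume "y \<in> closure S"
  then obtain Y where Y: "\<forall>n. Y n \<in> S" "Y \<longlonglongrightarrow> y"
    unfolding closure_sequential by blast
  have "\<forall>n. X n + Y n \<in> S" "(\<lambda>n. X n + Y n) \<longlonglongrightarrow> x + y"
    using X Y subspace_add[OF assms] by (auto intro: tendsto_intros)
  then show "x + y \<in> closure S"
    unfolding closure_sequential by (intro exI conjI)
qed

lemma L2_cong_AE:
  assumes "\<Omega> \<in> sets lebesgue" "F \<in> L2 \<Omega>" "AE x in lebesgue_on \<Omega>. G x = F x"
  shows "G \<in> L2 \<Omega>"
proof -
  have F: "square_integrable (zero_ext \<Omega> F)"
    using assms(1,2) by (simp add: L2_iff_square_integrable)
  have eq: "AE x in lebesgue. zero_ext \<Omega> G x = zero_ext \<Omega> F x"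
    using assms(3) unfolding AE_lebesgue_on_iff[OF assms(1)]
    by eventually_elim (auto simp: zero_ext_def indicator_def)
  have "zero_ext \<Omega> G \<in> borel_measurable lebesgue"
    using borel_measurable_lebesgue_AE[OF square_integrable_measurable[OF F] eq] .
  moreover have "AE x in lebesgue. norm (zero_ext \<Omega> G x) \<le> norm (zero_ext \<Omega> F x)"
    using eq by eventually_elim simp
  ultimately have "square_integrable (zero_ext \<Omega> G)"
    by (rule square_integrable_bound[OF F])
  then show ?thesis
    using assms(1) by (simp add: L2_iff_square_integrable)
qed

lemma L2_rep_l2:
  assumes "\<Omega> \<in> sets lebesgue"
  shows "rep_l2 X \<in> L2 \<Omega>"
proof -
  have "zero_ext \<Omega> (rep_l2 X) \<in> borel_measurable lebesgue"
    unfolding zero_ext_def[abs_def] using assms square_integrable_measurable[OF square_integrable_rep_l2]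
    by (intro borel_measurable_scaleR borel_measurable_indicator) auto
  then have "square_integrable (zero_ext \<Omega> (rep_l2 X))"
    by (rule square_integrable_bound[OF square_integrable_rep_l2[of X]]) (simp add: zero_ext_def indicator_def)
  then show ?thesis
    using assms by (simp add: L2_iff_square_integrable)
qed

lemma rep_l2_l2_class:
  assumes "\<Omega> \<in> sets lebesgue" "F \<in> L2 \<Omega>"
  shows "AE x in lebesgue. rep_l2 (l2_class \<Omega> F) x = zero_ext \<Omega> F x"
proof -
  have F: "square_integrable (zero_ext \<Omega> F)"
    using assms by (simp add: L2_iff_square_integrable)
  show ?thesis
    using abs_rep_l2[of "l2_class \<Omega> F"] abs_l2_eq_iff[OF square_integrable_rep_l2 F]
    unfolding l2_class_def by blast
qed

lemma l2_class_rep_l2_idem: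
  assumes "\<Omega> \<in> sets lebesgue" "F \<in> L2 \<Omega>"
  shows "l2_class \<Omega> (rep_l2 (l2_class \<Omega> F)) = l2_class \<Omega> F"
  unfolding l2_class_eq_iff[OF assms(1) L2_rep_l2[OF assms(1)] assms(2)] AE_lebesgue_on_iff[OF assms(1)]
  using rep_l2_l2_class[OF assms] by eventually_elim (simp add: zero_ext_def)

text \<open>
Cutting a field off outside \<Omega> does not increase its norm, and the classes of fields on \<Omega> are the
fixed points of this operation.
\<close>

lemma closed_l2_class:
  fixes \<Omega> :: "(real^'a) set"
  assumes "\<Omega> \<in> sets lebesgue"
  shows "closed (l2_class \<Omega> ` L2 \<Omega> :: (real^'a, 'b::euclidean_space) l2 set)"
  unfolding closed_sequential_limits
proof (intro allI impI, elim conjE)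
  fix X and Y :: "(real^'a, 'b) l2"
  assume X: "\<forall>n. X n \<in> l2_class \<Omega> ` L2 \<Omega>" and lim: "X \<longlonglongrightarrow> Y"
  define P where "P Z = l2_class \<Omega> (rep_l2 Z)" for Z :: "(real^'a, 'b) l2"
  have P_diff: "P Z - P Z' = l2_class \<Omega> (\<lambda>x. rep_l2 Z x - rep_l2 Z' x)" for Z Z'
    unfolding P_def using l2_class_diff[OF assms L2_rep_l2[OF assms] L2_rep_l2[OF assms], of Z Z'] by simp
  have "norm (P Z - P Z') \<le> norm (Z - Z')" for Z Z'
  proof (rule power2_le_imp_le)
    let ?f = "\<lambda>x. rep_l2 Z x - rep_l2 Z' x"
    have f: "square_integrable ?f"
      by (intro square_integrable_diff square_integrable_rep_l2)
    have f': "square_integrable (zero_ext \<Omega> ?f)"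
      using L2_diff[OF assms L2_rep_l2[OF assms] L2_rep_l2[OF assms], of Z Z'] assms by (simp add: L2_iff_square_integrable)
    have "Z - Z' = abs_l2 ?f"
      using abs_l2_diff[OF square_integrable_rep_l2 square_integrable_rep_l2, of Z Z'] by (simp add: abs_rep_l2)
    then have "(norm (Z - Z'))\<^sup>2 = (LINT x|lebesgue. (norm (?f x))\<^sup>2)"
      using abs_l2_norm[OF f] by simp
    moreover have "(norm (P Z - P Z'))\<^sup>2 = (LINT x|lebesgue. (norm (zero_ext \<Omega> ?f x))\<^sup>2)"
      unfolding P_diff l2_class_def using abs_l2_norm[OF f'] .
    moreover have "(LINT x|lebesgue. (norm (zero_ext \<Omega> ?f x))\<^sup>2) \<le> (LINT x|lebesgue. (norm (?f x))\<^sup>2)"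
      using f f' by (intro integral_mono) (auto simp: square_integrable_def zero_ext_def indicator_def)
    ultimately show "(norm (P Z - P Z'))\<^sup>2 \<le> (norm (Z - Z'))\<^sup>2"
      by simp
  qed simp
  moreover have "P (X n) = X n" for n
    using X[rule_format, of n] l2_class_rep_l2_idem[OF assms] by (auto simp: P_def)
  ultimately have "norm (X n - P Y) \<le> norm (X n - Y)" for n
    by metis
  moreover have "(\<lambda>n. norm (X n - Y)) \<longlonglongrightarrow> 0"
    using lim by (simp add: LIM_zero tendsto_norm_zero)
  ultimately have "(\<lambda>n. X n - P Y) \<longlonglongrightarrow> 0"
    by (intro Lim_null_comparison[of "\<lambda>n. X n - P Y" "\<lambda>n. norm (X n - Y)"]) auto
  then have "X \<longlonglongrightarrow> P Y"
    by (simp add: LIM_zero_iff)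
  then have "Y = P Y"
    using lim LIMSEQ_unique by blast
  then show "Y \<in> l2_class \<Omega> ` L2 \<Omega>"
    unfolding P_def using L2_rep_l2[OF assms] by blast
qed

lemma test_functions_L2:
  fixes \<phi> :: "real^'n \<Rightarrow> real"
  assumes "\<phi> \<in> test_functions \<Omega>" "\<Omega> \<in> sets lebesgue"
  shows "\<phi> \<in> L2 \<Omega>"
proof -
  have "zero_ext \<Omega> \<phi> = \<phi>"
    using test_functions_outside[OF assms(1)] by (rule zero_ext_id)
  moreover have "square_integrable \<phi>"
    unfolding square_integrable_def using test_functions_lebesgue[OF assms(1)]
      test_functions_integrable[OF test_functions_product[OF assms(1,1)]] by (simp add: power2_eq_square)
  ultimately show ?thesis
    using assms(2) by (simp add: L2_iff_square_integrable)
qed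

lemma test_functions_axis_L2:
  fixes \<phi> :: "real^'n \<Rightarrow> real"
  assumes "\<phi> \<in> test_functions \<Omega>" "\<Omega> \<in> sets lebesgue"
  shows "(\<lambda>x. \<phi> x *\<^sub>R axis i 1 :: real^'n) \<in> L2 \<Omega>"
proof -
  have \<phi>: "square_integrable (zero_ext \<Omega> \<phi>)"
    using test_functions_L2[OF assms] assms(2) by (simp add: L2_iff_square_integrable)
  have eq: "zero_ext \<Omega> (\<lambda>x. \<phi> x *\<^sub>R axis i 1 :: real^'n) = (\<lambda>x. zero_ext \<Omega> \<phi> x *\<^sub>R axis i 1)"
    by (rule ext) (simp add: zero_ext_def)
  have "square_integrable (\<lambda>x. zero_ext \<Omega> \<phi> x *\<^sub>R axis i 1 :: real^'n)"
    unfolding square_integrable_def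
    using \<phi> by (auto simp: square_integrable_def intro: borel_measurable_scaleR)
  then show ?thesis
    using assms(2) by (simp add: L2_iff_square_integrable eq)
qed

lemma test_functions_grad_L2:
  fixes \<phi> :: "real^'n \<Rightarrow> real"
  assumes "\<phi> \<in> test_functions \<Omega>" "\<Omega> \<in> sets lebesgue"
  shows "grad \<phi> \<in> L2 \<Omega>"
proof -
  have "grad \<phi> = (\<lambda>x. \<Sum>i\<in>UNIV. partial_deriv i \<phi> x *\<^sub>R axis i 1)"
    by (rule ext) (simp add: grad_def vec_eq_iff axis_def if_distrib cong: if_cong)
  moreover have "(\<lambda>x. \<Sum>i\<in>I. partial_deriv i \<phi> x *\<^sub>R axis i 1 :: real^'n) \<in> L2 \<Omega>" if "finite I" for I
    using that
  proof (induction I rule: finite_induct)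
    case empty
    show ?case
      by (simp add: L2_def)
  next
    case (insert i I)
    then show ?case
      using L2_add[OF assms(2) test_functions_axis_L2[OF test_functions_partial_deriv[OF assms(1)] assms(2)] insert.IH]
      by simp
  qed
  ultimately show ?thesis
    by simp
qed

text \<open>
Written with inner products, the defining identity of weak gradients is linear and continuous in the pair
(u, g), which makes it stable under sums and limits.
\<close>

lemma has_weak_grad_iff_inner:
  fixes u :: "real^'n \<Rightarrow> real"
  assumes "\<Omega> \<in> sets lebesgue" "u \<in> L2 \<Omega>" "g \<in> L2 \<Omega>"
  shows "has_weak_grad \<Omega> u g \<longleftrightarrow> (\<forall>\<phi>\<in>test_functions \<Omega>. \<forall>i.
    l2_class \<Omega> u \<bullet> l2_class \<Omega> (partial_deriv i \<phi>) = - (l2_class \<Omega> g \<bullet> l2_class \<Omega> (\<lambda>x. \<phi> x *\<^sub>R axis i 1)))"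
proof -
  have "(LINT x|lebesgue_on \<Omega>. u x * partial_deriv i \<phi> x) = l2_class \<Omega> u \<bullet> l2_class \<Omega> (partial_deriv i \<phi>)"
    "(LINT x|lebesgue_on \<Omega>. g x $ i * \<phi> x) = l2_class \<Omega> g \<bullet> l2_class \<Omega> (\<lambda>x. \<phi> x *\<^sub>R axis i 1)"
    if \<phi>: "\<phi> \<in> test_functions \<Omega>" for \<phi> i
    using l2_class_inner[OF assms(1,2) test_functions_L2[OF test_functions_partial_deriv[OF \<phi>] assms(1)]]
      l2_class_inner[OF assms(1,3) test_functions_axis_L2[OF \<phi> assms(1)]]
    by (simp_all add: L2_inner_def inner_axis mult.commute)
  then show ?thesis
    by (simp add: has_weak_grad_def)
qed

text \<open>
The components of the difference of two weak gradients annihilate all test functions. They are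
integrable because \<Omega> has finite measure.
\<close>

lemma has_weak_grad_unique:
  fixes u :: "real^'n \<Rightarrow> real"
  assumes "open \<Omega>" "bounded \<Omega>" "g \<in> L2 \<Omega>" "h \<in> L2 \<Omega>" "u \<in> L2 \<Omega>"
    and "has_weak_grad \<Omega> u g" "has_weak_grad \<Omega> u h"
  shows "l2_class \<Omega> g = l2_class \<Omega> h"
proof -
  have \<Omega>: "\<Omega> \<in> sets lebesgue"
    using assms(1) by simp
  have "indicat_real \<Omega> \<in> borel_measurable lebesgue" "integrable lebesgue (indicat_real \<Omega>)"
    using \<Omega> bounded_set_imp_lmeasurable[OF assms(2) \<Omega>] by (simp_all add: lmeasurable_iff_integrable)
  moreover have "(\<lambda>x. (norm (indicator \<Omega> x *\<^sub>R axis i (1::real) :: real^'n))\<^sup>2) = (\<lambda>x. indicator \<Omega> x :: real)" for i :: 'n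
    by (rule ext) (simp add: indicator_def)
  ultimately have ind: "square_integrable (\<lambda>x. indicator \<Omega> x *\<^sub>R axis i (1::real) :: real^'n)" for i
    unfolding square_integrable_def by (auto intro: borel_measurable_scaleR)
  have d: "(\<lambda>x. g x - h x) \<in> L2 \<Omega>"
    using L2_diff[OF \<Omega> assms(3,4)] .
  then have d': "square_integrable (zero_ext \<Omega> (\<lambda>x. g x - h x))"
    using \<Omega> by (simp add: L2_iff_square_integrable)
  have "AE x in lebesgue. x \<in> \<Omega> \<longrightarrow> zero_ext \<Omega> (\<lambda>x. g x - h x) x $ i = 0" for i
  proof (rule fundamental_lemma_calculus_of_variations[OF assms(1)])
    have "zero_ext \<Omega> (\<lambda>x. g x - h x) x \<bullet> (indicator \<Omega> x *\<^sub>R axis i 1) = zero_ext \<Omega> (\<lambda>x. g x - h x) x $ i" for x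
      by (simp add: inner_axis zero_ext_def indicator_def)
    then show "integrable lebesgue (\<lambda>x. zero_ext \<Omega> (\<lambda>x. g x - h x) x $ i)"
      using square_integrable_inner[OF d' ind[of i]] by simp
    fix \<phi> :: "real^'n \<Rightarrow> real"
    assume \<phi>: "\<phi> \<in> test_functions \<Omega>"
    have "l2_class \<Omega> (\<lambda>x. g x - h x) \<bullet> l2_class \<Omega> (\<lambda>x. \<phi> x *\<^sub>R axis i 1) = 0"
      using assms(6)[unfolded has_weak_grad_iff_inner[OF \<Omega> assms(5,3)], rule_format, OF \<phi>, of i]
        assms(7)[unfolded has_weak_grad_iff_inner[OF \<Omega> assms(5,4)], rule_format, OF \<phi>, of i]
      by (simp add: l2_class_diff[OF \<Omega> assms(3,4)] inner_diff_left)
    then have "(LINT x|lebesgue_on \<Omega>. (g x - h x) \<bullet> (\<phi> x *\<^sub>R axis i 1)) = 0"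
      using l2_class_inner[OF \<Omega> d test_functions_axis_L2[OF \<phi> \<Omega>]] by (simp add: L2_inner_def)
    moreover have "indicator \<Omega> x *\<^sub>R ((g x - h x) \<bullet> (\<phi> x *\<^sub>R axis i 1)) = zero_ext \<Omega> (\<lambda>x. g x - h x) x $ i * \<phi> x" for x
      by (simp add: inner_axis zero_ext_def)
    ultimately show "(LINT x|lebesgue. zero_ext \<Omega> (\<lambda>x. g x - h x) x $ i * \<phi> x) = 0"
      using \<Omega> by (simp add: integral_restrict_space del: inner_scaleR_right)
  qed
  then have "AE x in lebesgue. \<forall>i. x \<in> \<Omega> \<longrightarrow> zero_ext \<Omega> (\<lambda>x. g x - h x) x $ i = 0"
    unfolding AE_all_countable by blast
  then have "AE x in lebesgue. x \<in> \<Omega> \<longrightarrow> g x = h x"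
    by eventually_elim (auto simp: zero_ext_def vec_eq_iff)
  then show ?thesis
    unfolding l2_class_eq_iff[OF \<Omega> assms(3,4)] AE_lebesgue_on_iff[OF \<Omega>] .
qed

locale bounded_domain =
  fixes \<Omega> :: "(real^'n) set"
  assumes open_domain: "open \<Omega>" and bounded_domain: "bounded \<Omega>"
begin

lemma sets_domain: "\<Omega> \<in> sets lebesgue"
  using open_domain by simp

lemmas domain_L2 = L2_add[OF sets_domain] L2_diff[OF sets_domain] L2_scaleR[OF sets_domain]

text \<open>
The first-order jet turns the norm of H1 into the norm of a product of Hilbert spaces, so that statements
about H1 and H10 become statements about subspaces of this product.
\<close>

definition jet :: "(real^'n \<Rightarrow> real) \<Rightarrow> (real^'n, real) l2 \<times> (real^'n, real^'n) l2" where
  "jet u = (l2_class \<Omega> u, l2_class \<Omega> (wgrad \<Omega> u))"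

lemma H1_L2: "u \<in> H1 \<Omega> \<Longrightarrow> u \<in> L2 \<Omega>"
  by (simp add: H1_def)

lemma wgrad_L2: "u \<in> H1 \<Omega> \<Longrightarrow> wgrad \<Omega> u \<in> L2 \<Omega>"
  and wgrad_weak: "u \<in> H1 \<Omega> \<Longrightarrow> has_weak_grad \<Omega> u (wgrad \<Omega> u)"
proof -
  assume "u \<in> H1 \<Omega>"
  then have "\<exists>g. g \<in> L2 \<Omega> \<and> has_weak_grad \<Omega> u g"
    by (auto simp: H1_def)
  from someI_ex[OF this] show "wgrad \<Omega> u \<in> L2 \<Omega>" "has_weak_grad \<Omega> u (wgrad \<Omega> u)"
    by (simp_all add: wgrad_def)
qed

lemma H1I_jet:
  assumes "u \<in> L2 \<Omega>" "g \<in> L2 \<Omega>" "has_weak_grad \<Omega> u g"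
  shows "u \<in> H1 \<Omega> \<and> jet u = (l2_class \<Omega> u, l2_class \<Omega> g)"
proof -
  have u: "u \<in> H1 \<Omega>"
    using assms by (auto simp: H1_def)
  then show ?thesis
    using has_weak_grad_unique[OF open_domain bounded_domain wgrad_L2[OF u] assms(2,1) wgrad_weak[OF u] assms(3)]
    by (simp add: jet_def)
qed

lemma H1_add: "u \<in> H1 \<Omega> \<Longrightarrow> v \<in> H1 \<Omega> \<Longrightarrow> (\<lambda>x. u x + v x) \<in> H1 \<Omega> \<and> jet (\<lambda>x. u x + v x) = jet u + jet v"
proof -
  assume u: "u \<in> H1 \<Omega>" and v: "v \<in> H1 \<Omega>"
  let ?g = "\<lambda>x. wgrad \<Omega> u x + wgrad \<Omega> v x"
  have L2: "(\<lambda>x. u x + v x) \<in> L2 \<Omega>" "?g \<in> L2 \<Omega>"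
    by (intro domain_L2 H1_L2 wgrad_L2 u v)+
  have "has_weak_grad \<Omega> (\<lambda>x. u x + v x) ?g"
    using wgrad_weak[OF u] wgrad_weak[OF v]
    unfolding has_weak_grad_iff_inner[OF sets_domain L2] has_weak_grad_iff_inner[OF sets_domain H1_L2[OF u] wgrad_L2[OF u]]
      has_weak_grad_iff_inner[OF sets_domain H1_L2[OF v] wgrad_L2[OF v]]
    by (simp add: l2_class_add[OF sets_domain H1_L2[OF u] H1_L2[OF v]]
        l2_class_add[OF sets_domain wgrad_L2[OF u] wgrad_L2[OF v]] inner_add_left)
  from H1I_jet[OF L2 this] show ?thesis
    by (simp add: jet_def l2_class_add[OF sets_domain H1_L2[OF u] H1_L2[OF v]]
        l2_class_add[OF sets_domain wgrad_L2[OF u] wgrad_L2[OF v]])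
qed

lemma H1_scaleR: "u \<in> H1 \<Omega> \<Longrightarrow> (\<lambda>x. c * u x) \<in> H1 \<Omega> \<and> jet (\<lambda>x. c * u x) = c *\<^sub>R jet u"
proof -
  assume u: "u \<in> H1 \<Omega>"
  let ?g = "\<lambda>x. c *\<^sub>R wgrad \<Omega> u x"
  have L2: "(\<lambda>x. c *\<^sub>R u x) \<in> L2 \<Omega>" "?g \<in> L2 \<Omega>"
    by (intro domain_L2 H1_L2 wgrad_L2 u)+
  have "has_weak_grad \<Omega> (\<lambda>x. c *\<^sub>R u x) ?g"
    using wgrad_weak[OF u]
    unfolding has_weak_grad_iff_inner[OF sets_domain L2] has_weak_grad_iff_inner[OF sets_domain H1_L2[OF u] wgrad_L2[OF u]]
    by (simp only: l2_class_scaleR[OF sets_domain H1_L2[OF u]] l2_class_scaleR[OF sets_domain wgrad_L2[OF u]] inner_scaleR_left) simp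
  from H1I_jet[OF L2 this] show ?thesis
    using l2_class_scaleR[OF sets_domain H1_L2[OF u], of c] l2_class_scaleR[OF sets_domain wgrad_L2[OF u], of c]
    by (simp add: jet_def)
qed

lemma H1_diff: "u \<in> H1 \<Omega> \<Longrightarrow> v \<in> H1 \<Omega> \<Longrightarrow> (\<lambda>x. u x - v x) \<in> H1 \<Omega> \<and> jet (\<lambda>x. u x - v x) = jet u - jet v"
  using H1_add[of u "\<lambda>x. (- 1) * v x"] H1_scaleR[of v "- 1"] by simp

lemma H1_inner_jet: "u \<in> H1 \<Omega> \<Longrightarrow> v \<in> H1 \<Omega> \<Longrightarrow> H1_inner \<Omega> u v = jet u \<bullet> jet v"
  by (simp add: H1_inner_def jet_def inner_prod_def l2_class_inner[OF sets_domain] H1_L2 wgrad_L2)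

lemma H1_norm_jet: "u \<in> H1 \<Omega> \<Longrightarrow> H1_norm \<Omega> u = norm (jet u)"
  by (simp add: H1_norm_def H1_inner_jet norm_eq_sqrt_inner)

lemma H1_zero: "(\<lambda>_. 0) \<in> H1 \<Omega> \<and> jet (\<lambda>_. 0) = 0"
proof -
  have "(\<lambda>_. 0 :: real) \<in> H1 \<Omega>"
    using H1I_jet[of "\<lambda>_. 0" "\<lambda>_. 0"] by (simp add: has_weak_grad_def L2_def)
  then show ?thesis
    using H1_scaleR[of "\<lambda>_. 0" 0] by simp
qed

text \<open>
This is the completeness of H1.
\<close>

lemma closed_jets: "closed (jet ` H1 \<Omega>)"
  unfolding closed_sequential_limits
proof (intro allI impI, elim conjE)
  fix X Y
  assume X: "\<forall>n. X n \<in> jet ` H1 \<Omega>" and lim: "X \<longlonglongrightarrow> Y"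
  obtain u where u: "\<And>n. u n \<in> H1 \<Omega>" "\<And>n. X n = jet (u n)"
  proof -
    have "\<forall>n. \<exists>u. u \<in> H1 \<Omega> \<and> X n = jet u"
      using X by blast
    from choice[OF this] show ?thesis
      using that by blast
  qed
  have lim1: "(\<lambda>n. l2_class \<Omega> (u n)) \<longlonglongrightarrow> fst Y" and lim2: "(\<lambda>n. l2_class \<Omega> (wgrad \<Omega> (u n))) \<longlonglongrightarrow> snd Y"
    using tendsto_fst[OF lim] tendsto_snd[OF lim] by (simp_all add: u(2) jet_def)
  obtain w where w: "w \<in> L2 \<Omega>" "fst Y = l2_class \<Omega> w"
    using closed_sequentially[OF closed_l2_class[OF sets_domain] _ lim1] H1_L2[OF u(1)] by blast
  obtain g where g: "g \<in> L2 \<Omega>" "snd Y = l2_class \<Omega> g"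
    using closed_sequentially[OF closed_l2_class[OF sets_domain] _ lim2] wgrad_L2[OF u(1)] by blast
  have "has_weak_grad \<Omega> w g"
    unfolding has_weak_grad_iff_inner[OF sets_domain w(1) g(1)] w(2)[symmetric] g(2)[symmetric]
  proof (intro ballI allI)
    fix \<phi> i
    assume \<phi>: "\<phi> \<in> test_functions \<Omega>"
    let ?P = "l2_class \<Omega> (partial_deriv i \<phi>)" and ?A = "l2_class \<Omega> (\<lambda>x. \<phi> x *\<^sub>R axis i 1)"
    have "(\<lambda>n. l2_class \<Omega> (u n) \<bullet> ?P) \<longlonglongrightarrow> fst Y \<bullet> ?P"
      by (intro tendsto_intros lim1)
    moreover have "(\<lambda>n. - (l2_class \<Omega> (wgrad \<Omega> (u n)) \<bullet> ?A)) \<longlonglongrightarrow> - (snd Y \<bullet> ?A)"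
      by (intro tendsto_intros lim2)
    moreover have "l2_class \<Omega> (u n) \<bullet> ?P = - (l2_class \<Omega> (wgrad \<Omega> (u n)) \<bullet> ?A)" for n
      using wgrad_weak[OF u(1)[of n]] \<phi>
      unfolding has_weak_grad_iff_inner[OF sets_domain H1_L2[OF u(1)] wgrad_L2[OF u(1)]] by blast
    ultimately show "fst Y \<bullet> ?P = - (snd Y \<bullet> ?A)"
      using LIMSEQ_unique by simp
  qed
  then have "w \<in> H1 \<Omega> \<and> jet w = Y"
    using H1I_jet[OF w(1) g(1)] by (simp add: w(2)[symmetric] g(2)[symmetric])
  then show "Y \<in> jet ` H1 \<Omega>"
    by blast
qed

lemma test_functions_H1:
  assumes "\<phi> \<in> test_functions \<Omega>"
  shows "\<phi> \<in> H1 \<Omega> \<and> jet \<phi> = (l2_class \<Omega> \<phi>, l2_class \<Omega> (grad \<phi>))"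
proof (rule H1I_jet)
  show "\<phi> \<in> L2 \<Omega>" "grad \<phi> \<in> L2 \<Omega>"
    by (rule test_functions_L2[OF assms sets_domain], rule test_functions_grad_L2[OF assms sets_domain])
  show "has_weak_grad \<Omega> \<phi> (grad \<phi>)"
    unfolding has_weak_grad_def
  proof (intro ballI allI)
    fix \<psi> i
    assume \<psi>: "\<psi> \<in> test_functions \<Omega>"
    have "indicator \<Omega> x *\<^sub>R (\<phi> x * partial_deriv i \<psi> x) = \<phi> x * partial_deriv i \<psi> x"
      "indicator \<Omega> x *\<^sub>R (grad \<phi> x $ i * \<psi> x) = partial_deriv i \<phi> x * \<psi> x" for x
      using test_functions_outside[OF assms, of x] test_functions_outside[OF \<psi>, of x]
      by (auto simp: indicator_def grad_def)
    then show "(LINT x|lebesgue_on \<Omega>. \<phi> x * partial_deriv i \<psi> x) = - (LINT x|lebesgue_on \<Omega>. grad \<phi> x $ i * \<psi> x)"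
      using integration_by_parts[OF assms \<psi>, of i] sets_domain by (simp add: integral_restrict_space del: real_scaleR_def)
  qed
qed

text \<open>
By the lemmas H10_iff and jets0_H10 these are the jets of H10.
\<close>

definition jets0 :: "((real^'n, real) l2 \<times> (real^'n, real^'n) l2) set" where
  "jets0 = closure (jet ` test_functions \<Omega>)"

lemma subspace_jets0: "subspace jets0"
  unfolding jets0_def
proof (rule subspace_closure)
  show "subspace (jet ` test_functions \<Omega>)"
    unfolding subspace_def
  proof (intro conjI ballI allI)
    show "0 \<in> jet ` test_functions \<Omega>"
      using H1_zero test_functions_zero[of \<Omega>] by (metis image_eqI)
    fix x c
    assume x: "x \<in> jet ` test_functions \<Omega>"
    then obtain \<phi> where \<phi>: "\<phi> \<in> test_functions \<Omega>" "x = jet \<phi>"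
      by blast
    then have "(\<lambda>x. c * \<phi> x) \<in> test_functions \<Omega>" "jet (\<lambda>x. c * \<phi> x) = c *\<^sub>R x"
      using test_functions_mult[OF \<phi>(1) C_k_const[of _ c]] H1_scaleR test_functions_H1 by auto
    then show "c *\<^sub>R x \<in> jet ` test_functions \<Omega>"
      by (metis image_eqI)
    fix y
    assume "y \<in> jet ` test_functions \<Omega>"
    then obtain \<psi> where \<psi>: "\<psi> \<in> test_functions \<Omega>" "y = jet \<psi>"
      by blast
    then have "(\<lambda>x. \<phi> x + \<psi> x) \<in> test_functions \<Omega>" "jet (\<lambda>x. \<phi> x + \<psi> x) = x + y"
      using \<phi> test_functions_add H1_add test_functions_H1 by auto
    then show "x + y \<in> jet ` test_functions \<Omega>"
      by (metis image_eqI)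
  qed
qed

lemma H10_iff: "u \<in> H10 \<Omega> \<longleftrightarrow> u \<in> H1 \<Omega> \<and> jet u \<in> jets0"
proof -
  have lim_iff: "(\<lambda>k. H1_norm \<Omega> (\<lambda>x. \<phi> k x - u x)) \<longlonglongrightarrow> 0 \<longleftrightarrow> (\<lambda>k. jet (\<phi> k)) \<longlonglongrightarrow> jet u"
    if "u \<in> H1 \<Omega>" "\<And>k. \<phi> k \<in> test_functions \<Omega>" for \<phi> :: "nat \<Rightarrow> real^'n \<Rightarrow> real"
  proof -
    have "H1_norm \<Omega> (\<lambda>x. \<phi> k x - u x) = norm (jet (\<phi> k) - jet u)" for k
      using H1_diff[of "\<phi> k" u] test_functions_H1[OF that(2)] that(1) H1_norm_jet by simp
    then show ?thesis
      by (simp add: tendsto_norm_zero_iff LIM_zero_iff)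
  qed
  show ?thesis
  proof
    assume "u \<in> H10 \<Omega>"
    then obtain \<phi> where u: "u \<in> H1 \<Omega>" and \<phi>: "\<And>k::nat. \<phi> k \<in> test_functions \<Omega>"
      "(\<lambda>k. H1_norm \<Omega> (\<lambda>x. \<phi> k x - u x)) \<longlonglongrightarrow> 0"
      unfolding H10_def by blast
    then have "(\<lambda>k. jet (\<phi> k)) \<longlonglongrightarrow> jet u"
      using lim_iff by blast
    then show "u \<in> H1 \<Omega> \<and> jet u \<in> jets0"
      unfolding jets0_def closure_sequential using u \<phi>(1)
      by (intro conjI exI[of _ "\<lambda>k. jet (\<phi> k)"]) auto
  next
    assume u: "u \<in> H1 \<Omega> \<and> jet u \<in> jets0"
    then obtain X where X: "\<And>k. X k \<in> jet ` test_functions \<Omega>" "X \<longlonglongrightarrow> jet u"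
      unfolding jets0_def closure_sequential by blast
    obtain \<phi> where \<phi>: "\<And>k. \<phi> k \<in> test_functions \<Omega>" "\<And>k. X k = jet (\<phi> k)"
    proof -
      have "\<forall>k. \<exists>\<phi>. \<phi> \<in> test_functions \<Omega> \<and> X k = jet \<phi>"
        using X(1) by blast
      from choice[OF this] show ?thesis
        using that by blast
    qed
    then have "(\<lambda>k. H1_norm \<Omega> (\<lambda>x. \<phi> k x - u x)) \<longlonglongrightarrow> 0"
      using lim_iff[of \<phi>] u X(2) by (simp add: \<phi>(2)[symmetric])
    then show "u \<in> H10 \<Omega>"
      unfolding H10_def using u \<phi>(1) by blast
  qed
qed

lemma jets0_H10:
  assumes "X \<in> jets0"
  shows "\<exists>u\<in>H10 \<Omega>. jet u = X"
proof -
  have "jets0 \<subseteq> jet ` H1 \<Omega>"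
    unfolding jets0_def
  proof (rule closure_minimal[OF _ closed_jets])
    show "jet ` test_functions \<Omega> \<subseteq> jet ` H1 \<Omega>"
      using test_functions_H1 by (intro image_mono) blast
  qed
  then obtain u where "u \<in> H1 \<Omega>" "X = jet u"
    using assms by blast
  then have "u \<in> H10 \<Omega>"
    using assms by (simp only: H10_iff)
  then show ?thesis
    using \<open>X = jet u\<close> by blast
qed

lemma H10_H1: "u \<in> H10 \<Omega> \<Longrightarrow> u \<in> H1 \<Omega>"
  by (simp add: H10_iff)

lemma H10_diff: "u \<in> H10 \<Omega> \<Longrightarrow> v \<in> H10 \<Omega> \<Longrightarrow> (\<lambda>x. u x - v x) \<in> H10 \<Omega>"
  using H1_diff[of u v] subspace_diff[OF subspace_jets0] by (simp add: H10_iff)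

lemma H10_add: "u \<in> H10 \<Omega> \<Longrightarrow> v \<in> H10 \<Omega> \<Longrightarrow> (\<lambda>x. u x + v x) \<in> H10 \<Omega>"
  using H1_add[of u v] subspace_add[OF subspace_jets0] by (simp add: H10_iff)

lemma test_functions_H10: "\<phi> \<in> test_functions \<Omega> \<Longrightarrow> \<phi> \<in> H10 \<Omega>"
  unfolding H10_iff jets0_def
  using test_functions_H1 closure_subset[THEN subsetD, OF imageI, of \<phi> "test_functions \<Omega>" jet] by blast

lemma bdry_trace_eq_iff:
  assumes "v \<in> H1 \<Omega>" "w \<in> H1 \<Omega>"
  shows "bdry_trace \<Omega> v = bdry_trace \<Omega> w \<longleftrightarrow> (\<lambda>x. v x - w x) \<in> H10 \<Omega>"
proof
  assume "bdry_trace \<Omega> v = bdry_trace \<Omega> w"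
  moreover have "v \<in> bdry_trace \<Omega> v"
    using assms(1) test_functions_H10[OF test_functions_zero] by (simp add: bdry_trace_def)
  ultimately show "(\<lambda>x. v x - w x) \<in> H10 \<Omega>"
    by (simp add: bdry_trace_def)
next
  assume vw: "(\<lambda>x. v x - w x) \<in> H10 \<Omega>"
  have "(\<lambda>x. z x - v x) \<in> H10 \<Omega> \<longleftrightarrow> (\<lambda>x. z x - w x) \<in> H10 \<Omega>" for z
    using H10_add[OF _ vw, of "\<lambda>x. z x - v x"] H10_diff[OF _ vw, of "\<lambda>x. z x - w x"] by auto
  then show "bdry_trace \<Omega> v = bdry_trace \<Omega> w"
    by (simp add: bdry_trace_def)
qed

text \<open>
The set of pairs (U, X) with |U| \<le> 2 R |X| is closed and contains the jets of test functions.
\<close>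

lemma poincare:
  obtains C where "\<And>u. u \<in> H10 \<Omega> \<Longrightarrow> norm (l2_class \<Omega> u) \<le> C * norm (l2_class \<Omega> (wgrad \<Omega> u))" "C \<ge> 0"
proof -
  obtain R where R: "\<And>x. x \<in> \<Omega> \<Longrightarrow> norm x \<le> R" "R > 0"
    using bounded_domain bounded_pos by metis
  define S where "S = {X :: (real^'n, real) l2 \<times> (real^'n, real^'n) l2. norm (fst X) \<le> 2 * R * norm (snd X)}"
  have "closed S"
    unfolding S_def by (intro closed_Collect_le continuous_intros)
  moreover have "jet ` test_functions \<Omega> \<subseteq> S"
  proof
    fix X
    assume "X \<in> jet ` test_functions \<Omega>"
    then obtain \<phi> where \<phi>: "\<phi> \<in> test_functions \<Omega>" "X = jet \<phi>"
      by blast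
    have grad_out: "grad \<phi> x = 0" if "x \<notin> \<Omega>" for x
      using test_functions_outside[OF test_functions_partial_deriv[OF \<phi>(1)] that] by (simp add: grad_def vec_eq_iff)
    have ext: "zero_ext \<Omega> \<phi> = \<phi>" "zero_ext \<Omega> (grad \<phi>) = grad \<phi>"
      using test_functions_outside[OF \<phi>(1)] grad_out by (auto intro!: zero_ext_id)
    have L2: "square_integrable \<phi>" "square_integrable (grad \<phi>)"
      using test_functions_L2[OF \<phi>(1) sets_domain] test_functions_grad_L2[OF \<phi>(1) sets_domain]
      by (simp_all add: L2_iff_square_integrable[OF sets_domain] ext)
    have "(norm (l2_class \<Omega> \<phi>))\<^sup>2 \<le> 4 * R\<^sup>2 * (norm (l2_class \<Omega> (grad \<phi>)))\<^sup>2"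
      using poincare_test_functions[OF \<phi>(1) R(1)] by (simp add: l2_class_def ext abs_l2_norm L2)
    also have "\<dots> = (2 * R * norm (l2_class \<Omega> (grad \<phi>)))\<^sup>2"
      by (simp add: power_mult_distrib)
    finally have "norm (l2_class \<Omega> \<phi>) \<le> 2 * R * norm (l2_class \<Omega> (grad \<phi>))"
      using R(2) by (intro power2_le_imp_le[of "norm (l2_class \<Omega> \<phi>)"]) auto
    then show "X \<in> S"
      using test_functions_H1[OF \<phi>(1)] by (simp add: S_def \<phi>(2))
  qed
  ultimately have "jets0 \<subseteq> S"
    unfolding jets0_def by (intro closure_minimal)
  then show ?thesis
    using that[of "2 * R"] R(2) by (force simp: S_def H10_iff jet_def)
qed

definition gradients0 :: "(real^'n, real^'n) l2 set" where
  "gradients0 = snd ` jets0"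

lemma gradients0_H10:
  assumes "X \<in> gradients0"
  shows "\<exists>u\<in>H10 \<Omega>. l2_class \<Omega> (wgrad \<Omega> u) = X"
proof -
  obtain J where "J \<in> jets0" "X = snd J"
    using assms unfolding gradients0_def by blast
  moreover obtain u where "u \<in> H10 \<Omega>" "jet u = J"
    using jets0_H10[OF \<open>J \<in> jets0\<close>] by blast
  ultimately show ?thesis
    by (auto simp: jet_def)
qed

lemma H10_gradients0: "u \<in> H10 \<Omega> \<Longrightarrow> l2_class \<Omega> (wgrad \<Omega> u) \<in> gradients0"
  unfolding gradients0_def H10_iff jet_def by force

lemma subspace_gradients0: "subspace gradients0"
  unfolding gradients0_def by (intro linear_subspace_image subspace_jets0 bounded_linear.linear bounded_linear_snd)

lemma H10_gradient_diff:
  assumes "u \<in> H10 \<Omega>" "v \<in> H10 \<Omega>"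
  shows "l2_class \<Omega> (\<lambda>x. u x - v x) = l2_class \<Omega> u - l2_class \<Omega> v"
    "l2_class \<Omega> (wgrad \<Omega> (\<lambda>x. u x - v x)) = l2_class \<Omega> (wgrad \<Omega> u) - l2_class \<Omega> (wgrad \<Omega> v)"
  using H1_diff[OF H10_H1[OF assms(1)] H10_H1[OF assms(2)]] by (simp_all add: jet_def)

text \<open>
By the Poincare inequality, convergence of the gradients forces convergence of the functions, and jets0 is
closed.
\<close>

lemma closed_gradients0: "closed gradients0"
  unfolding closed_sequential_limits
proof (intro allI impI, elim conjE)
  fix X Y
  assume X: "\<forall>n. X n \<in> gradients0" and lim: "X \<longlonglongrightarrow> Y"
  obtain C where C: "\<And>u. u \<in> H10 \<Omega> \<Longrightarrow> norm (l2_class \<Omega> u) \<le> C * norm (l2_class \<Omega> (wgrad \<Omega> u))" "C \<ge> 0"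
    using poincare by blast
  have "\<exists>u. u \<in> H10 \<Omega> \<and> l2_class \<Omega> (wgrad \<Omega> u) = X n" for n
    using gradients0_H10[OF X[rule_format, of n]] by blast
  then obtain u where u: "\<And>n. u n \<in> H10 \<Omega>" "\<And>n. l2_class \<Omega> (wgrad \<Omega> (u n)) = X n"
    by metis
  have bound: "norm (l2_class \<Omega> (u m) - l2_class \<Omega> (u n)) \<le> C * norm (X m - X n)" for m n
    using C(1)[OF H10_diff[OF u(1) u(1)]] by (simp add: H10_gradient_diff[OF u(1) u(1)] u(2))
  have "Cauchy (\<lambda>n. l2_class \<Omega> (u n))"
  proof (rule metric_CauchyI)
    fix e :: real
    assume "e > 0"
    then have "e / (C + 1) > 0"
      using C(2) by simp
    then obtain M where M: "\<And>m n. m \<ge> M \<Longrightarrow> n \<ge> M \<Longrightarrow> dist (X m) (X n) < e / (C + 1)"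
      using metric_CauchyD[OF LIMSEQ_imp_Cauchy[OF lim]] by blast
    have "dist (l2_class \<Omega> (u m)) (l2_class \<Omega> (u n)) < e" if "m \<ge> M" "n \<ge> M" for m n
    proof -
      have "norm (l2_class \<Omega> (u m) - l2_class \<Omega> (u n)) \<le> (C + 1) * norm (X m - X n)"
        unfolding distrib_right using bound[of m n] norm_ge_zero[of "X m - X n"] by linarith
      also have "\<dots> < e"
        using M[OF that] C(2) by (simp add: dist_norm field_simps)
      finally show ?thesis
        by (simp add: dist_norm)
    qed
    then show "\<exists>M. \<forall>m\<ge>M. \<forall>n\<ge>M. dist (l2_class \<Omega> (u m)) (l2_class \<Omega> (u n)) < e"
      by blast
  qed
  then obtain U where U: "(\<lambda>n. l2_class \<Omega> (u n)) \<longlonglongrightarrow> U"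
    using Cauchy_convergent convergent_def by blast
  have "(\<lambda>n. jet (u n)) \<longlonglongrightarrow> (U, Y)"
    unfolding jet_def u(2) by (intro tendsto_Pair U lim)
  moreover have "jet (u n) \<in> jets0" for n
    using u(1) by (simp add: H10_iff)
  ultimately have "(U, Y) \<in> jets0"
    using closed_sequentially[of jets0 "\<lambda>n. jet (u n)" "(U, Y)"] closed_closure unfolding jets0_def by blast
  then show "Y \<in> gradients0"
    unfolding gradients0_def by force
qed

end

section \<open>Soft thresholding and the subdifferential of the weighted norm\<close>

text \<open>
The vector w = 0 is mapped to 0 for any value of the factor, which agrees with the second case of the
algorithm.
\<close>

definition shrink :: "real \<Rightarrow> 'b::euclidean_space \<Rightarrow> 'b" where
  "shrink t w = (max (norm w - t) 0 / norm w) *\<^sub>R w"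

lemma shrink_eq_algorithm:
  "(if norm w \<noteq> 0 then max (norm w - t) 0 *\<^sub>R (w /\<^sub>R norm w) - z else - z) = shrink t w - z"
  by (simp add: shrink_def divide_inverse)

text \<open>
If |w| \<le> t, then w is left over completely. Otherwise w splits into two parallel vectors, the first of
norm t. In both cases w - shrink t w is a subgradient of t |y| at y = shrink t w.
\<close>

lemma shrink_resolvent:
  assumes "0 \<le> t"
  shows "norm (w - shrink t w) \<le> t" "(w - shrink t w) \<bullet> shrink t w = t * norm (shrink t w)"
    "norm (shrink t w) \<le> norm w"
proof -
  have "norm (w - shrink t w) \<le> t \<and> (w - shrink t w) \<bullet> shrink t w = t * norm (shrink t w) \<and>
      norm (shrink t w) \<le> norm w"
  proof (cases "norm w \<le> t")
    case True
    then have "shrink t w = 0"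
      by (simp add: shrink_def)
    then show ?thesis
      using True by simp
  next
    case False
    then have w: "norm w > 0" "t < norm w"
      using assms by auto
    define r where "r = t / norm w"
    have r: "0 \<le> r" "r < 1" "t = r * norm w"
      using w assms by (simp_all add: r_def)
    have "shrink t w = (1 - r) *\<^sub>R w"
      using w by (simp add: shrink_def r_def diff_divide_distrib)
    moreover from this have "w - shrink t w = r *\<^sub>R w"
      by (simp add: algebra_simps)
    ultimately show ?thesis
      using r by (simp add: power2_norm_eq_inner[symmetric] power2_eq_square mult_left_le_one_le)
  qed
  then show "norm (w - shrink t w) \<le> t" "(w - shrink t w) \<bullet> shrink t w = t * norm (shrink t w)"
    "norm (shrink t w) \<le> norm w"
    by blast+
qed

lemma square_integrable_shrink:
  assumes "square_integrable w" "t \<in> borel_measurable lebesgue" "AE x in lebesgue. 0 \<le> t x"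
  shows "square_integrable (\<lambda>x. shrink (t x) (w x))"
proof (rule square_integrable_bound[OF assms(1)])
  show "(\<lambda>x. shrink (t x) (w x)) \<in> borel_measurable lebesgue"
    unfolding shrink_def using square_integrable_measurable[OF assms(1)] assms(2)
    by measurable
  show "AE x in lebesgue. norm (shrink (t x) (w x)) \<le> norm (w x)"
    using assms(3) by eventually_elim (simp add: shrink_resolvent(3))
qed

lemma rep_abs_l2: "square_integrable F \<Longrightarrow> AE x in lebesgue. rep_l2 (abs_l2 F) x = F x"
  using abs_rep_l2[of "abs_l2 F"] abs_l2_eq_iff[OF square_integrable_rep_l2] by blast

lemma inner_rep_l2: "X \<bullet> Y = (LINT x|lebesgue. rep_l2 X x \<bullet> rep_l2 Y x)"
  using abs_l2_inner[OF square_integrable_rep_l2 square_integrable_rep_l2, of X Y] by (simp add: abs_rep_l2)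

lemma rep_l2_diff: "AE x in lebesgue. rep_l2 (X - Y) x = rep_l2 X x - rep_l2 Y x"
  using rep_abs_l2[OF square_integrable_diff[OF square_integrable_rep_l2 square_integrable_rep_l2], of X Y]
    abs_l2_diff[OF square_integrable_rep_l2 square_integrable_rep_l2, of X Y] by (simp add: abs_rep_l2)

text \<open>
In the application t is a/\<lambda> and G is \<nabla>u_f, both extended by zero. Outside of the domain t
vanishes, which forces the subgradients to vanish there.
\<close>

locale weighted_norm =
  fixes t :: "'a::euclidean_space \<Rightarrow> real" and G :: "'a \<Rightarrow> 'b::euclidean_space"
  assumes t: "square_integrable t" and t_nonneg: "AE x in lebesgue. 0 \<le> t x"
    and G: "square_integrable G"
begin

definition weighted_l1 :: "('a, 'b) l2 \<Rightarrow> real" where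
  "weighted_l1 d = (LINT x|lebesgue. t x * norm (rep_l2 d x + G x))"

text \<open>
The graph of the subdifferential of weighted_l1, described pointwise: the two conditions say that b is
a subgradient of the weighted norm at d + G.
\<close>

definition subdiff :: "(('a, 'b) l2 \<times> ('a, 'b) l2) set" where
  "subdiff = {(d, b). AE x in lebesgue. norm (rep_l2 b x) \<le> t x \<and>
     rep_l2 b x \<bullet> (rep_l2 d x + G x) = t x * norm (rep_l2 d x + G x)}"

lemma abs_l2_subdiff_iff:
  assumes "square_integrable D" "square_integrable B"
  shows "(abs_l2 D, abs_l2 B) \<in> subdiff \<longleftrightarrow>
    (AE x in lebesgue. norm (B x) \<le> t x \<and> B x \<bullet> (D x + G x) = t x * norm (D x + G x))"
proof -
  have "AE x in lebesgue. (norm (rep_l2 (abs_l2 B) x) \<le> t x \<and>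
      rep_l2 (abs_l2 B) x \<bullet> (rep_l2 (abs_l2 D) x + G x) = t x * norm (rep_l2 (abs_l2 D) x + G x)) \<longleftrightarrow>
      (norm (B x) \<le> t x \<and> B x \<bullet> (D x + G x) = t x * norm (D x + G x))"
    using rep_abs_l2[OF assms(1)] rep_abs_l2[OF assms(2)] by eventually_elim simp
  then show ?thesis
    unfolding subdiff_def mem_Collect_eq case_prod_conv by (rule eventually_subst)
qed

lemma abs_l2_weighted_l1:
  assumes "square_integrable D"
  shows "weighted_l1 (abs_l2 D) = (LINT x|lebesgue. t x * norm (D x + G x))"
  unfolding weighted_l1_def
proof (rule integral_cong_AE)
  show "(\<lambda>x. t x * norm (rep_l2 (abs_l2 D) x + G x)) \<in> borel_measurable lebesgue"
    "(\<lambda>x. t x * norm (D x + G x)) \<in> borel_measurable lebesgue"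
    using t G assms square_integrable_rep_l2[of "abs_l2 D"]
    by (auto simp: square_integrable_def intro!: borel_measurable_times borel_measurable_norm borel_measurable_add)
  show "AE x in lebesgue. t x * norm (rep_l2 (abs_l2 D) x + G x) = t x * norm (D x + G x)"
    using rep_abs_l2[OF assms] by eventually_elim simp
qed

lemma weighted_l1_integrable:
  assumes "square_integrable F"
  shows "integrable lebesgue (\<lambda>x. t x * norm (F x))"
proof -
  have "square_integrable (\<lambda>x. norm (F x))"
    using assms by (auto simp: square_integrable_def intro: borel_measurable_norm)
  from square_integrable_inner[OF t this] show ?thesis
    by simp
qed

lemma subdiff_monotone:
  assumes "(d, b) \<in> subdiff" "(d', b') \<in> subdiff"
  shows "(b - b') \<bullet> (d - d') \<ge> 0"
  unfolding inner_rep_l2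
proof (rule integral_nonneg_AE)
  have db: "AE x in lebesgue. norm (rep_l2 b x) \<le> t x \<and>
      rep_l2 b x \<bullet> (rep_l2 d x + G x) = t x * norm (rep_l2 d x + G x)"
    and db': "AE x in lebesgue. norm (rep_l2 b' x) \<le> t x \<and>
      rep_l2 b' x \<bullet> (rep_l2 d' x + G x) = t x * norm (rep_l2 d' x + G x)"
    using assms by (simp_all add: subdiff_def)
  show "AE x in lebesgue. 0 \<le> rep_l2 (b - b') x \<bullet> rep_l2 (d - d') x"
    using db db' rep_l2_diff[of b b'] rep_l2_diff[of d d']
  proof eventually_elim
    case (elim x)
    define y y' where "y = rep_l2 d x + G x" "y' = rep_l2 d' x + G x"
    have "rep_l2 b x \<bullet> y' \<le> t x * norm y'" "rep_l2 b' x \<bullet> y \<le> t x * norm y"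
      using elim(1,2) norm_cauchy_schwarz order_trans mult_right_mono norm_ge_zero by metis+
    moreover have "rep_l2 d x - rep_l2 d' x = y - y'"
      by (simp add: y_y'_def)
    ultimately show ?case
      using elim by (simp add: y_y'_def[symmetric] inner_diff_left inner_diff_right)
  qed
qed

text \<open>
Soft thresholding of w + G computes the resolvent pointwise.
\<close>

lemma subdiff_resolvent: "\<exists>y. (y, w - y) \<in> subdiff"
proof -
  define W where "W x = rep_l2 w x + G x" for x
  define Y where "Y x = shrink (t x) (W x) - G x" for x
  have W: "square_integrable W"
    unfolding W_def by (intro square_integrable_add square_integrable_rep_l2 G)
  have Y: "square_integrable Y"
    unfolding Y_def by (intro square_integrable_diff square_integrable_shrink W G square_integrable_measurable[OF t] t_nonneg)
  have "w - abs_l2 Y = abs_l2 (\<lambda>x. rep_l2 w x - Y x)"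
    using abs_l2_diff[OF square_integrable_rep_l2 Y, of w] by (simp add: abs_rep_l2)
  moreover have "(abs_l2 Y, abs_l2 (\<lambda>x. rep_l2 w x - Y x)) \<in> subdiff"
    unfolding abs_l2_subdiff_iff[OF Y square_integrable_diff[OF square_integrable_rep_l2 Y]]
    using t_nonneg
  proof eventually_elim
    case (elim x)
    have "rep_l2 w x - Y x = W x - shrink (t x) (W x)" "Y x + G x = shrink (t x) (W x)"
      by (simp_all add: W_def Y_def)
    then show ?case
      using shrink_resolvent[OF elim, of "W x"] by simp
  qed
  ultimately show ?thesis
    by metis
qed

text \<open>
Maximality describes the subgradients at d as an intersection of closed half-spaces, which makes closedness
and convexity evident in the lemma that follows.
\<close>

lemma subdiff_iff_monotone:
  "(d, b) \<in> subdiff \<longleftrightarrow> (\<forall>(y, c)\<in>subdiff. (b - c) \<bullet> (d - y) \<ge> 0)"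
proof
  assume "\<forall>(y, c)\<in>subdiff. (b - c) \<bullet> (d - y) \<ge> 0"
  then show "(d, b) \<in> subdiff"
    by (intro monotone_resolvent_maximal[of subdiff, OF subdiff_resolvent]) auto
qed (use subdiff_monotone in auto)

lemma subdiff_values:
  shows "closed {b. (d, b) \<in> subdiff}" "convex {b. (d, b) \<in> subdiff}"
proof -
  have eq: "{b. (d, b) \<in> subdiff} = (\<Inter>(y, c)\<in>subdiff. {b. (d - y) \<bullet> b \<ge> (d - y) \<bullet> c})"
    unfolding subdiff_iff_monotone[of d] by (auto simp: inner_diff_left inner_diff_right inner_commute)
  show "closed {b. (d, b) \<in> subdiff}"
    unfolding eq by (intro closed_INT ballI) (auto intro: closed_halfspace_ge)
  show "convex {b. (d, b) \<in> subdiff}"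
    unfolding eq by (intro convex_INT) (auto intro: convex_halfspace_ge)
qed

lemma subdiff_norm_le:
  assumes "(d, b) \<in> subdiff"
  shows "norm b \<le> norm (abs_l2 t)"
proof (rule power2_le_imp_le)
  have b: "AE x in lebesgue. norm (rep_l2 b x) \<le> t x"
    using assms unfolding subdiff_def mem_Collect_eq case_prod_conv by (rule eventually_mono) simp
  have "(norm b)\<^sup>2 = (LINT x|lebesgue. (norm (rep_l2 b x))\<^sup>2)"
    using abs_l2_norm[OF square_integrable_rep_l2, of b] by (simp add: abs_rep_l2)
  also have "\<dots> \<le> (LINT x|lebesgue. (norm (t x))\<^sup>2)"
  proof (rule integral_mono_AE)
    show "integrable lebesgue (\<lambda>x. (norm (rep_l2 b x))\<^sup>2)" "integrable lebesgue (\<lambda>x. (norm (t x))\<^sup>2)"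
      using square_integrable_rep_l2[of b] t by (simp_all add: square_integrable_def)
    show "AE x in lebesgue. (norm (rep_l2 b x))\<^sup>2 \<le> (norm (t x))\<^sup>2"
      using b by eventually_elim (intro power_mono, auto)
  qed
  also have "\<dots> = (norm (abs_l2 t))\<^sup>2"
    using abs_l2_norm[OF t] by simp
  finally show "(norm b)\<^sup>2 \<le> (norm (abs_l2 t))\<^sup>2" .
qed simp

lemma subgradient_inequality:
  assumes "(d, b) \<in> subdiff"
  shows "weighted_l1 d + b \<bullet> (y - d) \<le> weighted_l1 y"
proof -
  have int: "integrable lebesgue (\<lambda>x. t x * norm (rep_l2 z x + G x))" for z
    by (intro weighted_l1_integrable square_integrable_add square_integrable_rep_l2 G)
  have int_b: "integrable lebesgue (\<lambda>x. rep_l2 b x \<bullet> rep_l2 (y - d) x)"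
    by (intro square_integrable_inner square_integrable_rep_l2)
  have "weighted_l1 d + b \<bullet> (y - d) = (LINT x|lebesgue. t x * norm (rep_l2 d x + G x) + rep_l2 b x \<bullet> rep_l2 (y - d) x)"
    unfolding weighted_l1_def inner_rep_l2 by (rule Bochner_Integration.integral_add[symmetric, OF int int_b])
  also have "\<dots> \<le> weighted_l1 y"
    unfolding weighted_l1_def
  proof (rule integral_mono_AE)
    show "integrable lebesgue (\<lambda>x. t x * norm (rep_l2 d x + G x) + rep_l2 b x \<bullet> rep_l2 (y - d) x)"
      by (intro Bochner_Integration.integrable_add int int_b)
    show "integrable lebesgue (\<lambda>x. t x * norm (rep_l2 y x + G x))"
      by (rule int)
    have db: "AE x in lebesgue. norm (rep_l2 b x) \<le> t x \<and>
      rep_l2 b x \<bullet> (rep_l2 d x + G x) = t x * norm (rep_l2 d x + G x)"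
      using assms by (simp add: subdiff_def)
    show "AE x in lebesgue. t x * norm (rep_l2 d x + G x) + rep_l2 b x \<bullet> rep_l2 (y - d) x \<le> t x * norm (rep_l2 y x + G x)"
      using db rep_l2_diff[of y d]
    proof eventually_elim
      case (elim x)
      have "rep_l2 b x \<bullet> (rep_l2 y x + G x) \<le> norm (rep_l2 b x) * norm (rep_l2 y x + G x)"
        by (rule norm_cauchy_schwarz)
      also have "\<dots> \<le> t x * norm (rep_l2 y x + G x)"
        using elim(1) by (intro mult_right_mono) auto
      finally show ?case
        using elim by (simp add: inner_add_right inner_diff_right)
    qed
  qed
  finally show ?thesis .
qed

text \<open>
A subgradient at d + s h has a nonnegative inner product with h, because the functional does not decrease
from d to d + s h. As s tends to 0, the subgradients with the direction of Y + s H converge pointwise to a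
subgradient at d: to the direction of Y where Y is nonzero, and to the direction of H elsewhere.
\<close>

lemma directional_subgradient:
  assumes min: "\<And>s. s > 0 \<Longrightarrow> weighted_l1 d \<le> weighted_l1 (d + s *\<^sub>R h)"
  shows "\<exists>b. (d, b) \<in> subdiff \<and> b \<bullet> h \<ge> 0"
proof -
  define Y where "Y x = rep_l2 d x + G x" for x
  define H where "H = rep_l2 h"
  define B where "B s x = t x *\<^sub>R sgn (Y x + s *\<^sub>R H x)" for s x
  define B0 where "B0 x = t x *\<^sub>R sgn (if Y x = 0 then H x else Y x)" for x
  have Y: "square_integrable Y" and H: "square_integrable H"
    unfolding Y_def H_def by (intro square_integrable_add square_integrable_rep_l2 G)+
  have t_meas: "t \<in> borel_measurable lebesgue" and Y_meas: "Y \<in> borel_measurable lebesgue"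
    and H_meas: "H \<in> borel_measurable lebesgue"
    using t Y H by (simp_all add: square_integrable_def)
  have sgn_le: "norm (t x *\<^sub>R sgn z) \<le> norm (t x)" for x and z :: 'b
    by (simp add: norm_sgn)
  have sgn_meas: "(\<lambda>x. t x *\<^sub>R sgn (F x)) \<in> borel_measurable lebesgue" if "F \<in> borel_measurable lebesgue" for F :: "'a \<Rightarrow> 'b"
    unfolding sgn_div_norm using that t_meas
    by measurable
  have B: "square_integrable (B s)" for s
    unfolding B_def
    by (rule square_integrable_bound[OF t]) (auto intro!: sgn_meas borel_measurable_add borel_measurable_scaleR Y_meas H_meas simp: norm_sgn)
  have "Y -` {0} \<inter> space lebesgue \<in> sets lebesgue"
    using Y_meas by (rule measurable_sets) simp
  then have "(\<lambda>x. if Y x = 0 then H x else Y x) \<in> borel_measurable lebesgue"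
    using Y_meas H_meas by (intro measurable_If) (simp_all add: vimage_def Int_def conj_commute)
  then have B0: "square_integrable B0"
    unfolding B0_def by (intro square_integrable_bound[OF t] sgn_meas AE_I2 sgn_le)
  have "(abs_l2 (rep_l2 d), abs_l2 B0) \<in> subdiff"
    unfolding abs_l2_subdiff_iff[OF square_integrable_rep_l2 B0] Y_def[symmetric]
    using t_nonneg
  proof eventually_elim
    case (elim x)
    have "sgn z \<bullet> z = norm z" for z :: 'b
      by (cases "z = 0") (simp_all add: sgn_div_norm power2_norm_eq_inner[symmetric] power2_eq_square)
    then show ?case
      using elim by (auto simp: B0_def norm_sgn)
  qed
  then have sub: "(d, abs_l2 B0) \<in> subdiff"
    by (simp add: abs_rep_l2)
  have pos: "0 \<le> (LINT x|lebesgue. B s x \<bullet> H x)" if s: "s > 0" for s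
  proof -
    have sH: "square_integrable (\<lambda>x. Y x + s *\<^sub>R H x)" "square_integrable (\<lambda>x. rep_l2 d x + s *\<^sub>R H x)"
      by (intro square_integrable_add square_integrable_scaleR Y H square_integrable_rep_l2)+
    have "d + s *\<^sub>R h = abs_l2 (\<lambda>x. rep_l2 d x + s *\<^sub>R H x)"
      using abs_l2_scaleR[OF square_integrable_rep_l2, of s h]
        abs_l2_add[OF square_integrable_rep_l2 square_integrable_scaleR[OF square_integrable_rep_l2], of d s h]
      by (simp add: abs_rep_l2 H_def)
    then have "weighted_l1 (d + s *\<^sub>R h) = (LINT x|lebesgue. t x * norm (Y x + s *\<^sub>R H x))"
      using abs_l2_weighted_l1[OF sH(2)] by (simp add: Y_def algebra_simps)
    then have "0 \<le> (LINT x|lebesgue. t x * norm (Y x + s *\<^sub>R H x)) - (LINT x|lebesgue. t x * norm (Y x))"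
      using min[OF s] by (simp add: weighted_l1_def Y_def)
    also have "\<dots> = (LINT x|lebesgue. t x * norm (Y x + s *\<^sub>R H x) - t x * norm (Y x))"
      by (rule Bochner_Integration.integral_diff[symmetric, OF weighted_l1_integrable[OF sH(1)] weighted_l1_integrable[OF Y]])
    also have "\<dots> \<le> (LINT x|lebesgue. s * (B s x \<bullet> H x))"
    proof (rule integral_mono_AE)
      show "integrable lebesgue (\<lambda>x. t x * norm (Y x + s *\<^sub>R H x) - t x * norm (Y x))"
        by (intro Bochner_Integration.integrable_diff weighted_l1_integrable sH Y)
      show "integrable lebesgue (\<lambda>x. s * (B s x \<bullet> H x))"
        by (intro integrable_mult_right square_integrable_inner B H)
      show "AE x in lebesgue. t x * norm (Y x + s *\<^sub>R H x) - t x * norm (Y x) \<le> s * (B s x \<bullet> H x)"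
        using t_nonneg
      proof eventually_elim
        case (elim x)
        define z where "z = Y x + s *\<^sub>R H x"
        have "sgn z \<bullet> z = norm z"
          by (cases "z = 0") (simp_all add: sgn_div_norm power2_norm_eq_inner[symmetric] power2_eq_square)
        moreover have "sgn z \<bullet> Y x \<le> norm (Y x)"
          using norm_cauchy_schwarz[of "sgn z" "Y x"] by (cases "z = 0") (simp_all add: norm_sgn)
        moreover have "s *\<^sub>R H x = z - Y x"
          by (simp add: z_def)
        then have "s * (sgn z \<bullet> H x) = sgn z \<bullet> z - sgn z \<bullet> Y x"
          by (metis inner_diff_right inner_scaleR_right)
        ultimately have "norm z - norm (Y x) \<le> s * (sgn z \<bullet> H x)"
          by linarith
        then have "t x * (norm z - norm (Y x)) \<le> t x * (s * (sgn z \<bullet> H x))"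
          using elim by (rule mult_left_mono)
        then show ?case
          by (simp add: B_def z_def[symmetric] algebra_simps)
      qed
    qed
    also have "\<dots> = s * (LINT x|lebesgue. B s x \<bullet> H x)"
      by simp
    finally show ?thesis
      using s by (simp add: zero_le_mult_iff)
  qed
  have "(\<lambda>n. LINT x|lebesgue. B (inverse (real (Suc n))) x \<bullet> H x) \<longlonglongrightarrow> (LINT x|lebesgue. B0 x \<bullet> H x)"
  proof (rule integral_dominated_convergence)
    show "(\<lambda>x. B0 x \<bullet> H x) \<in> borel_measurable lebesgue"
      "(\<lambda>x. B (inverse (real (Suc n))) x \<bullet> H x) \<in> borel_measurable lebesgue" for n
      using square_integrable_inner[OF B0 H] square_integrable_inner[OF B H] by auto
    show "integrable lebesgue (\<lambda>x. t x * norm (H x))"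
      by (rule weighted_l1_integrable[OF H])
    have "(\<lambda>n. B (inverse (real (Suc n))) x \<bullet> H x) \<longlonglongrightarrow> B0 x \<bullet> H x" for x
    proof (cases "Y x = 0")
      case True
      then have "B (inverse (real (Suc n))) x = B0 x" for n
        by (simp add: B_def B0_def sgn_scaleR)
      then show ?thesis
        by simp
    next
      case False
      have "(\<lambda>n. Y x + inverse (real (Suc n)) *\<^sub>R H x) \<longlonglongrightarrow> Y x + 0 *\<^sub>R H x"
        by (intro tendsto_intros LIMSEQ_inverse_real_of_nat)
      then have "(\<lambda>n. sgn (Y x + inverse (real (Suc n)) *\<^sub>R H x)) \<longlonglongrightarrow> sgn (Y x)"
        using False by (intro tendsto_sgn) simp_all
      then show ?thesis
        unfolding B_def B0_def using False by (auto intro!: tendsto_intros)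
    qed
    then show "AE x in lebesgue. (\<lambda>n. B (inverse (real (Suc n))) x \<bullet> H x) \<longlonglongrightarrow> B0 x \<bullet> H x"
      by simp
    show "AE x in lebesgue. norm (B (inverse (real (Suc n))) x \<bullet> H x) \<le> t x * norm (H x)" for n
      using t_nonneg
    proof eventually_elim
      case (elim x)
      have "\<bar>B s x \<bullet> H x\<bar> \<le> norm (B s x) * norm (H x)" for s
        by (rule Cauchy_Schwarz_ineq2)
      also have "norm (B s x) * norm (H x) \<le> t x * norm (H x)" for s
        unfolding B_def using sgn_le[of x] elim by (intro mult_right_mono) auto
      finally show ?case
        by simp
    qed
  qed
  then have "0 \<le> (LINT x|lebesgue. B0 x \<bullet> H x)"
    using pos by (intro LIMSEQ_le_const) auto
  moreover have "abs_l2 B0 \<bullet> h = (LINT x|lebesgue. B0 x \<bullet> H x)"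
    using abs_l2_inner[OF B0 H] by (simp add: H_def abs_rep_l2)
  ultimately show ?thesis
    using sub by auto
qed

lemma minimizer_has_orthogonal_subgradient:
  assumes "subspace V" "closed V" "\<And>h. h \<in> V \<Longrightarrow> weighted_l1 d \<le> weighted_l1 (d + h)"
  shows "\<exists>b. (d, b) \<in> subdiff \<and> (\<forall>h\<in>V. b \<bullet> h = 0)"
proof -
  have "\<exists>c\<in>{b. (d, b) \<in> subdiff}. c \<bullet> h \<ge> 0" if "h \<in> V" for h
    using directional_subgradient[of d h] assms(3) subspace_scale[OF assms(1) that] by auto
  then show ?thesis
    using convex_set_meets_orthogonal_complement[OF assms(1,2) subdiff_values(2,1)[of d], of "norm (abs_l2 t)"]
      subdiff_norm_le by (metis mem_Collect_eq)
qed

end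

section \<open>Convergence of the alternating split Bregman algorithm\<close>

locale least_gradient_problem = bounded_domain \<Omega> for \<Omega> :: "(real^'n) set" +
  fixes a :: "real^'n \<Rightarrow> real" and lam :: real and uf :: "real^'n \<Rightarrow> real"
  assumes a: "a \<in> L2 \<Omega>" and a_nonneg: "AE x in lebesgue_on \<Omega>. 0 \<le> a x"
    and lam: "lam > 0" and uf: "uf \<in> H1 \<Omega>"
begin

definition thr :: "real^'n \<Rightarrow> real" where
  "thr x = zero_ext \<Omega> a x / lam"

definition guf :: "real^'n \<Rightarrow> real^'n" where
  "guf = zero_ext \<Omega> (wgrad \<Omega> uf)"

lemma square_integrable_thr: "square_integrable thr"
proof -
  have "thr = (\<lambda>x. (1 / lam) *\<^sub>R zero_ext \<Omega> a x)"
    by (rule ext) (simp add: thr_def)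
  then show ?thesis
    using a square_integrable_scaleR[of "zero_ext \<Omega> a" "1 / lam"]
    by (simp only: L2_iff_square_integrable[OF sets_domain])
qed

lemma thr_nonneg: "AE x in lebesgue. 0 \<le> thr x"
  using a_nonneg unfolding AE_lebesgue_on_iff[OF sets_domain]
  by eventually_elim (use lam in \<open>auto simp: thr_def zero_ext_def indicator_def\<close>)

lemma square_integrable_guf: "square_integrable guf"
  using wgrad_L2[OF uf] unfolding guf_def by (simp add: L2_iff_square_integrable[OF sets_domain])

sublocale weighted_norm thr guf
  by (rule weighted_norm.intro[OF square_integrable_thr thr_nonneg square_integrable_guf])

lemma rep_class: "F \<in> L2 \<Omega> \<Longrightarrow> AE x in lebesgue. rep_l2 (l2_class \<Omega> F) x = zero_ext \<Omega> F x"
  by (rule rep_l2_l2_class[OF sets_domain])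

text \<open>
Elements of V are gradients of w - u_f for functions w with the given boundary values; adding \<nabla>u_f
recovers \<nabla>w.
\<close>

lemma translate_gradient:
  assumes "w \<in> H1 \<Omega>" "(\<lambda>x. w x - uf x) \<in> H10 \<Omega>"
  shows "AE x in lebesgue. rep_l2 (l2_class \<Omega> (wgrad \<Omega> (\<lambda>x. w x - uf x))) x + guf x = zero_ext \<Omega> (wgrad \<Omega> w) x"
proof -
  have "l2_class \<Omega> (wgrad \<Omega> (\<lambda>x. w x - uf x)) = l2_class \<Omega> (\<lambda>x. wgrad \<Omega> w x - wgrad \<Omega> uf x)"
    using H1_diff[OF assms(1) uf] l2_class_diff[OF sets_domain wgrad_L2[OF assms(1)] wgrad_L2[OF uf]]
    by (simp add: jet_def)
  then have "AE x in lebesgue. rep_l2 (l2_class \<Omega> (wgrad \<Omega> (\<lambda>x. w x - uf x))) x =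
      zero_ext \<Omega> (\<lambda>x. wgrad \<Omega> w x - wgrad \<Omega> uf x) x"
    using rep_class[OF L2_diff[OF sets_domain wgrad_L2[OF assms(1)] wgrad_L2[OF uf]]] by simp
  then show ?thesis
    by eventually_elim (simp add: guf_def zero_ext_def scaleR_diff_right)
qed

lemma weighted_l1_energy:
  assumes "w \<in> H1 \<Omega>" "(\<lambda>x. w x - uf x) \<in> H10 \<Omega>"
  shows "weighted_l1 (l2_class \<Omega> (wgrad \<Omega> (\<lambda>x. w x - uf x))) = energy \<Omega> a w / lam"
proof -
  let ?d = "l2_class \<Omega> (wgrad \<Omega> (\<lambda>x. w x - uf x))"
  have w: "square_integrable (zero_ext \<Omega> (wgrad \<Omega> w))"
    using wgrad_L2[OF assms(1)] by (simp add: L2_iff_square_integrable[OF sets_domain])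
  have "weighted_l1 ?d = (LINT x|lebesgue. thr x * norm (zero_ext \<Omega> (wgrad \<Omega> w) x))"
    unfolding weighted_l1_def
  proof (rule integral_cong_AE)
    show "(\<lambda>x. thr x * norm (rep_l2 ?d x + guf x)) \<in> borel_measurable lebesgue"
      by (intro borel_measurable_integrable weighted_l1_integrable square_integrable_add square_integrable_rep_l2 square_integrable_guf)
    show "(\<lambda>x. thr x * norm (zero_ext \<Omega> (wgrad \<Omega> w) x)) \<in> borel_measurable lebesgue"
      by (intro borel_measurable_integrable weighted_l1_integrable w)
    show "AE x in lebesgue. thr x * norm (rep_l2 ?d x + guf x) = thr x * norm (zero_ext \<Omega> (wgrad \<Omega> w) x)"
      using translate_gradient[OF assms] by eventually_elim simp
  qed
  also have "\<dots> = (LINT x|lebesgue. (indicator \<Omega> x *\<^sub>R (a x * norm (wgrad \<Omega> w x))) / lam)"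
    by (intro Bochner_Integration.integral_cong refl) (simp add: thr_def zero_ext_def indicator_def)
  also have "\<dots> = energy \<Omega> a w / lam"
    unfolding energy_def using sets_domain by (simp add: integral_restrict_space del: real_scaleR_def)
  finally show ?thesis .
qed

text \<open>
Functions with the boundary values of u_f differ by elements of H10, so minimizing over them amounts to
minimizing the weighted norm over a translate of V.
\<close>

lemma solution_iff:
  assumes "v \<in> H1 \<Omega>" "(\<lambda>x. v x - uf x) \<in> H10 \<Omega>"
  shows "least_gradient_solution \<Omega> a (bdry_trace \<Omega> uf) v \<longleftrightarrow>
    (\<forall>h\<in>gradients0. weighted_l1 (l2_class \<Omega> (wgrad \<Omega> (\<lambda>x. v x - uf x))) \<le>
       weighted_l1 (l2_class \<Omega> (wgrad \<Omega> (\<lambda>x. v x - uf x)) + h))"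
    (is "_ \<longleftrightarrow> (\<forall>h\<in>gradients0. weighted_l1 ?d \<le> weighted_l1 (?d + h))")
proof
  assume sol: "least_gradient_solution \<Omega> a (bdry_trace \<Omega> uf) v"
  show "\<forall>h\<in>gradients0. weighted_l1 ?d \<le> weighted_l1 (?d + h)"
  proof
    fix h
    assume "h \<in> gradients0"
    then obtain \<psi> where \<psi>: "\<psi> \<in> H10 \<Omega>" "l2_class \<Omega> (wgrad \<Omega> \<psi>) = h"
      using gradients0_H10 by blast
    define w where "w x = v x + \<psi> x" for x
    have w: "w \<in> H1 \<Omega>"
      unfolding w_def using H1_add[OF assms(1) H10_H1[OF \<psi>(1)]] by blast
    have eq: "(\<lambda>x. w x - uf x) = (\<lambda>x. (v x - uf x) + \<psi> x)"
      by (rule ext) (simp add: w_def)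
    have w_uf: "(\<lambda>x. w x - uf x) \<in> H10 \<Omega>"
      unfolding eq using H10_add[OF assms(2) \<psi>(1)] .
    have "?d + h = l2_class \<Omega> (wgrad \<Omega> (\<lambda>x. w x - uf x))"
      unfolding eq using H1_add[OF H10_H1[OF assms(2)] H10_H1[OF \<psi>(1)]] by (simp add: jet_def \<psi>(2))
    moreover have "energy \<Omega> a v \<le> energy \<Omega> a w"
      using sol w w_uf bdry_trace_eq_iff[OF w uf] by (simp add: least_gradient_solution_def)
    ultimately show "weighted_l1 ?d \<le> weighted_l1 (?d + h)"
      using weighted_l1_energy[OF assms] weighted_l1_energy[OF w w_uf] lam by (simp add: divide_right_mono)
  qed
next
  assume min: "\<forall>h\<in>gradients0. weighted_l1 ?d \<le> weighted_l1 (?d + h)"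
  have "energy \<Omega> a v \<le> energy \<Omega> a w" if w: "w \<in> H1 \<Omega>" "bdry_trace \<Omega> w = bdry_trace \<Omega> uf" for w
  proof -
    have w_uf: "(\<lambda>x. w x - uf x) \<in> H10 \<Omega>"
      using bdry_trace_eq_iff[OF w(1) uf] w(2) by blast
    let ?e = "l2_class \<Omega> (wgrad \<Omega> (\<lambda>x. w x - uf x))"
    have "?e - ?d \<in> gradients0"
      by (intro subspace_diff subspace_gradients0 H10_gradients0 w_uf assms)
    then have "weighted_l1 ?d \<le> weighted_l1 (?d + (?e - ?d))"
      using min by blast
    then show ?thesis
      using weighted_l1_energy[OF assms] weighted_l1_energy[OF w(1) w_uf] lam by (simp add: divide_le_cancel)
  qed
  then show "least_gradient_solution \<Omega> a (bdry_trace \<Omega> uf) v"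
    using assms bdry_trace_eq_iff[OF assms(1) uf] by (simp add: least_gradient_solution_def)
qed

text \<open>
By the Poincare inequality a function in H10 is determined by its gradient, and u \<mapsto> u \<bullet> y is a
bounded linear functional of the gradient.
\<close>

lemma riesz_representation_H10:
  assumes "y \<in> L2 \<Omega>"
  obtains z where "\<And>u. u \<in> H10 \<Omega> \<Longrightarrow> l2_class \<Omega> u \<bullet> l2_class \<Omega> y = z \<bullet> l2_class \<Omega> (wgrad \<Omega> u)"
proof -
  obtain C where C: "\<And>u. u \<in> H10 \<Omega> \<Longrightarrow> norm (l2_class \<Omega> u) \<le> C * norm (l2_class \<Omega> (wgrad \<Omega> u))" "C \<ge> 0"
    using poincare by blast
  define U where "U X = (SOME u. u \<in> H10 \<Omega> \<and> l2_class \<Omega> (wgrad \<Omega> u) = X)" for X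
  define f where "f X = l2_class \<Omega> (U X) \<bullet> l2_class \<Omega> y" for X
  have U: "U X \<in> H10 \<Omega>" "l2_class \<Omega> (wgrad \<Omega> (U X)) = X" if "X \<in> gradients0" for X
  proof -
    have "\<exists>u. u \<in> H10 \<Omega> \<and> l2_class \<Omega> (wgrad \<Omega> u) = X"
      using gradients0_H10[OF that] by blast
    from someI_ex[OF this] show "U X \<in> H10 \<Omega>" "l2_class \<Omega> (wgrad \<Omega> (U X)) = X"
      by (simp_all add: U_def)
  qed
  have f: "f (l2_class \<Omega> (wgrad \<Omega> u)) = l2_class \<Omega> u \<bullet> l2_class \<Omega> y" if u: "u \<in> H10 \<Omega>" for u
  proof -
    let ?v = "U (l2_class \<Omega> (wgrad \<Omega> u))"
    have v: "?v \<in> H10 \<Omega>" "l2_class \<Omega> (wgrad \<Omega> ?v) = l2_class \<Omega> (wgrad \<Omega> u)"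
      using U[OF H10_gradients0[OF u]] by blast+
    have "norm (l2_class \<Omega> ?v - l2_class \<Omega> u) \<le> 0"
      using C(1)[OF H10_diff[OF v(1) u]] by (simp add: H10_gradient_diff[OF v(1) u] v(2))
    then show ?thesis
      by (simp add: f_def)
  qed
  have add: "f (X + Y) = f X + f Y" if XY: "X \<in> gradients0" "Y \<in> gradients0" for X Y
  proof -
    have "l2_class \<Omega> (\<lambda>x. U X x + U Y x) = l2_class \<Omega> (U X) + l2_class \<Omega> (U Y)"
      "l2_class \<Omega> (wgrad \<Omega> (\<lambda>x. U X x + U Y x)) = X + Y"
      using H1_add[OF H10_H1[OF U(1)[OF XY(1)]] H10_H1[OF U(1)[OF XY(2)]]] U(2)[OF XY(1)] U(2)[OF XY(2)]
      by (simp_all add: jet_def)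
    then show ?thesis
      using f[OF H10_add[OF U(1)[OF XY(1)] U(1)[OF XY(2)]]] by (simp add: inner_add_left f_def)
  qed
  have scale: "f (c *\<^sub>R X) = c * f X" if X: "X \<in> gradients0" for X c
  proof -
    have jet: "jet (\<lambda>x. c * U X x) = c *\<^sub>R jet (U X)" and H1: "(\<lambda>x. c * U X x) \<in> H1 \<Omega>"
      using H1_scaleR[OF H10_H1[OF U(1)[OF X]], of c] by blast+
    then have "(\<lambda>x. c * U X x) \<in> H10 \<Omega>"
      using U(1)[OF X] subspace_scale[OF subspace_jets0] by (simp add: H10_iff)
    moreover have "l2_class \<Omega> (\<lambda>x. c * U X x) = c *\<^sub>R l2_class \<Omega> (U X)"
      "l2_class \<Omega> (wgrad \<Omega> (\<lambda>x. c * U X x)) = c *\<^sub>R X"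
      using jet U(2)[OF X] by (simp_all add: jet_def)
    ultimately show ?thesis
      using f[of "\<lambda>x. c * U X x"] by (simp add: f_def)
  qed
  have bound: "\<bar>f X\<bar> \<le> (C * norm (l2_class \<Omega> y)) * norm X" if X: "X \<in> gradients0" for X
  proof -
    have "\<bar>f X\<bar> \<le> norm (l2_class \<Omega> (U X)) * norm (l2_class \<Omega> y)"
      unfolding f_def by (rule Cauchy_Schwarz_ineq2)
    also have "\<dots> \<le> (C * norm X) * norm (l2_class \<Omega> y)"
      using C(1)[OF U(1)[OF X]] U(2)[OF X] by (intro mult_right_mono) auto
    finally show ?thesis
      by (simp add: algebra_simps)
  qed
  obtain z where "\<And>X. X \<in> gradients0 \<Longrightarrow> f X = z \<bullet> X"
    using riesz_representation_subspace[OF subspace_gradients0 closed_gradients0, of f, OF add scale bound] by metis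
  then have "l2_class \<Omega> u \<bullet> l2_class \<Omega> y = z \<bullet> l2_class \<Omega> (wgrad \<Omega> u)" if "u \<in> H10 \<Omega>" for u
    using f[OF that] H10_gradients0[OF that] by simp
  then show ?thesis
    by (rule that)
qed

text \<open>
The previous lemma expresses the inner product of H1 through the gradients alone.
\<close>

lemma weakly_converges_H10:
  assumes "\<And>k. u k \<in> H10 \<Omega>" "w \<in> H10 \<Omega>"
    and lim: "\<And>X. (\<lambda>k. l2_class \<Omega> (wgrad \<Omega> (u k)) \<bullet> X) \<longlonglongrightarrow> l2_class \<Omega> (wgrad \<Omega> w) \<bullet> X"
  shows "weakly_converges (H10 \<Omega>) (H1_inner \<Omega>) u w"
  unfolding weakly_converges_def
proof (intro conjI allI ballI)
  fix y
  assume y: "y \<in> H10 \<Omega>"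
  obtain z where z: "\<And>u. u \<in> H10 \<Omega> \<Longrightarrow> l2_class \<Omega> u \<bullet> l2_class \<Omega> y = z \<bullet> l2_class \<Omega> (wgrad \<Omega> u)"
    using riesz_representation_H10[OF H1_L2[OF H10_H1[OF y]]] by blast
  have "H1_inner \<Omega> v y = l2_class \<Omega> (wgrad \<Omega> v) \<bullet> (z + l2_class \<Omega> (wgrad \<Omega> y))" if "v \<in> H10 \<Omega>" for v
    using H1_inner_jet[OF H10_H1[OF that] H10_H1[OF y]] z[OF that]
    by (simp add: jet_def inner_prod_def inner_add_right inner_commute)
  then show "(\<lambda>k. H1_inner \<Omega> (u k) y) \<longlonglongrightarrow> H1_inner \<Omega> w y"
    using lim assms(1,2) by simp
qed (use assms in auto)

end

text \<open>
The equality case of the Cauchy-Schwarz inequality: with e = g / |g| one gets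
|\<beta> - \<tau> e|^2 \<le> \<tau>^2 - 2 \<tau>^2 + \<tau>^2 = 0.
\<close>

lemma weighted_direction_unique:
  fixes \<beta> g :: "'b::real_inner"
  assumes "norm \<beta> \<le> \<tau>" "\<beta> \<bullet> g = \<tau> * norm g" "g \<noteq> 0"
  shows "\<beta> = \<tau> *\<^sub>R (g /\<^sub>R norm g)"
proof -
  define e where "e = g /\<^sub>R norm g"
  have e: "e \<bullet> e = 1" "\<beta> \<bullet> e = \<tau>"
    using assms(2,3) by (simp_all add: e_def power2_norm_eq_inner[symmetric] power2_eq_square field_simps)
  have "0 \<le> \<tau>"
    using assms(1) norm_ge_zero order_trans by blast
  have "(norm \<beta>)\<^sup>2 \<le> \<tau>\<^sup>2"
    using assms(1) by (intro power_mono) auto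
  then have "(\<beta> - \<tau> *\<^sub>R e) \<bullet> (\<beta> - \<tau> *\<^sub>R e) \<le> 0"
    using e unfolding power2_norm_eq_inner
    by (simp add: inner_diff_left inner_diff_right inner_commute power2_eq_square)
  then have "\<beta> - \<tau> *\<^sub>R e = 0"
    by (metis inner_ge_zero inner_eq_zero_iff order_antisym)
  then show ?thesis
    by (simp add: e_def)
qed

theorem theorem1p1:
  fixes \<Omega> :: "(real^'n) set"
    and a :: "real^'n \<Rightarrow> real"
    and f :: "(real^'n \<Rightarrow> real) set"
    and lam :: real
    and uf :: "real^'n \<Rightarrow> real"
    and u :: "nat \<Rightarrow> real^'n \<Rightarrow> real"
    and d b :: "nat \<Rightarrow> real^'n \<Rightarrow> real^'n"
  assumes "CARD('n) \<ge> 2"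
    and "open \<Omega>" "connected \<Omega>" "\<Omega> \<noteq> {}" "bounded \<Omega>"
    and "a \<in> L2 \<Omega>" "AE x in lebesgue_on \<Omega>. 0 \<le> a x"
    and "f \<in> H_half \<Omega>"
    and "lam > 0"
    and "\<exists>v. least_gradient_solution \<Omega> a f v"
    and "uf \<in> H1 \<Omega>" "bdry_trace \<Omega> uf = f"
    and "b 0 \<in> L2 \<Omega>" "d 0 \<in> L2 \<Omega>"
    and "split_bregman \<Omega> a lam uf u d b"
  shows "\<exists>bh dh uh.
      weakly_converges (L2 \<Omega>) (L2_inner \<Omega>) b bh \<and>
      weakly_converges (L2 \<Omega>) (L2_inner \<Omega>) d dh \<and>
      weakly_converges (H10 \<Omega>) (H1_inner \<Omega>) (\<lambda>k. u (Suc k)) uh \<and>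
      (\<lambda>k. L2_norm \<Omega> (\<lambda>x. wgrad \<Omega> (u (Suc k)) x - d k x)) \<longlonglongrightarrow> 0 \<and>
      summable (\<lambda>k. (L2_norm \<Omega> (\<lambda>x. wgrad \<Omega> (u (Suc k)) x - d k x))\<^sup>2) \<and>
      least_gradient_solution \<Omega> a f (\<lambda>x. uh x + uf x) \<and>
      (AE x in lebesgue_on \<Omega>. dh x = wgrad \<Omega> uh x) \<and>
      (\<forall>\<phi>\<in>test_functions \<Omega>. distr_div \<Omega> bh \<phi> = 0) \<and>
      (AE x in lebesgue_on \<Omega>.
         let g = wgrad \<Omega> (\<lambda>y. uh y + uf y) x in
         \<not> (norm g = 0 \<and> a x \<noteq> 0) \<longrightarrow>
         bh x = (if a x = 0 then 0 else (1 / lam * a x) *\<^sub>R (g /\<^sub>R norm g)))"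
proof -
  interpret least_gradient_problem \<Omega> a lam uf
    using assms by unfold_locales
  have f: "f = bdry_trace \<Omega> uf"
    using assms by simp
  define cl :: "(real^'n \<Rightarrow> real^'n) \<Rightarrow> (real^'n, real^'n) l2" where "cl = l2_class \<Omega>"
  \<comment> \<open>The argument of the soft thresholding in step k + 1.\<close>
  define ws where "ws k x = wgrad \<Omega> (u (Suc k)) x + wgrad \<Omega> uf x + b k x" for k x
  have uS: "u (Suc k) \<in> H10 \<Omega>"
    and u_eq: "\<And>\<psi>. \<psi> \<in> H10 \<Omega> \<Longrightarrow> L2_inner \<Omega> (wgrad \<Omega> (u (Suc k))) (wgrad \<Omega> \<psi>) = L2_inner \<Omega> (\<lambda>x. d k x - b k x) (wgrad \<Omega> \<psi>)"
    and dS: "AE x in lebesgue_on \<Omega>. d (Suc k) x = shrink (a x / lam) (ws k x) - wgrad \<Omega> uf x"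
    and bS: "AE x in lebesgue_on \<Omega>. b (Suc k) x = b k x + wgrad \<Omega> (u (Suc k)) x - d (Suc k) x" for k
    using assms(15) unfolding split_bregman_def weak_poisson_solution_def Let_def shrink_eq_algorithm ws_def by blast+
  have gu: "wgrad \<Omega> (u (Suc k)) \<in> L2 \<Omega>" for k
    by (rule wgrad_L2[OF H10_H1[OF uS]])
  have shr: "(\<lambda>x. shrink (a x / lam) (F x)) \<in> L2 \<Omega>" if "F \<in> L2 \<Omega>" for F :: "real^'n \<Rightarrow> real^'n"
  proof -
    have "zero_ext \<Omega> (\<lambda>x. shrink (a x / lam) (F x)) = (\<lambda>x. shrink (thr x) (zero_ext \<Omega> F x))"
      by (rule ext) (simp add: zero_ext_def thr_def indicator_def shrink_def)
    then show ?thesis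
      using that square_integrable_shrink[OF _ square_integrable_measurable[OF square_integrable_thr] thr_nonneg]
      by (simp add: L2_iff_square_integrable[OF sets_domain])
  qed
  have db_L2: "d k \<in> L2 \<Omega> \<and> b k \<in> L2 \<Omega>" for k
  proof (induction k)
    case (Suc k)
    have "ws k \<in> L2 \<Omega>"
      unfolding ws_def[abs_def] using Suc by (intro L2_add sets_domain gu wgrad_L2 uf) auto
    then have d: "d (Suc k) \<in> L2 \<Omega>"
      by (intro L2_cong_AE[OF sets_domain _ dS] L2_diff sets_domain shr wgrad_L2 uf)
    moreover have "b (Suc k) \<in> L2 \<Omega>"
      using Suc d by (intro L2_cong_AE[OF sets_domain _ bS] L2_diff L2_add sets_domain gu) auto
    ultimately show ?case
      by simp
  qed (use assms in simp)
  then have dL: "d k \<in> L2 \<Omega>" and bL: "b k \<in> L2 \<Omega>" for k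
    by auto
  interpret split_bregman_iteration gradients0 subdiff "\<lambda>k. cl (wgrad \<Omega> (u k))" "\<lambda>k. cl (d k)" "\<lambda>k. cl (b k)"
  proof
    show "subspace gradients0" "closed gradients0"
      by (rule subspace_gradients0 closed_gradients0)+
    show "0 \<le> (c - c') \<bullet> (y - y')" if "(y, c) \<in> subdiff" "(y', c') \<in> subdiff" for y c y' c'
      using that by (rule subdiff_monotone)
    show "\<exists>y. (y, w - y) \<in> subdiff" for w
      by (rule subdiff_resolvent)
    show "cl (wgrad \<Omega> (u (Suc k))) \<in> gradients0" for k
      unfolding cl_def by (rule H10_gradients0[OF uS])
    show "cl (wgrad \<Omega> (u (Suc k))) \<bullet> h = (cl (d k) - cl (b k)) \<bullet> h" if h: "h \<in> gradients0" for k h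
    proof -
      obtain \<psi> where \<psi>: "\<psi> \<in> H10 \<Omega>" "l2_class \<Omega> (wgrad \<Omega> \<psi>) = h"
        using gradients0_H10[OF h] by blast
      have \<psi>L: "wgrad \<Omega> \<psi> \<in> L2 \<Omega>"
        by (rule wgrad_L2[OF H10_H1[OF \<psi>(1)]])
      show ?thesis
        using u_eq[OF \<psi>(1), of k] l2_class_inner[OF sets_domain gu \<psi>L, of k]
          l2_class_inner[OF sets_domain L2_diff[OF sets_domain dL bL] \<psi>L, of k k]
        unfolding cl_def \<psi>(2) l2_class_diff[OF sets_domain dL bL] by simp
    qed
    show "cl (b (Suc k)) + cl (d (Suc k)) = cl (b k) + cl (wgrad \<Omega> (u (Suc k)))" for k
      unfolding cl_def l2_class_add[OF sets_domain bL dL, symmetric] l2_class_add[OF sets_domain bL gu, symmetric]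
        l2_class_eq_iff[OF sets_domain L2_add[OF sets_domain bL dL] L2_add[OF sets_domain bL gu]]
      using bS[of k] by eventually_elim simp
    show "(cl (d (Suc k)), cl (b (Suc k))) \<in> subdiff" for k
    proof -
      have sq: "square_integrable (zero_ext \<Omega> (d (Suc k)))" "square_integrable (zero_ext \<Omega> (b (Suc k)))"
        using dL bL by (simp_all add: L2_iff_square_integrable[OF sets_domain])
      show ?thesis
        unfolding cl_def l2_class_def abs_l2_subdiff_iff[OF sq]
        using dS[of k, unfolded AE_lebesgue_on_iff[OF sets_domain]] bS[of k, unfolded AE_lebesgue_on_iff[OF sets_domain]]
          a_nonneg[unfolded AE_lebesgue_on_iff[OF sets_domain]]
      proof eventually_elim
        case (elim x)
        show ?case
        proof (cases "x \<in> \<Omega>")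
          case True
          define y where "y = shrink (a x / lam) (ws k x)"
          have "d (Suc k) x = y - wgrad \<Omega> uf x" "b (Suc k) x = ws k x - y"
            using elim True by (simp_all add: y_def ws_def)
          moreover have "0 \<le> a x / lam"
            using elim(3) True lam by simp
          ultimately show ?thesis
            using True shrink_resolvent(1,2)[of "a x / lam" "ws k x"]
            by (simp add: zero_ext_def thr_def guf_def y_def[symmetric])
        qed (simp add: zero_ext_def thr_def guf_def)
      qed
    qed
  qed
  have nonempty: "saddle \<noteq> {}"
  proof -
    obtain v where v: "least_gradient_solution \<Omega> a (bdry_trace \<Omega> uf) v"
      using assms(10) f by blast
    then have v': "v \<in> H1 \<Omega>" "(\<lambda>x. v x - uf x) \<in> H10 \<Omega>"
      using bdry_trace_eq_iff[OF _ uf, of v] by (auto simp: least_gradient_solution_def)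
    let ?d = "l2_class \<Omega> (wgrad \<Omega> (\<lambda>x. v x - uf x))"
    obtain c where "(?d, c) \<in> subdiff" "\<forall>h\<in>gradients0. c \<bullet> h = 0"
      using minimizer_has_orthogonal_subgradient[OF subspace_gradients0 closed_gradients0, of ?d] solution_iff[OF v'] v
      by blast
    then have "(c, ?d) \<in> saddle"
      using H10_gradients0[OF v'(2)] by (simp add: saddle_def)
    then show ?thesis
      by blast
  qed
  obtain p q where pq: "(p, q) \<in> saddle" and lim_b: "\<And>y. (\<lambda>k. cl (b k) \<bullet> y) \<longlonglongrightarrow> p \<bullet> y"
    and lim_d: "\<And>y. (\<lambda>k. cl (d k) \<bullet> y) \<longlonglongrightarrow> q \<bullet> y"
    and lim_u: "\<And>y. (\<lambda>k. cl (wgrad \<Omega> (u (Suc k))) \<bullet> y) \<longlonglongrightarrow> q \<bullet> y"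
    using weak_convergence[OF nonempty] by metis
  have q: "q \<in> gradients0" and p: "\<And>h. h \<in> gradients0 \<Longrightarrow> p \<bullet> h = 0" and sub: "(q, p) \<in> subdiff"
    using pq by (auto simp: saddle_def)
  obtain uh where uh: "uh \<in> H10 \<Omega>" "cl (wgrad \<Omega> uh) = q"
    using gradients0_H10[OF q] unfolding cl_def by blast
  define bh where "bh = rep_l2 p"
  define dh where "dh = wgrad \<Omega> uh"
  define ub where "ub x = uh x + uf x" for x
  have bh: "bh \<in> L2 \<Omega>"
    unfolding bh_def by (rule L2_rep_l2[OF sets_domain])
  have dh: "dh \<in> L2 \<Omega>"
    unfolding dh_def by (rule wgrad_L2[OF H10_H1[OF uh(1)]])
  have sub_AE: "AE x in lebesgue. norm (bh x) \<le> thr x \<and> bh x \<bullet> (rep_l2 q x + guf x) = thr x * norm (rep_l2 q x + guf x)"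
    using sub unfolding subdiff_def bh_def by simp
  have cl_bh: "cl bh = p"
  proof -
    \<comment> \<open>The threshold vanishes outside of the domain, and so does the limit.\<close>
    have "AE x in lebesgue. zero_ext \<Omega> bh x = rep_l2 p x"
      using sub_AE by eventually_elim (auto simp: zero_ext_def thr_def bh_def indicator_def)
    then have "abs_l2 (zero_ext \<Omega> bh) = abs_l2 (rep_l2 p)"
      using bh square_integrable_rep_l2[of p] by (simp add: abs_l2_eq_iff L2_iff_square_integrable[OF sets_domain])
    then show ?thesis
      by (simp add: cl_def l2_class_def abs_rep_l2)
  qed
  have ub: "ub \<in> H1 \<Omega>"
    unfolding ub_def using H1_add[OF H10_H1[OF uh(1)] uf] by blast
  have ub_uf: "(\<lambda>x. ub x - uf x) = uh"
    by (rule ext) (simp add: ub_def)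
  have conv_b: "weakly_converges (L2 \<Omega>) (L2_inner \<Omega>) b bh"
    unfolding weakly_converges_def using bL bh lim_b cl_bh
    by (simp add: l2_class_inner[OF sets_domain, symmetric] cl_def)
  have conv_d: "weakly_converges (L2 \<Omega>) (L2_inner \<Omega>) d dh"
    unfolding weakly_converges_def using dL dh lim_d uh(2)
    by (simp add: l2_class_inner[OF sets_domain, symmetric] cl_def dh_def)
  have conv_u: "weakly_converges (H10 \<Omega>) (H1_inner \<Omega>) (\<lambda>k. u (Suc k)) uh"
    using uS uh lim_u by (intro weakly_converges_H10) (auto simp: cl_def)
  have res: "L2_norm \<Omega> (\<lambda>x. wgrad \<Omega> (u (Suc k)) x - d k x) = norm (cl (wgrad \<Omega> (u (Suc k))) - cl (d k))" for k
    unfolding cl_def l2_class_norm[OF sets_domain L2_diff[OF sets_domain gu dL], symmetric]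
      l2_class_diff[OF sets_domain gu dL] ..
  have sol: "least_gradient_solution \<Omega> a f (\<lambda>x. uh x + uf x)"
  proof -
    have "weighted_l1 q \<le> weighted_l1 (q + h)" if "h \<in> gradients0" for h
      using subgradient_inequality[OF sub, of "q + h"] p[OF that] by simp
    then have "least_gradient_solution \<Omega> a (bdry_trace \<Omega> uf) ub"
      using solution_iff[of ub] ub uh unfolding ub_uf cl_def by simp
    then show ?thesis
      by (simp add: f ub_def[abs_def])
  qed
  have div: "distr_div \<Omega> bh \<phi> = 0" if \<phi>: "\<phi> \<in> test_functions \<Omega>" for \<phi>
  proof -
    have "l2_class \<Omega> (grad \<phi>) = l2_class \<Omega> (wgrad \<Omega> \<phi>)"
      using test_functions_H1[OF \<phi>] by (simp add: jet_def)
    then have "p \<bullet> l2_class \<Omega> (grad \<phi>) = 0"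
      using p H10_gradients0[OF test_functions_H10[OF \<phi>]] by simp
    then show ?thesis
      using l2_class_inner[OF sets_domain bh test_functions_grad_L2[OF \<phi> sets_domain]] cl_bh
      by (simp add: cl_def L2_inner_def distr_div_def)
  qed
  have formula: "AE x in lebesgue_on \<Omega>. let g = wgrad \<Omega> (\<lambda>y. uh y + uf y) x in
       \<not> (norm g = 0 \<and> a x \<noteq> 0) \<longrightarrow>
       bh x = (if a x = 0 then 0 else (1 / lam * a x) *\<^sub>R (g /\<^sub>R norm g))"
    unfolding AE_lebesgue_on_iff[OF sets_domain]
    using sub_AE translate_gradient[OF ub, unfolded ub_uf, OF uh(1)]
  proof eventually_elim
    case (elim x)
    define g where "g = wgrad \<Omega> ub x"
    show ?case
      unfolding Let_def ub_def[abs_def, symmetric] g_def[symmetric]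
    proof (intro impI)
      assume x: "x \<in> \<Omega>" and g: "\<not> (norm g = 0 \<and> a x \<noteq> 0)"
      have "norm (bh x) \<le> a x / lam" "bh x \<bullet> g = (a x / lam) * norm g"
        using elim x uh(2) by (simp_all add: thr_def zero_ext_def g_def cl_def)
      then show "bh x = (if a x = 0 then 0 else (1 / lam * a x) *\<^sub>R (g /\<^sub>R norm g))"
        using g weighted_direction_unique[of "bh x" "a x / lam" g] by auto
    qed
  qed
  show ?thesis
    using conv_b conv_d conv_u residual_tendsto_0[OF nonempty] residual_summable[OF nonempty] sol div formula
    by (intro exI[of _ bh] exI[of _ dh] exI[of _ uh]) (simp add: res dh_def)
qed

end
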